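(* For $m\in\{2,3,5\}$, if $r<4m-1$, then $R_r(\mathcal{B}(C_{2m});k)$ and $R_r(\mathcal{B}(C_{2m+1});k)$ are each $\Theta\left(k^{\frac{m}{rm-m-1}}\right)$.
   Context: Here $r$ (an integer) is the uniformity of the hypergraphs, and the asymptotics are as the number of colors $k\to\infty$ with $r$ and $m$ fixed (the implied constants in $\Theta$ may depend on $r$ and $m$ but not on $k$). For a ($2$-uniform) graph $G$, a hypergraph $H$ is a Berge-$G$ if $V(G)\subset V(H)$ and there is a bijection $\phi:E(G)\to E(H)$ such that $e\subset\phi(e)$ for all $e\in E(G)$. $\mathcal{B}(G)$ denotes the family of all hypergraphs that are a Berge-$G$. For a family $\mathcal{F}$ of hypergraphs, $R_r(\mathcal{F};k)$ is the minimum $n$ such that for any edge coloring of the complete $r$-uniform hypergraph on $n$ vertices with $k$ colors there exists a monochromatic subgraph $F$ for some $F\in\mathcal{F}$. $C_\ell$ denotes the cycle of length $\ell$.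
   Formalization: The uniformity is taken to be r ≥ 2 (for r ≤ 1 there are no Berge cycles), and the claim for C_{2m+1} is stated only for r ≥ 3, since for r = 2 it is false: K_{2^k} is a union of k bipartite graphs, so R_2(C_{2m+1};k) > 2^k. *)

theory Defs
  imports Complex_Main "HOL-Library.Ramsey" "HOL-Library.Landau_Symbols"
begin

text \<open>A hypergraph is a pair of a vertex set and a set of edges (so there are no repeated
  edges); graphs are the special case in which all edges have two elements.\<close>

type_synonym 'a hgraph = "'a set \<times> 'a set set"

abbreviation verts :: "'a hgraph \<Rightarrow> 'a set" where "verts \<equiv> fst"

abbreviation hedges :: "'a hgraph \<Rightarrow> 'a set set" where "hedges \<equiv> snd"

definition hypergraph :: "'a hgraph \<Rightarrow> bool" where
  "hypergraph H \<longleftrightarrow> finite (verts H) \<and> (\<forall>e \<in> hedges H. e \<subseteq> verts H)"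

text \<open>Meant for \<open>l \<ge> 3\<close>.\<close>

definition cycle_graph :: "nat \<Rightarrow> nat hgraph" where
  "cycle_graph l = ({..<l}, {{i, (i + 1) mod l} | i. i < l})"

definition is_berge :: "'a hgraph \<Rightarrow> 'a hgraph \<Rightarrow> bool" where
  "is_berge G H \<longleftrightarrow> hypergraph H \<and> verts G \<subseteq> verts H \<and>
     (\<exists>\<phi>. bij_betw \<phi> (hedges G) (hedges H) \<and> (\<forall>e \<in> hedges G. e \<subseteq> \<phi> e))"

definition berge :: "'a hgraph \<Rightarrow> 'a hgraph set" where
  "berge G = {H. is_berge G H}"

text \<open>\<open>contains_copy H F\<close>: some subgraph of \<open>H\<close> is isomorphic to \<open>F\<close>; \<open>g\<close> is the isomorphism
  onto that subgraph. Copies up to isomorphism are needed because the members of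
  \<open>berge G\<close> carry the concrete vertices of \<open>G\<close>.\<close>

definition contains_copy :: "'b hgraph \<Rightarrow> 'a hgraph \<Rightarrow> bool" where
  "contains_copy H F \<longleftrightarrow>
     (\<exists>g. inj_on g (verts F) \<and> g ` verts F \<subseteq> verts H \<and> (\<forall>e \<in> hedges F. g ` e \<in> hedges H))"

definition ramsey_property :: "nat \<Rightarrow> 'a hgraph set \<Rightarrow> nat \<Rightarrow> nat \<Rightarrow> bool" where
  "ramsey_property r \<F> k n \<longleftrightarrow>
     (\<forall>c \<in> nsets {..<n} r \<rightarrow> {..<k}. \<exists>i<k. \<exists>F \<in> \<F>.
        contains_copy ({..<n}, {e \<in> nsets {..<n} r. c e = i}) F)"

definition ramsey_number :: "nat \<Rightarrow> 'a hgraph set \<Rightarrow> nat \<Rightarrow> nat" where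
  "ramsey_number r \<F> k = (LEAST n. ramsey_property r \<F> k n)"

end

theory Submission
  imports Defs "HOL-Library.Z2" "HOL-Algebra.Algebraic_Closure_Type"
begin

text \<open>Put \<open>\<alpha> = r - 1 - 1 / m\<close>, so that the exponent in the theorem is \<open>1 / \<alpha>\<close>. A family of \<open>r\<close>-sets on
\<open>n\<close> vertices without a Berge cycle of length \<open>2 m\<close> (or \<open>2 m + 1\<close>, if \<open>r \<ge> 3\<close>) has at most \<open>O(n powr (1 + 1 / m))\<close>
members, and for \<open>m \<in> {2, 3, 5}\<close> all \<open>r\<close>-sets can be partitioned into \<open>O(n powr \<alpha>)\<close> such families.
The first fact gives the upper bound, the second one the lower bound.

\<^bold>\<open>Upper bound.\<close> Everything is reduced to families in which each hyperedge has one vertex of each of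
\<open>s\<close> types and any two vertices lie together in a bounded number of hyperedges (\<open>turan_typed\<close>). Pass to
a subfamily of minimum degree about \<open>n powr (1 / m)\<close> and search it breadth-first. If fewer than
\<open>m\<close> steps have been made, the hyperedges of a layer are at most a constant times the vertices reached
so far (\<open>layer_bound\<close>), so every step multiplies the number of vertices reached by more than
\<open>n powr (1 / m)\<close>, and after \<open>m\<close> steps there are more than \<open>n\<close> of them. The bound on a layer replaces the
usual lemma on cycles with a chord: a dense layer contains a subfamily in which paths can be
continued freely through any sequence of types. In it, look at the deepest generation of the search
tree in which two hyperedges with a common vertex still have different ancestors. A third vertex of
the layer, reached by a path of any prescribed length, has in that generation an ancestor that
differs from one of these two, while one generation higher all three agree. Path and tree branches
close up to a Berge cycle of exactly the prescribed length.

For the reduction, a family in which all pairs covered by a hyperedge are covered often contains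
a Berge cycle of the given length, because the third vertex of a hyperedge lengthens a cycle by one
(\<open>heavy_core_cycle\<close>). Hence hyperedges can be removed one after the other along pairs of small degree,
and a constant proportion of them own a private pair (\<open>private_pairs\<close>). For even length the private
pairs form a graph. For odd length either many hyperedges have a pair of large degree, and an even
cycle of private pairs can be lengthened by one, or they contain typed triples of bounded degree.

\<^bold>\<open>Lower bound.\<close> For \<open>m \<in> {2, 3, 5}\<close> there is a bipartite graph with \<open>q^m\<close> points, \<open>q^m\<close> lines, degree
\<open>q\<close> and girth \<open>2 m + 2\<close>, given by \<open>m - 1\<close> equations over the field with \<open>q\<close> elements; the right-hand
sides of these equations colour all point-line pairs with \<open>q^(m - 1)\<close> colours (\<open>pair_colouring\<close>). Blow up
each point to \<open>a\<close> vertices and each line to \<open>r - a\<close> vertices. A Berge cycle of length at most \<open>2 m + 1\<close>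
in the blown-up graph projects to a closed walk that uses no edge twice, hence, by the girth, to a
single node, and then it is no longer than \<open>a\<close> or \<open>r - a\<close>. With \<open>a = r div 2\<close> both are less than \<open>2 m\<close>
exactly when \<open>r < 4 m - 1\<close> (\<open>no_berge_cycle_over_large_girth\<close>). To colour all \<open>r\<close>-sets of numbers
below \<open>2^t\<close>, sort the elements. The colour records, for each pair of neighbours, the binary digit where
they separate and their difference, except that the middle pair is coloured as a point-line pair.
The digits determine the position of a vertex in every set of a colour class, so that each class is
such a blow-up. Neighbours that separate at digit \<open>h\<close> need only about \<open>2^h\<close> colours, so summing over
all digits costs a constant factor and not a power of \<open>t\<close>.\<close>

section \<open>Berge paths and Berge cycles\<close>

text \<open>\<open>bpath E x n y V H\<close>: a Berge path with \<open>n\<close> hyperedges of \<open>E\<close> from \<open>x\<close> to \<open>y\<close>. Its vertex set \<open>V\<close> and its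
set \<open>H\<close> of hyperedges are arguments, so that the conditions for gluing paths are plain statements
about sets.\<close>

inductive bpath :: "'a set set \<Rightarrow> 'a \<Rightarrow> nat \<Rightarrow> 'a \<Rightarrow> 'a set \<Rightarrow> 'a set set \<Rightarrow> bool" for E where
  refl: "bpath E x 0 x {x} {}"
| step: "\<lbrakk>h \<in> E; x \<in> h; x' \<in> h; x \<notin> V; h \<notin> H; bpath E x' n y V H\<rbrakk>
    \<Longrightarrow> bpath E x (Suc n) y (insert x V) (insert h H)"

text \<open>A Berge cycle is kept as a Berge path and a closing hyperedge; \<open>bcycle_iff\<close> gives the symmetric form.\<close>

definition bcycle :: "'a set set \<Rightarrow> nat \<Rightarrow> bool" where
  "bcycle E l \<longleftrightarrow> (\<exists>x n y V H h. l = Suc n \<and> n \<ge> 1 \<and> bpath E x n y V H \<and> h \<in> E \<and> h \<notin> H \<and> x \<in> h \<and> y \<in> h)"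

lemma bpath_ends: "bpath E x n y V H \<Longrightarrow> x \<in> V \<and> y \<in> V"
  by (induction rule: bpath.induct) auto

lemma bpath_edges: "bpath E x n y V H \<Longrightarrow> H \<subseteq> E"
  by (induction rule: bpath.induct) auto

lemma bpath_covered: "bpath E x n y V H \<Longrightarrow> V \<subseteq> insert x (\<Union>H)"
  by (induction rule: bpath.induct) auto

lemma bpath_append:
  assumes "bpath E x n y V H" "bpath E y k z V' H'" "V \<inter> V' = {y}" "H \<inter> H' = {}"
  shows "bpath E x (n + k) z (V \<union> V') (H \<union> H')"
  using assms
proof (induction rule: bpath.induct)
  case (refl x)
  then show ?case using bpath_ends by (metis Un_absorb1 add_0 insert_subset empty_subsetI sup_bot_left)
next
  case (step h x x' V H n y)
  have y: "y \<in> V" using step bpath_ends by metis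
  have 1: "V \<inter> V' = {y}" "H \<inter> H' = {}" using step.prems y by auto
  have "x \<notin> V'" using step.prems step.hyps y by auto
  moreover have "h \<notin> H'" using step.prems by auto
  moreover have "bpath E x' (n + k) z (V \<union> V') (H \<union> H')" using step.IH[OF step.prems(1) 1] .
  ultimately have "bpath E x (Suc (n + k)) z (insert x (V \<union> V')) (insert h (H \<union> H'))"
    using step.hyps by (intro bpath.step) auto
  then show ?case by simp
qed

lemma bpath_single: "\<lbrakk>h \<in> E; x \<in> h; y \<in> h; x \<noteq> y\<rbrakk> \<Longrightarrow> bpath E x 1 y {x, y} {h}"
  using bpath.step[OF _ _ _ _ _ bpath.refl, of h E x y] by simp

lemma bpath_sym: "bpath E x n y V H \<Longrightarrow> bpath E y n x V H"
proof (induction rule: bpath.induct)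
  case (refl x)
  then show ?case by (rule bpath.refl)
next
  case (step h x x' V H n y)
  have "x' \<in> V" using step bpath_ends by metis
  then have "bpath E x' 1 x {x', x} {h}" using step by (intro bpath_single) auto
  from bpath_append[OF step.IH this] show ?case using step.hyps \<open>x' \<in> V\<close>
    by (simp add: insert_commute Int_insert_right insert_absorb)
qed

lemma bpath_mono: "bpath E x n y V H \<Longrightarrow> H \<subseteq> E' \<Longrightarrow> bpath E' x n y V H"
  by (induction rule: bpath.induct) (auto intro: bpath.intros)

lemma bcycle_mono: "bcycle E l \<Longrightarrow> E \<subseteq> E' \<Longrightarrow> bcycle E' l"
  unfolding bcycle_def using bpath_mono bpath_edges by (metis (no_types, opaque_lifting) subset_eq)

lemma bpath_map:
  assumes "bpath E x n y V H" "inj_on \<phi> E" "\<And>h. h \<in> E \<Longrightarrow> \<phi> h \<in> E' \<and> h \<subseteq> \<phi> h"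
  shows "bpath E' x n y V (\<phi> ` H)"
  using assms(1)
proof (induction rule: bpath.induct)
  case (refl x)
  then show ?case by (simp add: bpath.refl)
next
  case (step h x x' V H n y)
  have "H \<subseteq> E" using step bpath_edges by metis
  then have "\<phi> h \<notin> \<phi> ` H" using step assms(2) by (auto dest: inj_onD)
  then show ?case unfolding image_insert using step.hyps step.IH assms(3)[of h]
    by (intro bpath.step[of "\<phi> h" E' x x']) auto
qed

text \<open>The transfer principle for all reductions: if the sets of \<open>E\<close> lie in different hyperedges of \<open>E'\<close>, a
cycle in \<open>E\<close> is carried by these.\<close>

lemma bcycle_map:
  assumes "bcycle E l" "inj_on \<phi> E" "\<And>h. h \<in> E \<Longrightarrow> \<phi> h \<in> E' \<and> h \<subseteq> \<phi> h"
  shows "bcycle E' l"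
proof -
  obtain x n y V H h where *: "l = Suc n" "n \<ge> 1" "bpath E x n y V H" "h \<in> E" "h \<notin> H" "x \<in> h" "y \<in> h"
    using assms(1) unfolding bcycle_def by blast
  have "H \<subseteq> E" using * bpath_edges by metis
  then have "\<phi> h \<notin> \<phi> ` H" using * assms(2) by (auto dest: inj_onD)
  then show ?thesis unfolding bcycle_def
    using * bpath_map[OF *(3) assms(2,3)] assms(3)[OF *(4)] by blast
qed

section \<open>Subfamilies of large minimum degree\<close>

text \<open>Take a smallest vertex set \<open>S\<close> that spans more than \<open>k * card S\<close> members of \<open>E\<close>: deleting a vertex must
destroy more than \<open>k\<close> of them.\<close>

lemma min_degree_subfamily:
  fixes k :: real
  assumes "finite V" "finite E" "\<Union>E \<subseteq> V" "real (card E) > k * real (card V)" "{} \<notin> E" "k \<ge> 0"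
  obtains E' where "E' \<subseteq> E" "E' \<noteq> {}" "\<And>v. v \<in> \<Union>E' \<Longrightarrow> real (card {h \<in> E'. v \<in> h}) > k"
proof -
  define P where "P S \<longleftrightarrow> S \<subseteq> V \<and> real (card {h \<in> E. h \<subseteq> S}) > k * real (card S)" for S
  have "{h \<in> E. h \<subseteq> V} = E" using assms by auto
  then have "P V" using assms unfolding P_def by simp
  then obtain S where S: "P S" and min: "\<And>S'. card S' < card S \<Longrightarrow> \<not> P S'"
    using exists_least_lemma ex_has_least_nat[of P V card] by (metis linorder_not_le)
  have fS: "finite S" using S assms finite_subset unfolding P_def by blast
  define E' where "E' = {h \<in> E. h \<subseteq> S}"
  have fE': "finite E'" using assms unfolding E'_def by auto
  have ne: "E' \<noteq> {}" using S assms(6) unfolding P_def E'_def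
    by (metis card.empty mult_nonneg_nonneg not_le of_nat_0 of_nat_0_le_iff)
  have "real (card {h \<in> E'. v \<in> h}) > k" if v: "v \<in> \<Union>E'" for v
  proof -
    have vS: "v \<in> S" using v unfolding E'_def by auto
    have "card (S - {v}) < card S" using vS fS by (meson card_Diff1_less)
    then have "\<not> P (S - {v})" using min by blast
    moreover have "S - {v} \<subseteq> V" using S unfolding P_def by auto
    ultimately have 1: "real (card {h \<in> E. h \<subseteq> S - {v}}) \<le> k * real (card (S - {v}))"
      unfolding P_def by auto
    have "E' = {h \<in> E. h \<subseteq> S - {v}} \<union> {h \<in> E'. v \<in> h}" unfolding E'_def by auto
    moreover have "{h \<in> E. h \<subseteq> S - {v}} \<inter> {h \<in> E'. v \<in> h} = {}" by auto
    moreover have "finite {h \<in> E. h \<subseteq> S - {v}}" using assms(2) by simp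
    ultimately have "card E' = card {h \<in> E. h \<subseteq> S - {v}} + card {h \<in> E'. v \<in> h}"
      using card_Un_disjoint[of "{h \<in> E. h \<subseteq> S - {v}}" "{h \<in> E'. v \<in> h}"] fE' by simp
    moreover have "real (card E') > k * real (card S)" using S unfolding P_def E'_def by simp
    moreover have "real (card S) = real (card (S - {v})) + 1"
      using vS fS by (simp add: card_Diff_singleton) (metis One_nat_def Suc_leI card_gt_0_iff empty_iff of_nat_diff of_nat_1 diff_add_cancel)
    ultimately show ?thesis using 1 by (simp add: algebra_simps)
  qed
  then show thesis using that[of E'] ne unfolding E'_def by blast
qed

text \<open>Every hyperedge has exactly one vertex of each of the types below \<open>s\<close>.\<close>

definition typed :: "nat \<Rightarrow> ('a \<Rightarrow> nat) \<Rightarrow> 'a set set \<Rightarrow> bool" where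
  "typed s ty E \<longleftrightarrow> (\<forall>h \<in> E. bij_betw ty h {..<s})"

definition codeg_le :: "nat \<Rightarrow> 'a set set \<Rightarrow> bool" where
  "codeg_le d E \<longleftrightarrow> (\<forall>u v. u \<noteq> v \<longrightarrow> card {h \<in> E. u \<in> h \<and> v \<in> h} \<le> d)"

text \<open>The form of minimum degree that allows walking: from every vertex there are more than \<open>D\<close>
possible next vertices of every other type.\<close>

definition rich :: "nat \<Rightarrow> nat \<Rightarrow> ('a \<Rightarrow> nat) \<Rightarrow> 'a set set \<Rightarrow> bool" where
  "rich D s ty T \<longleftrightarrow> (\<forall>v \<in> \<Union>T. \<forall>t<s. t \<noteq> ty v \<longrightarrow>
     D < card {w. ty w = t \<and> (\<exists>h \<in> T. v \<in> h \<and> w \<in> h)})"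

lemma typed_subset: "typed s ty E \<Longrightarrow> E' \<subseteq> E \<Longrightarrow> typed s ty E'"
  unfolding typed_def by auto

lemma codeg_le_subset:
  assumes "codeg_le d E" "E' \<subseteq> E" "finite E"
  shows "codeg_le d E'"
  unfolding codeg_le_def
proof (intro allI impI)
  fix u v :: 'a assume "u \<noteq> v"
  have "card {h \<in> E'. u \<in> h \<and> v \<in> h} \<le> card {h \<in> E. u \<in> h \<and> v \<in> h}"
    using assms(2,3) by (intro card_mono) auto
  also have "\<dots> \<le> d" using assms(1) \<open>u \<noteq> v\<close> unfolding codeg_le_def by blast
  finally show "card {h \<in> E'. u \<in> h \<and> v \<in> h} \<le> d" .
qed

lemma typed_finite: "typed s ty E \<Longrightarrow> h \<in> E \<Longrightarrow> finite h"
  unfolding typed_def by (metis bij_betw_finite finite_lessThan)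

lemma typed_card: "typed s ty E \<Longrightarrow> h \<in> E \<Longrightarrow> card h = s"
  unfolding typed_def by (metis bij_betw_same_card card_lessThan)

lemma typed_eq: "typed s ty E \<Longrightarrow> h \<in> E \<Longrightarrow> u \<in> h \<Longrightarrow> v \<in> h \<Longrightarrow> ty u = ty v \<Longrightarrow> u = v"
  unfolding typed_def bij_betw_def by (metis inj_onD)

lemma typed_ex: "typed s ty E \<Longrightarrow> h \<in> E \<Longrightarrow> t < s \<Longrightarrow> \<exists>v\<in>h. ty v = t"
  unfolding typed_def bij_betw_def by (metis imageE lessThan_iff)

lemma typed_less: "typed s ty E \<Longrightarrow> h \<in> E \<Longrightarrow> v \<in> h \<Longrightarrow> ty v < s"
  unfolding typed_def bij_betw_def by (metis image_eqI lessThan_iff)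

lemma rich_subfamily:
  assumes "finite V" "finite T" "\<Union>T \<subseteq> V" "typed s ty T" "codeg_le d T" "s > 0"
    and "card T > D * d * card V"
  obtains T' where "T' \<subseteq> T" "T' \<noteq> {}" "rich D s ty T'"
proof -
  have "real (card T) > real (D * d) * real (card V)" using assms(7)
    by (metis of_nat_less_iff of_nat_mult)
  moreover have "{} \<notin> T" using typed_card[OF assms(4)] assms(6) by fastforce
  ultimately obtain T' where T': "T' \<subseteq> T" "T' \<noteq> {}"
    and deg: "\<And>v. v \<in> \<Union>T' \<Longrightarrow> real (card {h \<in> T'. v \<in> h}) > real (D * d)"
    using min_degree_subfamily[OF assms(1-3), of "real (D * d)"] of_nat_0_le_iff by blast
  have fT': "finite T'" using T' assms finite_subset by blast
  have ty': "typed s ty T'" using typed_subset assms(4) T' by blast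
  have "D < card {w. ty w = t \<and> (\<exists>h \<in> T'. v \<in> h \<and> w \<in> h)}" (is "_ < card ?N")
    if v: "v \<in> \<Union>T'" "t < s" "t \<noteq> ty v" for v t
  proof -
    have "?N \<subseteq> \<Union>T'" by auto
    moreover have "finite (\<Union>T')" using fT' typed_finite[OF ty'] by auto
    ultimately have fN: "finite ?N" using finite_subset by blast
    have "{h \<in> T'. v \<in> h} \<subseteq> (\<Union>w\<in>?N. {h \<in> T'. v \<in> h \<and> w \<in> h})"
      using typed_ex[OF ty' _ v(2)] by blast
    then have "card {h \<in> T'. v \<in> h} \<le> card (\<Union>w\<in>?N. {h \<in> T'. v \<in> h \<and> w \<in> h})"
      using fN fT' by (intro card_mono) auto
    also have "\<dots> \<le> (\<Sum>w\<in>?N. card {h \<in> T'. v \<in> h \<and> w \<in> h})" by (rule card_UN_le[OF fN])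
    also have "\<dots> \<le> (\<Sum>w\<in>?N. d)"
    proof (rule sum_mono)
      fix w assume "w \<in> ?N"
      then have "v \<noteq> w" using v by auto
      have "card {h \<in> T'. v \<in> h \<and> w \<in> h} \<le> card {h \<in> T. v \<in> h \<and> w \<in> h}"
        using assms(2) T' by (intro card_mono) auto
      also have "\<dots> \<le> d" using assms(5) \<open>v \<noteq> w\<close> unfolding codeg_le_def by blast
      finally show "card {h \<in> T'. v \<in> h \<and> w \<in> h} \<le> d" .
    qed
    finally have "card {h \<in> T'. v \<in> h} \<le> card ?N * d" by simp
    moreover have "card {h \<in> T'. v \<in> h} > D * d" using deg[OF v(1)] by linarith
    ultimately show ?thesis by (meson less_le_trans mult_less_cancel2)
  qed
  then have "rich D s ty T'" unfolding rich_def by blast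
  then show thesis using that T' by blast
qed

text \<open>A path is extended greedily. The whole of each hyperedge used is added to the forbidden set \<open>F\<close>: since
a new vertex is never in \<open>F\<close>, this makes the later hyperedges new as well.\<close>

lemma rich_path:
  assumes "typed s ty T" "rich D s ty T" "finite F" "card F + s * L \<le> D" "y \<in> \<Union>T"
    and "ty y = \<tau> 0" "\<And>k. \<tau> k < s" "\<And>k. \<tau> k \<noteq> \<tau> (Suc k)"
  shows "\<exists>c V H. bpath T y L c V H \<and> ty c = \<tau> L \<and> V \<inter> F \<subseteq> {y} \<and> (\<forall>h\<in>H. \<not> h \<subseteq> F)"
  using assms(3-)
proof (induction L arbitrary: F y \<tau>)
  case 0
  then show ?case using bpath.refl[of T y] by fastforce
next
  case (Suc L)
  have t1: "\<tau> 1 \<noteq> ty y" using Suc.prems(4) Suc.prems(6)[of 0] by simp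
  have "D < card {w. ty w = \<tau> 1 \<and> (\<exists>h \<in> T. y \<in> h \<and> w \<in> h)}" (is "_ < card ?N")
    using assms(2) Suc.prems(3) Suc.prems(5)[of 1] t1 unfolding rich_def by blast
  moreover have "card F \<le> D" using Suc.prems by simp
  ultimately have "\<not> ?N \<subseteq> F" using card_mono[OF Suc.prems(1), of ?N] by linarith
  then obtain w h where w: "ty w = \<tau> 1" "h \<in> T" "y \<in> h" "w \<in> h" "w \<notin> F" by auto
  have wy: "w \<noteq> y" using w t1 by auto
  have fh: "finite h" "card h = s" using typed_finite[OF assms(1)] typed_card[OF assms(1)] w by auto
  have "card (F \<union> h) + s * L \<le> D" using Suc.prems(2) fh card_Un_le[of F h] by simp
  moreover have "w \<in> \<Union>T" using w by auto
  ultimately obtain c V H where ih: "bpath T w L c V H" "ty c = \<tau> (Suc L)" "V \<inter> (F \<union> h) \<subseteq> {w}"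
    "\<forall>h'\<in>H. \<not> h' \<subseteq> F \<union> h"
    using Suc.IH[of "F \<union> h" w "\<lambda>k. \<tau> (Suc k)"] Suc.prems fh w by auto
  have "y \<notin> V" using ih(3) w wy by auto
  moreover have "h \<notin> H" using ih(4) by auto
  ultimately have "bpath T y (Suc L) c (insert y V) (insert h H)"
    using w ih(1) by (intro bpath.step)
  moreover have "insert y V \<inter> F \<subseteq> {y}" using ih(3) w by auto
  moreover have "\<forall>h'\<in>insert h H. \<not> h' \<subseteq> F" using ih(4) w by auto
  ultimately show ?case using ih(2) by blast
qed

section \<open>Breadth-first search\<close>

primrec reach :: "'a set set \<Rightarrow> 'a \<Rightarrow> nat \<Rightarrow> 'a set" where
  "reach E x 0 = {x}"
| "reach E x (Suc n) = reach E x n \<union> \<Union>{h \<in> E. h \<inter> reach E x n \<noteq> {}}"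

definition sphere_at :: "'a set set \<Rightarrow> 'a \<Rightarrow> nat \<Rightarrow> 'a set" where
  "sphere_at E x i = {v \<in> reach E x i. \<forall>j<i. v \<notin> reach E x j}"

text \<open>Each hyperedge met by the search belongs to exactly one layer, that of the step when the search first
touches it.\<close>

definition layer :: "'a set set \<Rightarrow> 'a \<Rightarrow> nat \<Rightarrow> 'a set set" where
  "layer E x i = {h \<in> E. h \<inter> reach E x i \<noteq> {} \<and> (\<forall>j<i. h \<inter> reach E x j = {})}"

text \<open>\<open>\<pi>\<close> is the parent of a vertex, and \<open>\<eta>\<close> the hyperedge through which it was found.\<close>

definition bfs_tree :: "'a set set \<Rightarrow> 'a \<Rightarrow> ('a \<Rightarrow> 'a) \<Rightarrow> ('a \<Rightarrow> 'a set) \<Rightarrow> bool" where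
  "bfs_tree E x \<pi> \<eta> \<longleftrightarrow> (\<forall>l. \<forall>v \<in> sphere_at E x (Suc l).
     \<eta> v \<in> layer E x l \<and> v \<in> \<eta> v \<and> \<pi> v \<in> \<eta> v \<and> \<pi> v \<in> sphere_at E x l)"

lemma reach_mono: "i \<le> j \<Longrightarrow> reach E x i \<subseteq> reach E x j"
  by (rule lift_Suc_mono_le[of "reach E x"]) auto

lemma reach_subset: "x \<in> V \<Longrightarrow> \<Union>E \<subseteq> V \<Longrightarrow> reach E x i \<subseteq> V"
  by (induction i) auto

lemma layer_subset_reach: "h \<in> layer E x i \<Longrightarrow> h \<subseteq> reach E x (Suc i)"
  unfolding layer_def by auto

lemma layer_subset: "layer E x i \<subseteq> E"
  unfolding layer_def by auto

lemma layer_unique: "h \<in> layer E x i \<Longrightarrow> h \<in> layer E x j \<Longrightarrow> i = j"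
  unfolding layer_def by (metis (no_types, lifting) linorder_neqE_nat mem_Collect_eq)

lemma sphere_unique: "v \<in> sphere_at E x i \<Longrightarrow> v \<in> sphere_at E x j \<Longrightarrow> i = j"
  unfolding sphere_at_def by (metis (no_types, lifting) linorder_neqE_nat mem_Collect_eq)

lemma sphere_zero: "sphere_at E x 0 = {x}"
  unfolding sphere_at_def by simp

lemma meets_reach_layers: "{h \<in> E. h \<inter> reach E x i \<noteq> {}} \<subseteq> (\<Union>j\<le>i. layer E x j)"
proof
  fix h assume h: "h \<in> {h \<in> E. h \<inter> reach E x i \<noteq> {}}"
  define j where "j = (LEAST j. h \<inter> reach E x j \<noteq> {})"
  have "h \<inter> reach E x j \<noteq> {}" using h LeastI[of "\<lambda>j. h \<inter> reach E x j \<noteq> {}" i] unfolding j_def by simp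
  moreover have "j \<le> i" using h Least_le[of "\<lambda>j. h \<inter> reach E x j \<noteq> {}" i] unfolding j_def by simp
  moreover have "\<forall>k<j. h \<inter> reach E x k = {}" using not_less_Least[of _ "\<lambda>j. h \<inter> reach E x j \<noteq> {}"] unfolding j_def by simp
  ultimately have "j \<le> i" "h \<in> layer E x j" using h unfolding layer_def by simp_all
  then show "h \<in> (\<Union>j\<le>i. layer E x j)" by auto
qed

lemma bfs_tree_exists: obtains \<pi> \<eta> where "bfs_tree E x \<pi> \<eta>"
proof -
  have "\<exists>p h. \<forall>l. v \<in> sphere_at E x (Suc l) \<longrightarrow>
     h \<in> layer E x l \<and> v \<in> h \<and> p \<in> h \<and> p \<in> sphere_at E x l" for v
  proof (cases "\<exists>l. v \<in> sphere_at E x (Suc l)")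
    case True
    then obtain l where l: "v \<in> sphere_at E x (Suc l)" by blast
    then have "v \<notin> reach E x l" "v \<in> reach E x (Suc l)" unfolding sphere_at_def by auto
    then obtain h where h: "h \<in> E" "v \<in> h" "h \<inter> reach E x l \<noteq> {}" by auto
    have *: "h \<inter> reach E x j = {}" if "j < l" for j
    proof (rule ccontr)
      assume "h \<inter> reach E x j \<noteq> {}"
      then have "v \<in> reach E x (Suc j)" using h by auto
      then show False using l that unfolding sphere_at_def by (auto simp del: reach.simps)
    qed
    obtain p where p: "p \<in> h" "p \<in> reach E x l" using h by auto
    have "h \<in> layer E x l" using h * unfolding layer_def by auto
    moreover have "p \<in> sphere_at E x l" using p * unfolding sphere_at_def by auto
    ultimately show ?thesis using h p sphere_unique[OF l] by (metis old.nat.inject)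
  qed auto
  then show thesis using that unfolding bfs_tree_def by metis
qed

text \<open>Branches of the tree are Berge paths: the vertices lie in different spheres and the hyperedges in
different layers.\<close>

lemma bfs_tree_path:
  assumes "bfs_tree E x \<pi> \<eta>"
  shows "v \<in> sphere_at E x i \<Longrightarrow> k \<le> i \<Longrightarrow> (\<pi> ^^ k) v \<in> sphere_at E x (i - k) \<and>
    (k < i \<longrightarrow> \<eta> ((\<pi> ^^ k) v) \<in> layer E x (i - Suc k) \<and> (\<pi> ^^ k) v \<in> \<eta> ((\<pi> ^^ k) v)) \<and>
    bpath E v k ((\<pi> ^^ k) v) ((\<lambda>l. (\<pi> ^^ l) v) ` {..k}) ((\<lambda>l. \<eta> ((\<pi> ^^ l) v)) ` {..<k})"
proof (induction k arbitrary: v i)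
  case 0
  then show ?case using assms unfolding bfs_tree_def
    by (cases i) (auto simp: bpath.refl)
next
  case (Suc k)
  then obtain i' where i: "i = Suc i'" by (cases i) auto
  have v: "\<eta> v \<in> layer E x i'" "v \<in> \<eta> v" "\<pi> v \<in> \<eta> v" "\<pi> v \<in> sphere_at E x i'"
    using assms Suc.prems i unfolding bfs_tree_def by auto
  have IH: "l \<le> k \<Longrightarrow> (\<pi> ^^ l) (\<pi> v) \<in> sphere_at E x (i' - l) \<and>
     (l < i' \<longrightarrow> \<eta> ((\<pi> ^^ l) (\<pi> v)) \<in> layer E x (i' - Suc l))" for l
  proof (induction l)
    case 0
    show ?case using v(4) assms unfolding bfs_tree_def by (cases i') auto
  next
    case (Suc l)
    then have *: "(\<pi> ^^ l) (\<pi> v) \<in> sphere_at E x (Suc (i' - Suc l))"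
      using \<open>Suc k \<le> i\<close> i by (metis Suc_diff_Suc Suc_leD Suc_le_lessD Suc_le_mono le_trans)
    then have "\<pi> ((\<pi> ^^ l) (\<pi> v)) \<in> sphere_at E x (i' - Suc l)"
      using assms unfolding bfs_tree_def by blast
    moreover have "\<eta> u \<in> layer E x (i' - Suc (Suc l))"
      if "Suc l < i'" "u \<in> sphere_at E x (i' - Suc l)" for u
      using that assms unfolding bfs_tree_def by (metis Suc_diff_Suc)
    ultimately show ?case by auto
  qed
  have 1: "v \<notin> (\<lambda>l. (\<pi> ^^ l) (\<pi> v)) ` {..k}"
  proof
    assume "v \<in> (\<lambda>l. (\<pi> ^^ l) (\<pi> v)) ` {..k}"
    then obtain l where l: "l \<le> k" "v = (\<pi> ^^ l) (\<pi> v)" by auto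
    then have "v \<in> sphere_at E x (i' - l)" using IH[OF l(1)] by simp
    then have "Suc i' = i' - l" using sphere_unique[OF _ Suc.prems(1)] i by metis
    then show False by simp
  qed
  have 2: "\<eta> v \<notin> (\<lambda>l. \<eta> ((\<pi> ^^ l) (\<pi> v))) ` {..<k}"
  proof
    assume "\<eta> v \<in> (\<lambda>l. \<eta> ((\<pi> ^^ l) (\<pi> v))) ` {..<k}"
    then obtain l where l: "l < k" "\<eta> v = \<eta> ((\<pi> ^^ l) (\<pi> v))" by auto
    then have "\<eta> v \<in> layer E x (i' - Suc l)" using IH[of l] l Suc.prems i by simp
    then have "i' = i' - Suc l" using layer_unique[OF v(1)] by metis
    then show False using l Suc.prems i by simp
  qed
  have 3: "(\<lambda>l. (\<pi> ^^ l) v) ` {..Suc k} = insert v ((\<lambda>l. (\<pi> ^^ l) (\<pi> v)) ` {..k})"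
    by (simp add: atMost_Suc_eq_insert_0 image_image funpow_swap1)
  have 4: "(\<lambda>l. \<eta> ((\<pi> ^^ l) v)) ` {..<Suc k} = insert (\<eta> v) ((\<lambda>l. \<eta> ((\<pi> ^^ l) (\<pi> v))) ` {..<k})"
    by (simp add: lessThan_Suc_eq_insert_0 image_image funpow_swap1)
  have 5: "(\<pi> ^^ Suc k) v = (\<pi> ^^ k) (\<pi> v)" by (simp add: funpow_swap1)
  have ih: "(\<pi> ^^ k) (\<pi> v) \<in> sphere_at E x (i' - k)"
    "k < i' \<Longrightarrow> \<eta> ((\<pi> ^^ k) (\<pi> v)) \<in> layer E x (i' - Suc k) \<and> (\<pi> ^^ k) (\<pi> v) \<in> \<eta> ((\<pi> ^^ k) (\<pi> v))"
    "bpath E (\<pi> v) k ((\<pi> ^^ k) (\<pi> v)) ((\<lambda>l. (\<pi> ^^ l) (\<pi> v)) ` {..k}) ((\<lambda>l. \<eta> ((\<pi> ^^ l) (\<pi> v))) ` {..<k})"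
    using Suc.IH[OF v(4)] Suc.prems i by auto
  have "\<eta> v \<in> E" using v(1) unfolding layer_def by simp
  then show ?case unfolding 3 4 5 using ih i bpath.step[OF _ v(2,3) 1 2 ih(3)] by simp
qed

lemma bpath_const:
  assumes "bpath T u n c V H" "\<And>g g'. g \<in> T \<Longrightarrow> g' \<in> T \<Longrightarrow> g \<inter> g' \<noteq> {} \<Longrightarrow> F g = F g'"
    and "g \<in> T" "u \<in> g" "g' \<in> T" "c \<in> g'"
  shows "F g = F g'"
  using assms(1,3,4,5,6)
proof (induction arbitrary: g rule: bpath.induct)
  case (refl x)
  then show ?case using assms(2)[of g g'] by auto
next
  case (step h x x' V H n y)
  have "F g = F h" using assms(2)[of g h] step by auto
  moreover have "F h = F g'" using step.IH[of h] step by auto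
  ultimately show ?case by simp
qed

lemma pigeonhole_fibre:
  assumes "finite A" "finite B" "f ` A \<subseteq> B" "B \<noteq> {}"
  obtains b where "b \<in> B" "card A \<le> card B * card {a \<in> A. f a = b}"
proof (rule ccontr)
  note obt = that
  assume no: "\<not> thesis"
  have *: "card B * card {a \<in> A. f a = b} < card A" if b: "b \<in> B" for b
    using obt[OF b] no by (meson not_le_imp_less)
  have "card A = (\<Sum>b\<in>B. card {a \<in> A. f a = b})"
    using sum_card_image card_eq_sum assms sum.group[OF assms(1,2,3), of "\<lambda>_. 1::nat"] by simp
  then have "card B * card A = (\<Sum>b\<in>B. card B * card {a \<in> A. f a = b})"
    by (simp add: sum_distrib_left)
  also have "\<dots> < (\<Sum>b\<in>B. card A)" using * assms by (intro sum_strict_mono) auto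
  finally show False by simp
qed

section \<open>Typed families without Berge cycles of a given length\<close>

text \<open>In a layer with more hyperedges, fix the types of the ancestors of the tree vertices \<open>a h\<close>, and pass
to a rich subfamily \<open>T\<close>. Let \<open>j\<close> be maximal such that the tree vertices of two
hyperedges of \<open>T\<close> with a common vertex \<open>y\<close> have different \<open>j\<close>-th ancestors. Then all tree vertices that can
be reached from \<open>y\<close> in \<open>T\<close> have the same \<open>(j + 1)\<close>-st ancestor \<open>\<beta>\<close>. A path in \<open>T\<close> from \<open>y\<close> to a tree vertex \<open>c\<close>, the branches from \<open>c\<close> and from
\<open>z\<close> to \<open>\<beta>\<close>, and the hyperedge containing \<open>z\<close> and \<open>y\<close> form a cycle, where \<open>z\<close> is one of the two tree vertices,
chosen with \<open>j\<close>-th ancestor other than that of \<open>c\<close>. The length of the path is free, which makes the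
cycle as long as desired. With only two types the path alternates, hence the assumption on parity.\<close>

lemma layer_bound:
  assumes fin: "finite E" and ty: "typed s ty E" and cd: "codeg_le d E" and s2: "s \<ge> 2"
    and nocyc: "\<not> bcycle E len" and im: "i < m" and ml: "2 * m \<le> len" and par: "even len \<or> 3 \<le> s"
    and x: "x \<in> \<Union>E"
  shows "card (layer E x i) \<le> s ^ (i + 1) * ((2 * s + s * len) * d * card (reach E x (Suc i)))"
proof -
  \<comment> \<open>The path to be built has to avoid two given hyperedges and its own at most \<open>len\<close> hyperedges.\<close>
  define D where "D = 2 * s + s * len"
  obtain \<pi> \<eta> where tree: "bfs_tree E x \<pi> \<eta>" by (rule bfs_tree_exists)
  note tpath = bfs_tree_path[OF tree]
  define a where "a h = (SOME v. v \<in> h \<inter> reach E x i)" for h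
  have a: "a h \<in> h" "a h \<in> sphere_at E x i" if "h \<in> layer E x i" for h
  proof -
    have "a h \<in> h \<inter> reach E x i" unfolding a_def by (rule someI_ex) (use that in \<open>auto simp: layer_def\<close>)
    then show "a h \<in> h" "a h \<in> sphere_at E x i" using that unfolding layer_def sphere_at_def by auto
  qed
  have fV: "finite (\<Union>E)" using fin typed_finite[OF ty] by auto
  have RV: "reach E x k \<subseteq> \<Union>E" for k using reach_subset[OF x] by simp
  have fR: "finite (reach E x k)" for k using finite_subset[OF RV fV] .
  have RVs: "v \<in> sphere_at E x k \<Longrightarrow> v \<in> \<Union>E" for v k using RV unfolding sphere_at_def by blast
  define \<sigma> where "\<sigma> h = map (\<lambda>l. ty ((\<pi> ^^ l) (a h))) [0..<i + 1]" for h
  define W where "W = {w. set w \<subseteq> {..<s} \<and> length w = i + 1}"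
  have W: "finite W" "card W = s ^ (i + 1)" unfolding W_def
    using finite_lists_length_eq[of "{..<s}"] card_lists_length_eq[of "{..<s}"] by auto
  then have Wne: "W \<noteq> {}" using s2 by (metis card.empty not_numeral_le_zero power_eq_0_iff)
  have tyless: "v \<in> \<Union>E \<Longrightarrow> ty v < s" for v using typed_less[OF ty] by blast
  have fL: "finite (layer E x i)" using fin unfolding layer_def by simp
  have "\<sigma> ` layer E x i \<subseteq> W"
  proof
    fix w assume "w \<in> \<sigma> ` layer E x i"
    then obtain h where h: "h \<in> layer E x i" "w = \<sigma> h" by blast
    have "ty ((\<pi> ^^ l) (a h)) < s" if "l < i + 1" for l
      using tpath[OF a(2)[OF h(1)], of l] RVs tyless that by auto
    then show "w \<in> W" unfolding W_def h(2) \<sigma>_def by auto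
  qed
  then obtain w where w: "w \<in> W" "card (layer E x i) \<le> card W * card {h \<in> layer E x i. \<sigma> h = w}"
    using pigeonhole_fibre[OF fL W(1) _ Wne] by blast
  define T0 where "T0 = {h \<in> layer E x i. \<sigma> h = w}"
  have "card T0 \<le> D * d * card (reach E x (Suc i))"
  proof (rule ccontr)
    assume "\<not> card T0 \<le> D * d * card (reach E x (Suc i))"
    then have big: "D * d * card (reach E x (Suc i)) < card T0" by simp
    have T0E: "T0 \<subseteq> E" unfolding T0_def layer_def by auto
    have fT0: "finite T0" using T0E fin finite_subset by blast
    have "\<Union>T0 \<subseteq> reach E x (Suc i)" unfolding T0_def using layer_subset_reach by fastforce
    moreover have "codeg_le d T0" by (rule codeg_le_subset[OF cd T0E fin])
    ultimately obtain T where T: "T \<subseteq> T0" "T \<noteq> {}" and rich: "rich D s ty T"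
      using rich_subfamily[OF fR fT0 _ typed_subset[OF ty T0E] _ _ big] s2 by auto
    have TE: "T \<subseteq> E" using T T0E by blast
    have tyT: "typed s ty T" using typed_subset[OF ty TE] .
    have TL: "h \<in> layer E x i" if "h \<in> T" for h using that T unfolding T0_def by auto
    define t0 where "t0 = w ! 0"
    have seq: "ty ((\<pi> ^^ l) (a h)) = w ! l" if "h \<in> T" "l \<le> i" for h l
    proof -
      have "\<sigma> h = w" using that T unfolding T0_def by auto
      then show ?thesis using that(2) unfolding \<sigma>_def by (metis (no_types, lifting) add.commute
        add_0 diff_zero le_imp_less_Suc length_upt nth_map nth_upt plus_1_eq_Suc)
    qed
    have tya: "ty (a h) = t0" if "h \<in> T" for h using seq[OF that, of 0] unfolding t0_def by simp
    have a_eq: "v = a h" if "h \<in> T" "v \<in> h" "ty v = t0" for h v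
      using typed_eq[OF tyT that(1,2) a(1)[OF TL[OF that(1)]]] that tya by simp
    have t0s: "t0 < s" using w unfolding t0_def W_def by (auto simp: subset_iff)
    define J where "J = {j. \<exists>h\<in>T. \<exists>h'\<in>T. h \<inter> h' \<noteq> {} \<and> (\<pi> ^^ j) (a h) \<noteq> (\<pi> ^^ j) (a h')}"
    have root: "(\<pi> ^^ i) (a h) = x" if "h \<in> T" for h
      using tpath[OF a(2)[OF TL[OF that]], of i] sphere_zero[of E x] by simp
    have J: "J \<subseteq> {..<i}"
    proof
      fix j assume "j \<in> J"
      then obtain h h' where hh: "h \<in> T" "h' \<in> T" "(\<pi> ^^ j) (a h) \<noteq> (\<pi> ^^ j) (a h')"
        unfolding J_def by blast
      show "j \<in> {..<i}"
      proof (rule ccontr)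
        assume "j \<notin> {..<i}"
        then have "j = (j - i) + i" by simp
        then have "(\<pi> ^^ j) v = (\<pi> ^^ (j - i)) ((\<pi> ^^ i) v)" for v by (metis comp_apply funpow_add)
        then show False using hh root by metis
      qed
    qed
    obtain h0 where h0: "h0 \<in> T" using T by blast
    obtain t1 where t1: "t1 < s" "t1 \<noteq> t0" using s2
      by (metis One_nat_def Suc_1 less_le_trans lessI zero_less_Suc zero_neq_one)
    obtain y0 where y0: "y0 \<in> h0" "ty y0 = t1" using typed_ex[OF tyT h0 t1(1)] by blast
    have "0 \<in> J"
    proof -
      have "D < card {u. ty u = t0 \<and> (\<exists>h \<in> T. y0 \<in> h \<and> u \<in> h)}" (is "_ < card ?N")
      proof -
        have "y0 \<in> \<Union>T" "t0 \<noteq> ty y0" using h0 y0 t1 by auto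
        then show ?thesis using rich[unfolded rich_def, rule_format, of y0 t0] t0s by simp
      qed
      moreover have "D \<ge> 1" using s2 unfolding D_def by simp
      ultimately have "card ?N > 1" by linarith
      then obtain u u' where u: "u \<in> ?N" "u' \<in> ?N" "u \<noteq> u'"
        by (metis (no_types, lifting) One_nat_def card_le_Suc0_iff_eq card.infinite not_le not_less_zero)
      obtain h h' where "h \<in> T" "y0 \<in> h" "u \<in> h" "h' \<in> T" "y0 \<in> h'" "u' \<in> h'" "ty u = t0" "ty u' = t0"
        using u by blast
      then have "h \<in> T" "h' \<in> T" "h \<inter> h' \<noteq> {}" "a h \<noteq> a h'" using a_eq u by auto
      then show ?thesis unfolding J_def by auto
    qed
    define j where "j = Max J"
    have fJ: "finite J" using J finite_subset by blast
    have jJ: "j \<in> J" unfolding j_def using fJ \<open>0 \<in> J\<close> by (intro Max_in) auto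
    have ji: "j < i" using subsetD[OF J jJ] by simp
    have "Suc j \<notin> J"
    proof
      assume "Suc j \<in> J"
      then have "Suc j \<le> j" unfolding j_def using Max_ge[OF fJ] by simp
      then show False by simp
    qed
    then have glue: "(\<pi> ^^ Suc j) (a g) = (\<pi> ^^ Suc j) (a g')" if "g \<in> T" "g' \<in> T" "g \<inter> g' \<noteq> {}" for g g'
      using that unfolding J_def by blast
    obtain h h' y where hh: "h \<in> T" "h' \<in> T" "y \<in> h" "y \<in> h'" "(\<pi> ^^ j) (a h) \<noteq> (\<pi> ^^ j) (a h')"
      using jJ unfolding J_def by blast
    have ty_y: "ty y \<noteq> t0" using a_eq hh by metis
    have tys: "ty y < s" using typed_less[OF tyT hh(1,3)] .
    \<comment> \<open>The two branches have \<open>j + 1\<close> hyperedges each, and one more hyperedge closes the cycle.\<close>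
    define L where "L = len - 2 * j - 3"
    have L1: "L \<ge> 1" "len = L + 2 * j + 3" using ji im ml unfolding L_def by auto
    obtain t2 where t2: "t2 < s" "even L \<Longrightarrow> t2 \<noteq> t0 \<and> t2 \<noteq> ty y"
    proof (cases "even L")
      case True
      then have "odd len" using L1 by simp
      then have s3: "3 \<le> s" using par by simp
      have "\<not> {0, 1, 2} \<subseteq> {t0, ty y}"
      proof
        assume "{0, 1, 2} \<subseteq> {t0, ty y}"
        then have "card {0, 1, 2 :: nat} \<le> card {t0, ty y}" by (intro card_mono) auto
        also have "\<dots> \<le> 2" by (simp add: card_insert_if)
        finally show False by simp
      qed
      then obtain t where "t \<in> {0, 1, 2}" "t \<notin> {t0, ty y}" by blast
      then show thesis using s3 that[of t] by auto
    next
      case False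
      then show thesis using t0s that[of t0] by simp
    qed
    \<comment> \<open>The path alternates between two types; for even \<open>L\<close> it leaves \<open>y\<close> through a third type.\<close>
    define \<tau> where "\<tau> k = (if k = 0 then ty y else if odd L then (if even k then ty y else t0)
       else (if odd k then t2 else t0))" for k :: nat
    have \<tau>: "\<tau> 0 = ty y" "\<tau> L = t0" "\<And>k. \<tau> k < s" "\<And>k. \<tau> k \<noteq> \<tau> (Suc k)"
      unfolding \<tau>_def using L1 t0s tys t2 ty_y by auto
    define F where "F = h \<union> h'"
    have hE: "h \<in> E" "h' \<in> E" using hh TE by auto
    have fF: "finite F" unfolding F_def using typed_finite[OF ty] hE by auto
    have "card F \<le> 2 * s" unfolding F_def using card_Un_le[of h h'] typed_card[OF ty] hE by simp
    moreover have "L \<le> len" using L1 by simp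
    ultimately have cF: "card F + s * L \<le> D" unfolding D_def by (intro add_mono) auto
    have yT: "y \<in> \<Union>T" using hh(1,3) by blast
    obtain c V H where Q: "bpath T y L c V H" "ty c = t0" "V \<inter> F \<subseteq> {y}" "\<forall>g\<in>H. \<not> g \<subseteq> F"
      using rich_path[OF tyT rich fF cF yT, of \<tau>] \<tau> by metis
    have HT: "H \<subseteq> T" using bpath_edges[OF Q(1)] .
    have "c \<in> \<Union>H" using bpath_covered[OF Q(1)] bpath_ends[OF Q(1)] ty_y Q(2) by auto
    then obtain g where g: "g \<in> T" "c \<in> g" using HT by blast
    have cg: "c = a g" using a_eq[OF g Q(2)] .
    define \<beta> where "\<beta> = (\<pi> ^^ Suc j) c"
    have \<beta>: "(\<pi> ^^ Suc j) (a h'') = \<beta>" if "h'' \<in> T" "y \<in> h''" for h''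
      unfolding \<beta>_def cg
      using bpath_const[OF Q(1), of "\<lambda>h. (\<pi> ^^ Suc j) (a h)", OF glue that g] by simp
    have VT: "V \<subseteq> \<Union>T"
      using bpath_covered[OF Q(1)] HT hh(1,3) by blast
    have False if e: "e \<in> T" "y \<in> e" "e \<subseteq> F" "(\<pi> ^^ j) (a e) \<noteq> (\<pi> ^^ j) c" for e
    proof -
      define z where "z = a e"
      have sc: "c \<in> sphere_at E x i" unfolding cg using a TL g by blast
      have sz: "z \<in> sphere_at E x i" unfolding z_def using a TL e by blast
      have ze: "z \<in> e" unfolding z_def using a TL e by blast
      have tz: "ty z = t0" unfolding z_def using tya e by blast
      have same: "ty ((\<pi> ^^ l) z) = ty ((\<pi> ^^ l) c)" if "l \<le> i" for l
        unfolding z_def cg using seq e g that by simp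
      have z\<beta>: "(\<pi> ^^ Suc j) z = \<beta>" unfolding z_def using \<beta> e by blast
      define V1 where "V1 = (\<lambda>l. (\<pi> ^^ l) c) ` {..Suc j}"
      define H1 where "H1 = (\<lambda>l. \<eta> ((\<pi> ^^ l) c)) ` {..<Suc j}"
      define V2 where "V2 = (\<lambda>l. (\<pi> ^^ l) z) ` {..Suc j}"
      define H2 where "H2 = (\<lambda>l. \<eta> ((\<pi> ^^ l) z)) ` {..<Suc j}"
      have P1: "bpath E c (Suc j) \<beta> V1 H1" using tpath[OF sc, of "Suc j"] ji
        unfolding V1_def H1_def \<beta>_def by simp
      have "bpath E z (Suc j) ((\<pi> ^^ Suc j) z) V2 H2" using tpath[OF sz, of "Suc j"] ji
        unfolding V2_def H2_def by simp
      then have P2: "bpath E \<beta> (Suc j) z V2 H2" using bpath_sym z\<beta> by metis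
      have diff: "(\<pi> ^^ l) c \<noteq> (\<pi> ^^ l) z" if "l \<le> j" for l
      proof
        assume eq: "(\<pi> ^^ l) c = (\<pi> ^^ l) z"
        have "(\<pi> ^^ j) v = (\<pi> ^^ (j - l)) ((\<pi> ^^ l) v)" for v
          using that by (metis comp_apply funpow_add le_add_diff_inverse2)
        then have "(\<pi> ^^ j) c = (\<pi> ^^ j) z" using eq by metis
        then show False using e(4) unfolding z_def by simp
      qed
      have sph: "(\<pi> ^^ l) c \<in> sphere_at E x (i - l)" "(\<pi> ^^ l) z \<in> sphere_at E x (i - l)" if "l \<le> Suc j" for l
        using tpath[OF sc, of l] tpath[OF sz, of l] that ji by auto
      have lay: "\<eta> ((\<pi> ^^ l) c) \<in> layer E x (i - Suc l)" "(\<pi> ^^ l) c \<in> \<eta> ((\<pi> ^^ l) c)"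
         "\<eta> ((\<pi> ^^ l) z) \<in> layer E x (i - Suc l)" "(\<pi> ^^ l) z \<in> \<eta> ((\<pi> ^^ l) z)" if "l < Suc j" for l
        using tpath[OF sc, of l] tpath[OF sz, of l] that ji by auto
      have V12: "V1 \<inter> V2 = {\<beta>}"
      proof
        show "V1 \<inter> V2 \<subseteq> {\<beta>}"
        proof
          fix v assume "v \<in> V1 \<inter> V2"
          then obtain l l' where l: "l \<le> Suc j" "v = (\<pi> ^^ l) c" "l' \<le> Suc j" "v = (\<pi> ^^ l') z"
            unfolding V1_def V2_def by auto
          then have "i - l = i - l'" using sphere_unique sph by metis
          then have "l = l'" using l ji by simp
          then have "l = Suc j" using diff[of l] l by (metis le_SucE)
          then show "v \<in> {\<beta>}" using l unfolding \<beta>_def by simp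
        qed
        show "{\<beta>} \<subseteq> V1 \<inter> V2" using bpath_ends[OF P1] bpath_ends[OF P2] by simp
      qed
      \<comment> \<open>A common hyperedge would contain two different vertices of the same type.\<close>
      have H12: "H1 \<inter> H2 = {}"
      proof (rule ccontr)
        assume "H1 \<inter> H2 \<noteq> {}"
        then obtain f where f: "f \<in> H1" "f \<in> H2" by blast
        obtain l where l: "l < Suc j" "f = \<eta> ((\<pi> ^^ l) c)" using f(1) unfolding H1_def by blast
        obtain l' where l': "l' < Suc j" "f = \<eta> ((\<pi> ^^ l') z)" using f(2) unfolding H2_def by blast
        have "i - Suc l = i - Suc l'" using layer_unique lay l l' by metis
        then have ll: "l = l'" using l l' ji by simp
        have "(\<pi> ^^ l) c \<in> f" "(\<pi> ^^ l) z \<in> f" using lay(2)[OF l(1)] lay(4)[OF l'(1)] l l' ll by auto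
        moreover have "f \<in> E" using lay(1)[OF l(1)] l unfolding layer_def by simp
        moreover have "l \<le> i" using l ji by simp
        ultimately have "(\<pi> ^^ l) c = (\<pi> ^^ l) z" using typed_eq[OF ty, of f "(\<pi> ^^ l) c" "(\<pi> ^^ l) z"] same[of l] by simp
        then show False using diff[of l] l by simp
      qed
      have P: "bpath E c (Suc j + Suc j) z (V1 \<union> V2) (H1 \<union> H2)"
        using bpath_append[OF P1 P2 V12 H12] .
      have low: "f \<notin> T" if f: "f \<in> H1 \<union> H2" for f
      proof
        assume "f \<in> T"
        then have fi: "f \<in> layer E x i" using TL by blast
        obtain l where l: "l < Suc j" "f = \<eta> ((\<pi> ^^ l) c) \<or> f = \<eta> ((\<pi> ^^ l) z)"
          using f unfolding H1_def H2_def by blast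
        then have "f \<in> layer E x (i - Suc l)" using lay(1)[OF l(1)] lay(3)[OF l(1)] by metis
        then have "i = i - Suc l" using layer_unique[OF fi] by metis
        then show False using ji by simp
      qed
      \<comment> \<open>Apart from their ends in the layer, the branches lie in spheres that the layer does not meet.\<close>
      have lowv: "v = c \<or> v = z" if v: "v \<in> V1 \<union> V2" "v \<in> \<Union>T" for v
      proof (rule ccontr)
        assume n: "\<not> (v = c \<or> v = z)"
        obtain l where l: "l \<le> Suc j" "v = (\<pi> ^^ l) c \<or> v = (\<pi> ^^ l) z"
          using v unfolding V1_def V2_def by auto
        then have "l \<noteq> 0" using n by (metis funpow_0)
        have "v \<in> sphere_at E x (i - l)" using l sph by auto
        then have "v \<in> reach E x (i - l)" unfolding sphere_at_def by simp
        moreover obtain h where "h \<in> layer E x i" "v \<in> h" using v TL by blast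
        moreover have "i - l < i" using \<open>l \<noteq> 0\<close> ji by simp
        ultimately show False unfolding layer_def by blast
      qed
      have zV: "z \<notin> V" using Q(3) ze e(3) tz ty_y by auto
      have "V \<inter> (V1 \<union> V2) = {c}"
      proof
        show "V \<inter> (V1 \<union> V2) \<subseteq> {c}"
        proof
          fix v assume v: "v \<in> V \<inter> (V1 \<union> V2)"
          then have "v \<in> \<Union>T" using subsetD[OF VT] by simp
          then have "v = c \<or> v = z" using lowv v by simp
          then show "v \<in> {c}" using v zV by auto
        qed
        show "{c} \<subseteq> V \<inter> (V1 \<union> V2)" using bpath_ends[OF Q(1)] bpath_ends[OF P1] by simp
      qed
      moreover have "H \<inter> (H1 \<union> H2) = {}" using low HT by blast
      moreover have "bpath E y L c V H" using bpath_mono[OF Q(1) subset_trans[OF HT TE]] .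
      ultimately have full: "bpath E y (L + (Suc j + Suc j)) z (V \<union> (V1 \<union> V2)) (H \<union> (H1 \<union> H2))"
        using bpath_append[OF _ P] by blast
      have "e \<notin> H" using e(3) Q(4) by blast
      moreover have "e \<notin> H1 \<union> H2" using low e(1) by blast
      ultimately have "e \<notin> H \<union> (H1 \<union> H2)" by simp
      then have "bcycle E (Suc (L + (Suc j + Suc j)))" unfolding bcycle_def
        using full e TE ze by (intro exI[of _ y] exI[of _ "L + (Suc j + Suc j)"] exI[of _ z]
          exI[of _ "V \<union> (V1 \<union> V2)"] exI[of _ "H \<union> (H1 \<union> H2)"] exI[of _ e]) auto
      moreover have "Suc (L + (Suc j + Suc j)) = len" using L1 by simp
      ultimately show False using nocyc by simp
    qed
    from this[of h] this[of h'] show False using hh unfolding F_def by (metis Un_upper1 Un_upper2)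
  qed
  then show ?thesis using w(2) W(2) unfolding T0_def D_def
    by (metis (no_types, lifting) le_trans mult_le_mono2)
qed

text \<open>The constant is chosen so that \<open>layer_bound\<close> makes the search grow by the factor
\<open>2 * card V powr (1 / m)\<close> in each of its first \<open>m\<close> steps.\<close>

lemma turan_typed:
  assumes s2: "s \<ge> 2" and m1: "m \<ge> 1" and ml: "2 * m \<le> len" and par: "even len \<or> 3 \<le> s"
  obtains K where "K > 0" "\<And>(V :: 'a set) E ty. \<lbrakk>finite V; \<Union>E \<subseteq> V; typed s ty E; codeg_le d E; \<not> bcycle E len\<rbrakk>
     \<Longrightarrow> real (card E) \<le> K * real (card V) powr (1 + 1 / real m)"
proof -
  define B where "B = s ^ m * ((2 * s + s * len) * d)"
  define B' where "B' = real (s * m * B) + 1"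
  define K where "K = 2 * B'"
  have B'1: "B' \<ge> 1" unfolding B'_def by simp
  have main: "real (card E) \<le> K * real (card V) powr (1 + 1 / real m)"
    if fV: "finite V" and EV: "\<Union>E \<subseteq> V" and ty: "typed s ty E" and cd: "codeg_le d E" and nocyc: "\<not> bcycle E len"
    for V :: "'a set" and E and ty :: "'a \<Rightarrow> nat"
  proof (rule ccontr)
    assume "\<not> ?thesis"
    then have big: "real (card E) > K * real (card V) powr (1 + 1 / real m)" by simp
    define N where "N = real (card V) powr (1 / real m)"
    have fE: "finite E" using EV fV by (meson finite_UnionD finite_subset)
    have ne: "{} \<notin> E" using typed_card[OF ty] s2 by fastforce
    have "card V > 0"
    proof (rule ccontr)
      assume "\<not> 0 < card V"
      then have "E \<subseteq> {{}}" using fV EV by auto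
      then have "E = {}" using ne by auto
      then show False using big \<open>\<not> 0 < card V\<close> by simp
    qed
    then have V1: "real (card V) \<ge> 1" by simp
    have eq: "K * real (card V) powr (1 + 1 / real m) = (K * N) * real (card V)"
      unfolding N_def using V1 by (simp add: powr_add)
    have "real (card E) > (K * N) * real (card V)" using big unfolding eq .
    moreover have "K * N \<ge> 0" unfolding K_def N_def using B'1 by simp
    ultimately obtain E' where E': "E' \<subseteq> E" "E' \<noteq> {}"
      and deg: "\<And>v. v \<in> \<Union>E' \<Longrightarrow> real (card {h \<in> E'. v \<in> h}) > K * N"
      using min_degree_subfamily[OF fV fE EV _ ne, of "K * N"] by blast
    have fE': "finite E'" using E' fE finite_subset by blast
    have ty': "typed s ty E'" using typed_subset[OF ty E'(1)] .
    have cd': "codeg_le d E'" by (rule codeg_le_subset[OF cd E'(1) fE])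
    have nocyc': "\<not> bcycle E' len" using nocyc bcycle_mono E' by blast
    obtain h0 where h0: "h0 \<in> E'" using E'(2) by blast
    then have "h0 \<noteq> {}" using ne subsetD[OF E'(1)] by metis
    then obtain x where x: "x \<in> \<Union>E'" using h0 by blast
    have E'V: "\<Union>E' \<subseteq> V" using E' EV by blast
    have RE: "reach E' x i \<subseteq> \<Union>E'" for i using reach_subset[OF x] by simp
    have fR: "finite (reach E' x i)" for i using RE E'V fV finite_subset by metis
    have lb: "card (layer E' x i) \<le> B * card (reach E' x (Suc i))" if "i < m" for i
    proof -
      have "card (layer E' x i) \<le> s ^ (i + 1) * ((2 * s + s * len) * d * card (reach E' x (Suc i)))"
        by (rule layer_bound[OF fE' ty' cd' s2 nocyc' that ml par x])
      also have "\<dots> \<le> s ^ m * ((2 * s + s * len) * d * card (reach E' x (Suc i)))"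
        using that s2 by (intro mult_le_mono1 power_increasing) auto
      finally show ?thesis unfolding B_def by (simp add: mult_ac)
    qed
    have grow: "2 * N * real (card (reach E' x i)) \<le> real (card (reach E' x (Suc i)))" if im: "i < m" for i
    proof -
      define M where "M = {h \<in> E'. h \<inter> reach E' x i \<noteq> {}}"
      have fM: "finite M" unfolding M_def using fE' by simp
      have "M \<subseteq> (\<Union>j\<le>i. layer E' x j)" unfolding M_def by (rule meets_reach_layers)
      then have "card M \<le> card (\<Union>j\<le>i. layer E' x j)"
        using finite_subset[OF layer_subset fE'] by (intro card_mono finite_UN_I) auto
      also have "\<dots> \<le> (\<Sum>j\<le>i. card (layer E' x j))" by (rule card_UN_le) simp
      also have "\<dots> \<le> (\<Sum>j\<le>i. B * card (reach E' x (Suc i)))"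
      proof (rule sum_mono)
        fix j assume "j \<in> {..i}"
        then have "card (layer E' x j) \<le> B * card (reach E' x (Suc j))" using lb im by simp
        also have "\<dots> \<le> B * card (reach E' x (Suc i))"
          using \<open>j \<in> {..i}\<close> by (intro mult_le_mono2 card_mono fR reach_mono) simp
        finally show "card (layer E' x j) \<le> B * card (reach E' x (Suc i))" .
      qed
      also have "\<dots> = Suc i * B * card (reach E' x (Suc i))" by (simp add: algebra_simps)
      also have "\<dots> \<le> m * B * card (reach E' x (Suc i))" using im by (intro mult_le_mono1) simp
      finally have cM: "card M \<le> m * B * card (reach E' x (Suc i))" .
      have "(\<Sum>v\<in>reach E' x i. card {h \<in> E'. v \<in> h}) = (\<Sum>v\<in>reach E' x i. \<Sum>h\<in>M. if v \<in> h then 1 else 0)"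
      proof (rule sum.cong)
        fix v assume v: "v \<in> reach E' x i"
        have "{h \<in> E'. v \<in> h} = {h \<in> M. v \<in> h}" unfolding M_def using v by auto
        then show "card {h \<in> E'. v \<in> h} = (\<Sum>h\<in>M. if v \<in> h then 1 else 0)"
          using fM by (simp add: sum.If_cases Int_def)
      qed simp
      also have "\<dots> = (\<Sum>h\<in>M. \<Sum>v\<in>reach E' x i. if v \<in> h then 1 else 0)" by (rule sum.swap)
      also have "\<dots> \<le> (\<Sum>h\<in>M. s)"
      proof (rule sum_mono)
        fix h assume h: "h \<in> M"
        then have hE: "h \<in> E'" unfolding M_def by simp
        have "(\<Sum>v\<in>reach E' x i. if v \<in> h then 1 else 0) = card {v \<in> reach E' x i. v \<in> h}"
          using fR by (simp add: sum.If_cases Int_def)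
        also have "\<dots> \<le> card h" using typed_finite[OF ty' hE] by (intro card_mono) auto
        finally show "(\<Sum>v\<in>reach E' x i. if v \<in> h then 1 else 0) \<le> s" using typed_card[OF ty' hE] by simp
      qed
      also have "\<dots> = s * card M" by simp
      also have "\<dots> \<le> s * (m * B * card (reach E' x (Suc i)))" using cM by (rule mult_le_mono2)
      finally have "(\<Sum>v\<in>reach E' x i. card {h \<in> E'. v \<in> h}) \<le> s * m * B * card (reach E' x (Suc i))"
        by (simp add: mult_ac)
      then have "(\<Sum>v\<in>reach E' x i. real (card {h \<in> E'. v \<in> h})) \<le> real (s * m * B) * real (card (reach E' x (Suc i)))"
        unfolding of_nat_sum[symmetric] of_nat_mult[symmetric] by (simp only: of_nat_le_iff)
      also have "\<dots> \<le> B' * real (card (reach E' x (Suc i)))" unfolding B'_def by (intro mult_right_mono) auto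
      finally have up: "(\<Sum>v\<in>reach E' x i. real (card {h \<in> E'. v \<in> h})) \<le> B' * real (card (reach E' x (Suc i)))" .
      have "(\<Sum>v\<in>reach E' x i. K * N) \<le> (\<Sum>v\<in>reach E' x i. real (card {h \<in> E'. v \<in> h}))"
        using deg RE by (intro sum_mono) (meson less_imp_le subsetD)
      then have "real (card (reach E' x i)) * (K * N) \<le> B' * real (card (reach E' x (Suc i)))" using up by simp
      then have "B' * (2 * N * real (card (reach E' x i))) \<le> B' * real (card (reach E' x (Suc i)))"
        unfolding K_def by (simp add: mult_ac)
      then show ?thesis using B'1 by (simp add: mult_le_cancel_left)
    qed
    have N0: "N \<ge> 0" unfolding N_def by simp
    have "i \<le> m \<Longrightarrow> (2 * N) ^ i \<le> real (card (reach E' x i))" for i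
    proof (induction i)
      case (Suc i)
      have "(2 * N) ^ Suc i \<le> 2 * N * real (card (reach E' x i))" using Suc N0 by (simp add: mult_left_mono)
      then show ?case using grow[of i] Suc.prems by simp
    qed simp
    then have "(2 * N) ^ m \<le> real (card (reach E' x m))" by simp
    also have "\<dots> \<le> real (card V)" using card_mono[OF fV subset_trans[OF RE E'V], of m] by simp
    finally have "2 ^ m * N ^ m \<le> real (card V)" by (simp add: power_mult_distrib)
    moreover have "N ^ m = real (card V)" unfolding N_def using V1 m1
      by (simp add: powr_realpow[symmetric] powr_powr)
    moreover have "(2::real) ^ m > 1" using m1 by (simp add: one_less_power)
    ultimately show False using V1 by (simp add: mult_le_cancel_right1)
  qed
  have "K > 0" unfolding K_def using B'1 by simp
  then show thesis using that main by blast
qed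

section \<open>Reducing uniform families to typed ones\<close>

text \<open>Averaging over all maps from \<open>V\<close> to the types: for a fixed \<open>h\<close>, the proportion of maps that send
\<open>f h t\<close> to \<open>t\<close> for all \<open>t < s\<close> is \<open>1 / s ^ s\<close>.\<close>

lemma typing_exists:
  fixes f :: "'b \<Rightarrow> nat \<Rightarrow> 'a"
  assumes fV: "finite V" and fH: "finite H" and s: "s \<ge> 1"
    and inj: "\<And>h. h \<in> H \<Longrightarrow> inj_on (f h) {..<s}" and sub: "\<And>h. h \<in> H \<Longrightarrow> f h ` {..<s} \<subseteq> V"
  obtains ty H' where "H' \<subseteq> H" "card H \<le> s ^ s * card H'" "\<And>h t. h \<in> H' \<Longrightarrow> t < s \<Longrightarrow> ty (f h t) = t"
proof (rule ccontr)
  note obt = that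
  assume no: "\<not> thesis"
  define \<Omega> where "\<Omega> = PiE V (\<lambda>_. {..<s})"
  define G where "G h = {\<omega> \<in> \<Omega>. \<forall>t<s. \<omega> (f h t) = t}" for h
  have f\<Omega>: "finite \<Omega>" unfolding \<Omega>_def using fV by (intro finite_PiE) auto
  have c\<Omega>: "card \<Omega> = s ^ card V" unfolding \<Omega>_def using fV by (simp add: card_PiE)
  have \<Omega>ne: "card \<Omega> > 0" using c\<Omega> s by simp
  have cG: "s ^ s * card (G h) = card \<Omega>" if h: "h \<in> H" for h
  proof -
    define R where "R = f h ` {..<s}"
    have R: "R \<subseteq> V" "card R = s" unfolding R_def using inj[OF h] sub[OF h] by (auto simp: card_image)
    have "G h = PiE V (\<lambda>v. if v \<in> R then {inv_into {..<s} (f h) v} else {..<s})"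
    proof (intro Set.set_eqI iffI)
      fix \<omega> assume w: "\<omega> \<in> G h"
      show "\<omega> \<in> PiE V (\<lambda>v. if v \<in> R then {inv_into {..<s} (f h) v} else {..<s})"
        using w inj[OF h] unfolding G_def \<Omega>_def R_def by (auto simp: PiE_iff)
    next
      fix \<omega> assume w: "\<omega> \<in> PiE V (\<lambda>v. if v \<in> R then {inv_into {..<s} (f h) v} else {..<s})"
      have val: "\<omega> (f h t) = t" if t: "t < s" for t
      proof -
        have "f h t \<in> R" "f h t \<in> V" using t R unfolding R_def by auto
        then have "\<omega> (f h t) = inv_into {..<s} (f h) (f h t)" using PiE_mem[OF w, of "f h t"] by simp
        then show ?thesis using inj[OF h] t by simp
      qed
      have "\<omega> v < s" if v: "v \<in> V" for v
      proof (cases "v \<in> R")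
        case True
        then show ?thesis using val unfolding R_def by auto
      next
        case False
        then show ?thesis using PiE_mem[OF w v] by simp
      qed
      then show "\<omega> \<in> G h" using val w unfolding G_def \<Omega>_def by (auto simp: PiE_iff)
    qed
    then have "card (G h) = (\<Prod>v\<in>V. if v \<in> R then 1 else s)"
      using fV by (simp add: card_PiE if_distrib cong: if_cong)
    also have "\<dots> = s ^ card (V - R)"
      using fV by (simp add: prod.If_cases Diff_eq Compl_eq)
    finally have "s ^ s * card (G h) = s ^ (card R + card (V - R))" using R by (simp add: power_add)
    moreover have "card R + card (V - R) = card V"
      using R fV by (metis card_Diff_subset card_mono finite_subset le_add_diff_inverse)
    ultimately show ?thesis using c\<Omega> by simp
  qed
  have lt: "s ^ s * card {h \<in> H. \<omega> \<in> G h} < card H" if w: "\<omega> \<in> \<Omega>" for \<omega>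
  proof (rule ccontr)
    assume "\<not> ?thesis"
    then have "card H \<le> s ^ s * card {h \<in> H. \<omega> \<in> G h}" by simp
    moreover have "{h \<in> H. \<omega> \<in> G h} \<subseteq> H" by simp
    moreover have "\<omega> (f h t) = t" if "h \<in> {h \<in> H. \<omega> \<in> G h}" "t < s" for h t
      using that unfolding G_def by simp
    ultimately show False using no obt by blast
  qed
  have "card \<Omega> * card H = (\<Sum>h\<in>H. s ^ s * card (G h))" using cG by (simp add: mult.commute)
  also have "\<dots> = s ^ s * (\<Sum>h\<in>H. \<Sum>\<omega>\<in>\<Omega>. if \<omega> \<in> G h then 1 else 0)"
  proof -
    have "card (G h) = (\<Sum>\<omega>\<in>\<Omega>. if \<omega> \<in> G h then 1 else 0)" for h
    proof -
      have "\<Omega> \<inter> {\<omega>. \<omega> \<in> G h} = G h" unfolding G_def by auto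
      then show ?thesis using f\<Omega> by (simp add: sum.If_cases)
    qed
    then show ?thesis by (simp add: sum_distrib_left)
  qed
  also have "\<dots> = s ^ s * (\<Sum>\<omega>\<in>\<Omega>. \<Sum>h\<in>H. if \<omega> \<in> G h then 1 else 0)" by (subst sum.swap) simp
  also have "\<dots> = (\<Sum>\<omega>\<in>\<Omega>. s ^ s * card {h \<in> H. \<omega> \<in> G h})"
    using fH by (simp add: sum.If_cases Int_def sum_distrib_left)
  also have "\<dots> < (\<Sum>\<omega>\<in>\<Omega>. card H)" using lt f\<Omega> \<Omega>ne by (intro sum_strict_mono) auto
  finally show False by simp
qed

lemma bpath_of_fun:
  assumes "inj_on w {..n}" "inj_on g {..<n}" "\<And>i. i < n \<Longrightarrow> g i \<in> E \<and> w i \<in> g i \<and> w (Suc i) \<in> g i"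
  shows "bpath E (w 0) n (w n) (w ` {..n}) (g ` {..<n})"
  using assms
proof (induction n)
  case 0
  then show ?case by (simp add: bpath.refl)
next
  case (Suc n)
  have "bpath E (w 0) n (w n) (w ` {..n}) (g ` {..<n})"
    using Suc.prems by (intro Suc.IH) (auto intro: inj_on_subset)
  moreover have "w n \<noteq> w (Suc n)" using Suc.prems(1) by (auto dest: inj_onD)
  then have "bpath E (w n) 1 (w (Suc n)) {w n, w (Suc n)} {g n}"
    using Suc.prems(3)[of n] by (intro bpath_single) auto
  moreover have "w ` {..n} \<inter> {w n, w (Suc n)} = {w n}"
  proof -
    have "w (Suc n) \<notin> w ` {..n}" using Suc.prems(1) by (simp add: atMost_Suc)
    then show ?thesis by auto
  qed
  moreover have "g ` {..<n} \<inter> {g n} = {}"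
    using Suc.prems(2) by (simp add: lessThan_Suc)
  ultimately have "bpath E (w 0) (n + 1) (w (Suc n)) (w ` {..n} \<union> {w n, w (Suc n)}) (g ` {..<n} \<union> {g n})"
    by (rule bpath_append)
  moreover have "w ` {..n} \<union> {w n, w (Suc n)} = w ` {..Suc n}" by (auto simp: atMost_Suc)
  moreover have "g ` {..<n} \<union> {g n} = g ` {..<Suc n}" by (auto simp: lessThan_Suc)
  ultimately show ?case by simp
qed

lemma fun_of_bpath:
  assumes "bpath E x n y V H"
  shows "\<exists>w g. w 0 = x \<and> w n = y \<and> inj_on w {..n} \<and> w ` {..n} = V \<and> inj_on g {..<n} \<and> g ` {..<n} = H \<and>
    (\<forall>i<n. g i \<in> E \<and> w i \<in> g i \<and> w (Suc i) \<in> g i)"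
  using assms
proof (induction rule: bpath.induct)
  case (refl x)
  then show ?case by (intro exI[of _ "\<lambda>_. x"]) auto
next
  case (step h x x' V H n y)
  then obtain w g where wg: "w 0 = x'" "w n = y" "inj_on w {..n}" "w ` {..n} = V" "inj_on g {..<n}" "g ` {..<n} = H"
    "\<forall>i<n. g i \<in> E \<and> w i \<in> g i \<and> w (Suc i) \<in> g i" by blast
  define w' where "w' = case_nat x w"
  define g' where "g' = case_nat h g"
  have V: "w' ` {..Suc n} = insert x V"
    unfolding w'_def wg(4)[symmetric] by (simp add: atMost_Suc_eq_insert_0 image_image)
  have H: "g' ` {..<Suc n} = insert h H"
    unfolding g'_def wg(6)[symmetric] by (simp add: lessThan_Suc_eq_insert_0 image_image)
  have "inj_on w' {..Suc n}"
  proof (rule inj_onI)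
    fix i j assume "i \<in> {..Suc n}" "j \<in> {..Suc n}" "w' i = w' j"
    then show "i = j" using wg(3,4) step.hyps(4) unfolding w'_def
      by (cases i; cases j) (auto dest: inj_onD)
  qed
  moreover have "inj_on g' {..<Suc n}"
  proof (rule inj_onI)
    fix i j assume "i \<in> {..<Suc n}" "j \<in> {..<Suc n}" "g' i = g' j"
    then show "i = j" using wg(5,6) step.hyps(5) unfolding g'_def
      by (cases i; cases j) (auto dest: inj_onD)
  qed
  moreover have "\<forall>i<Suc n. g' i \<in> E \<and> w' i \<in> g' i \<and> w' (Suc i) \<in> g' i"
    using wg step.hyps unfolding w'_def g'_def by (auto split: nat.split)
  moreover have "w' 0 = x" "w' (Suc n) = y" unfolding w'_def using wg by auto
  ultimately show ?case using V H by blast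
qed

lemma bcycle_iff:
  assumes "k \<ge> 2"
  shows "bcycle E k \<longleftrightarrow> (\<exists>w g. inj_on w {..<k} \<and> inj_on g {..<k} \<and>
     (\<forall>i<k. g i \<in> E \<and> w i \<in> g i \<and> w ((i + 1) mod k) \<in> g i))" (is "_ \<longleftrightarrow> ?R")
proof
  assume "bcycle E k"
  then obtain x n y V H h where c: "k = Suc n" "n \<ge> 1" "bpath E x n y V H" "h \<in> E" "h \<notin> H" "x \<in> h" "y \<in> h"
    unfolding bcycle_def by blast
  obtain w g where wg: "w 0 = x" "w n = y" "inj_on w {..n}" "inj_on g {..<n}" "g ` {..<n} = H"
    "\<forall>i<n. g i \<in> E \<and> w i \<in> g i \<and> w (Suc i) \<in> g i" using fun_of_bpath[OF c(3)] by blast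
  define g' where "g' = g(n := h)"
  have "{..<k} = {..n}" using c by auto
  then have "inj_on w {..<k}" using wg by simp
  moreover have "inj_on g' {..<k}" unfolding g'_def c(1) lessThan_Suc using wg(4,5) c(5)
    by (auto simp: inj_on_def)
  moreover have "g' i \<in> E \<and> w i \<in> g' i \<and> w ((i + 1) mod k) \<in> g' i" if "i < k" for i
  proof (cases "i = n")
    case True
    then show ?thesis using c wg unfolding g'_def by simp
  next
    case False
    then show ?thesis using wg that c unfolding g'_def by simp
  qed
  ultimately show ?R by blast
next
  assume ?R
  then obtain w g where wg: "inj_on w {..<k}" "inj_on g {..<k}"
    "\<And>i. i < k \<Longrightarrow> g i \<in> E \<and> w i \<in> g i \<and> w ((i + 1) mod k) \<in> g i" by blast
  obtain n where n: "k = Suc n" "n \<ge> 1" using assms by (cases k) auto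
  have s: "{..n} = {..<k}" "{..<n} \<subseteq> {..<k}" using n by auto
  have "g i \<in> E \<and> w i \<in> g i \<and> w (Suc i) \<in> g i" if "i < n" for i using wg(3)[of i] that n by simp
  then have "bpath E (w 0) n (w n) (w ` {..n}) (g ` {..<n})"
    using wg s by (intro bpath_of_fun) (auto intro: inj_on_subset)
  moreover have "g n \<notin> g ` {..<n}" using wg(2) n by (simp add: lessThan_Suc)
  moreover have "g n \<in> E" "w n \<in> g n" "w 0 \<in> g n" using wg(3)[of n] n by auto
  ultimately show "bcycle E k" unfolding bcycle_def using n by blast
qed

lemma distinct_representatives:
  assumes "\<And>i. i < k \<Longrightarrow> k \<le> card (S i)"
  obtains g where "inj_on g {..<k}" "\<And>i. i < k \<Longrightarrow> g i \<in> S i"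
proof -
  have "j \<le> k \<Longrightarrow> \<exists>g. inj_on g {..<j} \<and> (\<forall>i<j. g i \<in> S i)" for j
  proof (induction j)
    case (Suc j)
    then obtain g where g: "inj_on g {..<j}" "\<forall>i<j. g i \<in> S i" by auto
    have "card (g ` {..<j}) \<le> j" using card_image_le[of "{..<j}" g] by simp
    also have "\<dots> < card (S j)" using Suc.prems assms[of j] by simp
    finally have "\<not> S j \<subseteq> g ` {..<j}" using card_mono[of "g ` {..<j}" "S j"] by auto
    then obtain y where y: "y \<in> S j" "y \<notin> g ` {..<j}" by blast
    have "inj_on (g(j := y)) {..<Suc j}" unfolding lessThan_Suc using g(1) y
      by (auto simp: inj_on_def)
    moreover have "\<forall>i<Suc j. (g(j := y)) i \<in> S i" using g y by (auto simp: less_Suc_eq)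
    ultimately show ?case by blast
  qed simp
  then show thesis using that by blast
qed

text \<open>Start with three vertices of a hyperedge. More than \<open>2 ^ len\<close> hyperedges contain two consecutive
vertices, too many for all of them to lie inside the current cycle, so one of them has a new vertex to
insert between the two. When the length is \<open>len\<close>, the consecutive pairs lie in enough hyperedges to
choose distinct ones.\<close>

lemma heavy_core_cycle:
  assumes fH: "finite H" and ne: "H \<noteq> {}" and c3: "\<And>h. h \<in> H \<Longrightarrow> 3 \<le> card h" and len: "3 \<le> len"
    and heavy: "\<And>h u v. \<lbrakk>h \<in> H; u \<in> h; v \<in> h; u \<noteq> v\<rbrakk> \<Longrightarrow> 2 ^ len < card {g \<in> H. u \<in> g \<and> v \<in> g}"
  shows "bcycle H len"
proof -
  define C where "C k w \<longleftrightarrow> inj_on w {..<k} \<and> (\<forall>i. Suc i < k \<longrightarrow> (\<exists>h\<in>H. w i \<in> h \<and> w (Suc i) \<in> h)) \<and>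
     (\<exists>h\<in>H. w (k - 1) \<in> h \<and> w 0 \<in> h)" for k and w :: "nat \<Rightarrow> 'a"
  have "3 \<le> k \<Longrightarrow> k \<le> len \<Longrightarrow> \<exists>w. C k w" for k
  proof (induction k rule: dec_induct)
    case base
    obtain h where h: "h \<in> H" using ne by blast
    obtain T where T: "T \<subseteq> h" "card T = 3" using obtain_subset_with_card_n[OF c3[OF h]] by metis
    obtain a b c where abc: "T = {a, b, c}" "a \<noteq> b" "a \<noteq> c" "b \<noteq> c" using T(2) card_3_iff by metis
    define w where "w = (\<lambda>i::nat. if i = 0 then a else if i = 1 then b else c)"
    have "{..<3} = {0, 1, 2 :: nat}" by auto
    then have "inj_on w {..<3}" unfolding w_def using abc by auto
    then have "C 3 w" unfolding C_def w_def using h T abc by auto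
    then show ?case by blast
  next
    case (step k)
    then obtain w where w: "C k w" by auto
    then obtain h where h: "h \<in> H" "w (k - 1) \<in> h" "w 0 \<in> h" unfolding C_def by blast
    have "w (k - 1) \<noteq> w 0" using w step.hyps unfolding C_def by (auto dest!: inj_onD)
    then have "2 ^ len < card {g \<in> H. w (k - 1) \<in> g \<and> w 0 \<in> g}" (is "_ < card ?G") using heavy[OF h] by simp
    moreover have "card (Pow (w ` {..<k})) \<le> 2 ^ len"
    proof -
      have "card (w ` {..<k}) \<le> k" using card_image_le[of "{..<k}" w] by simp
      also have "\<dots> \<le> len" using step by simp
      finally show ?thesis by (simp add: card_Pow)
    qed
    ultimately have "\<not> ?G \<subseteq> Pow (w ` {..<k})" using card_mono[of "Pow (w ` {..<k})" ?G] by auto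
    then obtain g v where g: "g \<in> H" "w (k - 1) \<in> g" "w 0 \<in> g" "v \<in> g" "v \<notin> w ` {..<k}" by auto
    have "inj_on (w(k := v)) {..<Suc k}" unfolding lessThan_Suc using w g(5) unfolding C_def
      by (auto simp: inj_on_def)
    moreover have "\<exists>h\<in>H. (w(k := v)) i \<in> h \<and> (w(k := v)) (Suc i) \<in> h" if i: "Suc i < Suc k" for i
    proof (cases "Suc i = k")
      case True
      then have "i = k - 1" "i \<noteq> k" by auto
      then show ?thesis using g True by auto
    next
      case False
      then show ?thesis using w i unfolding C_def by auto
    qed
    ultimately have "C (Suc k) (w(k := v))" unfolding C_def using g step.hyps by auto
    then show ?case by blast
  qed
  then obtain w where w: "C len w" using len by blast
  define S where "S i = {g \<in> H. w i \<in> g \<and> w ((i + 1) mod len) \<in> g}" for i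
  have "len \<le> card (S i)" if i: "i < len" for i
  proof -
    have neq: "w i \<noteq> w ((i + 1) mod len)"
    proof
      assume "w i = w ((i + 1) mod len)"
      then have "i = (i + 1) mod len" using w i unfolding C_def by (auto dest: inj_onD)
      then show False using i len by (cases "Suc i = len") auto
    qed
    obtain h where "h \<in> H" "w i \<in> h" "w ((i + 1) mod len) \<in> h"
    proof (cases "Suc i = len")
      case True
      then show thesis using w that unfolding C_def by auto
    next
      case False
      then have "Suc i < len" using i by simp
      then show thesis using w that unfolding C_def by auto
    qed
    then have "2 ^ len < card (S i)" unfolding S_def using heavy neq by blast
    then show ?thesis using less_exp[of len] by (meson le_trans less_imp_le)
  qed
  then obtain g where g: "inj_on g {..<len}" "\<And>i. i < len \<Longrightarrow> g i \<in> S i"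
    using distinct_representatives[of len S] by metis
  then show ?thesis using w len unfolding S_def C_def by (subst bcycle_iff) auto
qed

text \<open>Remove all hyperedges that contain a pair of small degree, let one of them own the pair, and repeat:
the hyperedges treated later do not contain this pair.\<close>

lemma private_pairs:
  assumes "finite H" "\<And>H'. \<lbrakk>H' \<subseteq> H; H' \<noteq> {}\<rbrakk> \<Longrightarrow>
     \<exists>h\<in>H'. \<exists>u\<in>h. \<exists>v\<in>h. u \<noteq> v \<and> card {g \<in> H'. u \<in> g \<and> v \<in> g} \<le> d"
  shows "\<exists>H1 p. H1 \<subseteq> H \<and> card H \<le> d * card H1 \<and> inj_on p H1 \<and> (\<forall>h\<in>H1. p h \<subseteq> h \<and> card (p h) = 2)"
  using assms
proof (induction H rule: finite_psubset_induct)
  case (psubset H)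
  show ?case
  proof (cases "H = {}")
    case False
    then obtain h u v where h: "h \<in> H" "u \<in> h" "v \<in> h" "u \<noteq> v" "card {g \<in> H. u \<in> g \<and> v \<in> g} \<le> d"
      using psubset.prems[of H] by blast
    define H' where "H' = H - {g \<in> H. u \<in> g \<and> v \<in> g}"
    have "H' \<subset> H" unfolding H'_def using h by auto
    then obtain H1 p where ih: "H1 \<subseteq> H'" "card H' \<le> d * card H1" "inj_on p H1" "\<forall>h\<in>H1. p h \<subseteq> h \<and> card (p h) = 2"
      using psubset.IH[of H'] psubset.prems by (meson psubset_imp_subset subset_trans)
    have hH1: "h \<notin> H1" using ih(1) h unfolding H'_def by auto
    have f1: "finite H1" using ih(1) psubset.hyps finite_subset unfolding H'_def by blast
    have "card H = card {g \<in> H. u \<in> g \<and> v \<in> g} + card H'" unfolding H'_def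
      using psubset.hyps by (simp add: card_Diff_subset card_mono)
    also have "\<dots> \<le> d + d * card H1" using h(5) ih(2) by simp
    also have "\<dots> = d * card (insert h H1)" using f1 hH1 by simp
    finally have "card H \<le> d * card (insert h H1)" .
    moreover have "inj_on (p(h := {u, v})) (insert h H1)"
    proof -
      have "p g \<noteq> {u, v}" if "g \<in> H1" for g using that ih(1,4) unfolding H'_def by auto
      moreover have "inj_on (p(h := {u, v})) H1" using ih(3) hH1 by (auto simp: inj_on_def)
      ultimately show ?thesis using hH1 by (auto simp: inj_on_insert)
    qed
    moreover have "\<forall>g\<in>insert h H1. (p(h := {u, v})) g \<subseteq> g \<and> card ((p(h := {u, v})) g) = 2"
      using ih(4) h by auto
    moreover have "insert h H1 \<subseteq> H" using ih(1) h unfolding H'_def by auto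
    ultimately show ?thesis by blast
  qed auto
qed

section \<open>Uniform families without Berge cycles\<close>

lemma bpath_neq: "bpath E x n y V H \<Longrightarrow> n \<ge> 1 \<Longrightarrow> x \<noteq> y"
  by (cases rule: bpath.cases, assumption) (auto dest: bpath_ends)

lemma bpath_card_edges: "bpath E x n y V H \<Longrightarrow> finite H \<and> card H = n"
  by (induction rule: bpath.induct) auto

lemma turan_even_graph:
  assumes m1: "m \<ge> 1"
  obtains K where "K > 0" "\<And>(V :: 'a set) G. \<lbrakk>finite V; \<And>e. e \<in> G \<Longrightarrow> e \<subseteq> V \<and> card e = 2; \<not> bcycle G (2 * m)\<rbrakk>
     \<Longrightarrow> real (card G) \<le> K * real (card V) powr (1 + 1 / real m)"
proof -
  obtain K where K: "K > 0" "\<And>(V :: 'a set) E ty. \<lbrakk>finite V; \<Union>E \<subseteq> V; typed 2 ty E; codeg_le 1 E; \<not> bcycle E (2 * m)\<rbrakk>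
     \<Longrightarrow> real (card E) \<le> K * real (card V) powr (1 + 1 / real m)"
    using turan_typed[of 2 m "2 * m" 1] m1 by auto
  have "real (card G) \<le> 4 * K * real (card V) powr (1 + 1 / real m)"
    if fV: "finite V" and G: "\<And>e. e \<in> G \<Longrightarrow> e \<subseteq> V \<and> card e = 2" and nocyc: "\<not> bcycle G (2 * m)"
    for V :: "'a set" and G
  proof -
    have fG: "finite G" using G fV by (intro finite_subset[of G "Pow V"]) auto
    have "\<forall>e\<in>G. \<exists>f. bij_betw f {..<2::nat} e"
    proof
      fix e assume "e \<in> G"
      then have "finite e" "card e = 2" using G[of e] finite_subset[of e V] fV by simp_all
      then show "\<exists>f. bij_betw f {..<2::nat} e" using ex_bij_betw_nat_finite[of e] by (simp add: atLeast0LessThan)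
    qed
    then obtain f where f: "\<And>e. e \<in> G \<Longrightarrow> bij_betw (f e) {..<2::nat} e" by metis
    obtain ty G' where G': "G' \<subseteq> G" "card G \<le> 2 ^ 2 * card G'" "\<And>e t. e \<in> G' \<Longrightarrow> t < 2 \<Longrightarrow> ty (f e t) = t"
    proof (rule typing_exists[OF fV fG, of 2 f])
      fix e assume "e \<in> G"
      then show "inj_on (f e) {..<2}" "f e ` {..<2} \<subseteq> V" using f G unfolding bij_betw_def by auto
    qed auto
    have "typed 2 ty G'" unfolding typed_def
    proof
      fix e assume e: "e \<in> G'"
      then have b: "bij_betw (f e) {..<2} e" using f G' by auto
      have "bij_betw (ty \<circ> f e) {..<2} {..<2}"
        using G'(3)[OF e] by (intro bij_betw_cong[THEN iffD2, OF _ bij_betw_id]) auto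
      then show "bij_betw ty e {..<2}" using b by (meson bij_betw_comp_iff)
    qed
    moreover have "codeg_le 1 G'" unfolding codeg_le_def
    proof (intro allI impI)
      fix u v :: 'a assume uv: "u \<noteq> v"
      have "e = {u, v}" if "e \<in> G'" "u \<in> e" "v \<in> e" for e
      proof -
        have "card e = 2" using that G G' by auto
        then obtain a b where "e = {a, b}" by (meson card_2_iff)
        then show ?thesis using that uv by auto
      qed
      then have "{h \<in> G'. u \<in> h \<and> v \<in> h} \<subseteq> {{u, v}}" by auto
      then show "card {h \<in> G'. u \<in> h \<and> v \<in> h} \<le> 1" using card_mono[of "{{u, v}}"] by auto
    qed
    moreover have "\<Union>G' \<subseteq> V" using G' G by blast
    moreover have "\<not> bcycle G' (2 * m)" using nocyc bcycle_mono G'(1) by blast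
    ultimately have "real (card G') \<le> K * real (card V) powr (1 + 1 / real m)" using K(2)[OF fV] by blast
    moreover have "real (card G) \<le> 4 * real (card G')" using G'(2) by simp
    ultimately show ?thesis by simp
  qed
  then show thesis using that[of "4 * K"] K(1) by simp
qed

text \<open>The last edge \<open>p h = {u h, w h}\<close> of a cycle of private pairs is replaced by the detour from \<open>u h\<close> through
one of the many other hyperedges to \<open>x h\<close> and then through \<open>h\<close> to \<open>w h\<close>.\<close>

lemma heavy_pair_extends_cycle:
  assumes fH: "finite H" and p: "inj_on p Ha" "\<And>h. h \<in> Ha \<Longrightarrow> p h \<subseteq> h" and HaH: "Ha \<subseteq> H"
    and x: "\<And>h. h \<in> Ha \<Longrightarrow> x h \<in> h \<and> x h \<notin> \<Union>(p ` Ha)"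
    and u: "\<And>h. h \<in> Ha \<Longrightarrow> p h = {u h, w h}"
    and big: "\<And>h. h \<in> Ha \<Longrightarrow> k < card {g \<in> H. u h \<in> g \<and> x h \<in> g}"
    and cyc: "bcycle (p ` Ha) k"
  shows "bcycle H (Suc k)"
proof -
  obtain a n b V Es e where c: "k = Suc n" "n \<ge> 1" "bpath (p ` Ha) a n b V Es" "e \<in> p ` Ha" "e \<notin> Es" "a \<in> e" "b \<in> e"
    using cyc unfolding bcycle_def by blast
  obtain h where h: "h \<in> Ha" "e = p h" using c by blast
  have ab: "a \<noteq> b" using bpath_neq[OF c(3,2)] .
  have path: "\<exists>V Es. bpath (p ` Ha) (u h) n (w h) V Es \<and> e \<notin> Es"
  proof -
    have "(u h = a \<and> w h = b) \<or> (u h = b \<and> w h = a)" using c(6,7) h u[OF h(1)] ab by auto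
    then show ?thesis using c(3,5) bpath_sym by metis
  qed
  then obtain V Es where P: "bpath (p ` Ha) (u h) n (w h) V Es" "e \<notin> Es" by blast
  define q where "q = inv_into Ha p"
  have q: "q (p g) = g" if "g \<in> Ha" for g unfolding q_def using p(1) that by simp
  have injq: "inj_on q (p ` Ha)" unfolding q_def by (simp add: inj_on_inv_into)
  have EsE: "Es \<subseteq> p ` Ha" using bpath_edges[OF P(1)] .
  have P': "bpath H (u h) n (w h) V (q ` Es)"
    by (rule bpath_map[OF P(1) injq]) (use q p HaH in auto)
  have hq: "h \<notin> q ` Es"
  proof
    assume "h \<in> q ` Es"
    then obtain g where g: "g \<in> Ha" "p g \<in> Es" "h = q (p g)" using EsE by blast
    then show False using q[OF g(1)] h(2) P(2) by simp
  qed
  have "V \<subseteq> insert (u h) (\<Union>Es)" using bpath_covered[OF P(1)] .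
  also have "\<dots> \<subseteq> \<Union>(p ` Ha)" using EsE u[OF h(1)] h(1) by blast
  finally have xV: "x h \<notin> V" using x[OF h(1)] by blast
  have fq: "finite (q ` Es)" "card (q ` Es) \<le> n" using bpath_card_edges[OF P(1)] card_image_le by auto
  then have "card (insert h (q ` Es)) \<le> k" using c(1) by (simp add: card_insert_if)
  then have "\<not> {g \<in> H. u h \<in> g \<and> x h \<in> g} \<subseteq> insert h (q ` Es)"
    using big[OF h(1)] card_mono[of "insert h (q ` Es)"] fq by (meson finite_insert leD le_trans)
  then obtain g where g: "g \<in> H" "u h \<in> g" "x h \<in> g" "g \<noteq> h" "g \<notin> q ` Es" by blast
  have "bpath H (x h) (Suc n) (w h) (insert (x h) V) (insert g (q ` Es))"
    using g xV P' by (intro bpath.step[of g]) auto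
  moreover have "h \<notin> insert g (q ` Es)" using g hq by auto
  moreover have "h \<in> H" "x h \<in> h" "w h \<in> h" using h(1) HaH x u p(2) by auto
  ultimately show ?thesis unfolding bcycle_def c(1) by (metis le_SucI c(2))
qed

text \<open>The members of \<open>Ha\<close> have a pair of large degree that meets their private pair in one vertex; for
them \<open>heavy_pair_extends_cycle\<close> reduces the odd to the even cycle. Each other hyperedge is replaced by a
triple \<open>T h\<close> consisting of its private pair and a third vertex. If the private pairs have types
\<open>0\<close> and \<open>1\<close> and the third vertices type \<open>2\<close>, then a pair of types \<open>0\<close> and \<open>1\<close> lies in one triple only and
every other pair has small degree, so that \<open>turan_typed\<close> applies with three types.\<close>

lemma turan_berge_odd:
  assumes m1: "m \<ge> 1"
  obtains K where "K > 0" "\<And>(V :: 'a set) H p. \<lbrakk>finite V; \<And>h. h \<in> H \<Longrightarrow> h \<subseteq> V \<and> 3 \<le> card h; inj_on p H;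
      \<And>h. h \<in> H \<Longrightarrow> p h \<subseteq> h \<and> card (p h) = 2; \<not> bcycle H (2 * m + 1)\<rbrakk>
     \<Longrightarrow> real (card H) \<le> K * real (card V) powr (1 + 1 / real m)"
proof -
  obtain K2 where K2: "K2 > 0" "\<And>(V :: 'a set) G. \<lbrakk>finite V; \<And>e. e \<in> G \<Longrightarrow> e \<subseteq> V \<and> card e = 2; \<not> bcycle G (2 * m)\<rbrakk>
     \<Longrightarrow> real (card G) \<le> K2 * real (card V) powr (1 + 1 / real m)"
    using turan_even_graph[OF m1] by blast
  obtain K3 where K3: "K3 > 0" "\<And>(V :: 'a set) E ty. \<lbrakk>finite V; \<Union>E \<subseteq> V; typed 3 ty E; codeg_le (2 * m + 1) E; \<not> bcycle E (2 * m + 1)\<rbrakk>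
     \<Longrightarrow> real (card E) \<le> K3 * real (card V) powr (1 + 1 / real m)"
    using turan_typed[of 3 m "2 * m + 1" "2 * m + 1"] m1 by auto
  have "real (card H) \<le> (27 * K2 + 27 * K3) * real (card V) powr (1 + 1 / real m)"
    if fV: "finite V" and H: "\<And>h. h \<in> H \<Longrightarrow> h \<subseteq> V \<and> 3 \<le> card h" and inj: "inj_on p H"
      and p: "\<And>h. h \<in> H \<Longrightarrow> p h \<subseteq> h \<and> card (p h) = 2" and nocyc: "\<not> bcycle H (2 * m + 1)"
    for V :: "'a set" and H p
  proof -
    define N where "N = real (card V) powr (1 + 1 / real m)"
    have fH: "finite H" using H fV by (intro finite_subset[of H "Pow V"]) auto
    define cod where "cod u x = card {g \<in> H. u \<in> g \<and> x \<in> g}" for u x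
    define Ha where "Ha = {h \<in> H. \<exists>u\<in>p h. \<exists>x\<in>h - p h. 2 * m + 1 < cod u x}"
    define Hb where "Hb = H - Ha"
    have "\<exists>u w x. p h = {u, w} \<and> u \<noteq> w \<and> x \<in> h - p h \<and> (h \<in> Ha \<longrightarrow> 2 * m + 1 < cod u x)"
      if h: "h \<in> H" for h
    proof (cases "h \<in> Ha")
      case True
      then obtain u x where ux: "u \<in> p h" "x \<in> h - p h" "2 * m + 1 < cod u x" unfolding Ha_def by blast
      obtain a b where ab: "p h = {a, b}" "a \<noteq> b" using p[OF h] card_2_iff[of "p h"] by auto
      then have "p h = {u, if u = a then b else a}" "u \<noteq> (if u = a then b else a)" using ux by auto
      then show ?thesis using ux by blast
    next
      case False
      obtain a b where ab: "p h = {a, b}" "a \<noteq> b" using p[OF h] card_2_iff[of "p h"] by auto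
      have "finite (p h)" using ab by simp
      then have "\<not> h \<subseteq> p h" using p[OF h] H[OF h] card_mono[of "p h" h] by linarith
      then show ?thesis using ab False by blast
    qed
    then obtain u w x where uwx: "\<And>h. h \<in> H \<Longrightarrow> p h = {u h, w h} \<and> u h \<noteq> w h \<and> x h \<in> h - p h \<and>
       (h \<in> Ha \<longrightarrow> 2 * m + 1 < cod (u h) (x h))" by metis
    define f where "f h t = (if t = 0 then u h else if t = 1 then w h else x h)" for h and t :: nat
    have L3: "{..<3} = {0, 1, 2 :: nat}" by auto
    have pu: "p h = {u h, w h}" "u h \<noteq> w h" "x h \<noteq> u h" "x h \<noteq> w h" if "h \<in> H" for h
      using uwx[OF that] by blast+
    have fim: "f h ` {..<3} = insert (x h) (p h)" if "h \<in> H" for h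
      unfolding L3 f_def pu(1)[OF that] by auto
    have finj: "inj_on (f h) {..<3}" if "h \<in> H" for h
      unfolding L3 f_def using pu(2-4)[OF that] by simp
    have fsub: "f h ` {..<3} \<subseteq> V" if "h \<in> H" for h
      using fim[OF that] uwx[OF that] p[OF that] H[OF that] by auto
    have xh: "x h \<in> h" if "h \<in> H" for h using uwx[OF that] by blast
    have Ha: "real (card Ha) \<le> 27 * (K2 * N)"
    proof -
      have HaH: "Ha \<subseteq> H" unfolding Ha_def by auto
      have fHa: "finite Ha" using HaH fH finite_subset by blast
      obtain ty H' where H': "H' \<subseteq> Ha" "card Ha \<le> 3 ^ 3 * card H'" "\<And>h t. h \<in> H' \<Longrightarrow> t < 3 \<Longrightarrow> ty (f h t) = t"
      proof (rule typing_exists[OF fV fHa, of 3 f])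
        fix h assume "h \<in> Ha"
        then have "h \<in> H" using HaH by blast
        then show "inj_on (f h) {..<3}" "f h ` {..<3} \<subseteq> V" using finj fsub by auto
      qed auto
      have H'H: "H' \<subseteq> H" using H' HaH by blast
      have ty: "ty (u h) = 0" "ty (w h) = 1" "ty (x h) = 2" if "h \<in> H'" for h
        using H'(3)[OF that, of 0] H'(3)[OF that, of 1] H'(3)[OF that, of 2] unfolding f_def by auto
      have "\<not> bcycle (p ` H') (2 * m)"
      proof
        assume cyc: "bcycle (p ` H') (2 * m)"
        have "bcycle H (Suc (2 * m))"
        proof (rule heavy_pair_extends_cycle[OF fH _ _ H'H _ _ _ cyc, of x u w])
          show "inj_on p H'" using inj H'H inj_on_subset by blast
          show "p h \<subseteq> h" if "h \<in> H'" for h using p that H'H by blast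
          show "p h = {u h, w h}" if "h \<in> H'" for h using uwx that H'H by blast
          show "2 * m < card {g \<in> H. u h \<in> g \<and> x h \<in> g}" if "h \<in> H'" for h
            using uwx[of h] that H'H H'(1) unfolding cod_def by (metis Suc_eq_plus1 Suc_lessD subsetD)
          show "x h \<in> h \<and> x h \<notin> \<Union> (p ` H')" if h: "h \<in> H'" for h
          proof
            show "x h \<in> h" using xh h H'H by blast
            show "x h \<notin> \<Union> (p ` H')"
            proof
              assume "x h \<in> \<Union> (p ` H')"
              then obtain g where g: "g \<in> H'" "x h \<in> p g" by blast
              then have "x h = u g \<or> x h = w g" using uwx[of g] H'H by blast
              then show False using ty[OF g(1)] ty[OF h] by auto
            qed
          qed
        qed
        then show False using nocyc by simp
      qed
      moreover have "e \<subseteq> V \<and> card e = 2" if "e \<in> p ` H'" for e using that p H H'H by blast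
      ultimately have "real (card (p ` H')) \<le> K2 * N" using K2(2)[OF fV] unfolding N_def by blast
      moreover have "card (p ` H') = card H'" using inj H'H by (metis card_image inj_on_subset)
      moreover have "real (card Ha) \<le> 27 * real (card H')" using H'(2) by simp
      ultimately show ?thesis by simp
    qed
    have Hb: "real (card Hb) \<le> 27 * (K3 * N)"
    proof -
      have HbH: "Hb \<subseteq> H" unfolding Hb_def by auto
      have fHb: "finite Hb" using HbH fH finite_subset by blast
      obtain ty H' where H': "H' \<subseteq> Hb" "card Hb \<le> 3 ^ 3 * card H'" "\<And>h t. h \<in> H' \<Longrightarrow> t < 3 \<Longrightarrow> ty (f h t) = t"
      proof (rule typing_exists[OF fV fHb, of 3 f])
        fix h assume "h \<in> Hb"
        then have "h \<in> H" using HbH by blast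
        then show "inj_on (f h) {..<3}" "f h ` {..<3} \<subseteq> V" using finj fsub by auto
      qed auto
      have H'H: "H' \<subseteq> H" using H' HbH by blast
      have fH': "finite H'" using H'H fH finite_subset by blast
      have ty: "ty (u h) = 0" "ty (w h) = 1" "ty (x h) = 2" if "h \<in> H'" for h
        using H'(3)[OF that, of 0] H'(3)[OF that, of 1] H'(3)[OF that, of 2] unfolding f_def by auto
      have pty: "p h = {v \<in> f h ` {..<3}. ty v < 2}" if "h \<in> H'" for h
      proof -
        have "h \<in> H" using that H'H by blast
        then show ?thesis unfolding fim[OF \<open>h \<in> H\<close>] unfolding pu(1)[OF \<open>h \<in> H\<close>] using ty[OF that] by auto
      qed
      define T where "T h = f h ` {..<3}" for h
      have injT: "inj_on T H'"
      proof (rule inj_onI)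
        fix g h assume gh: "g \<in> H'" "h \<in> H'" "T g = T h"
        then have "p g = p h" using pty unfolding T_def by simp
        then show "g = h" using inj gh H'H by (meson inj_onD subsetD)
      qed
      have T: "T h = insert (x h) (p h)" if "h \<in> H'" for h using fim that H'H unfolding T_def by blast
      have tyT: "typed 3 ty (T ` H')" unfolding typed_def
      proof
        fix e assume "e \<in> T ` H'"
        then obtain h where h: "h \<in> H'" "e = T h" by blast
        have b: "bij_betw (f h) {..<3} e" unfolding h(2) T_def
          using finj h(1) H'H by (auto simp: bij_betw_def)
        have "bij_betw (ty \<circ> f h) {..<3} {..<3}"
          using H'(3)[OF h(1)] by (intro bij_betw_cong[THEN iffD2, OF _ bij_betw_id]) auto
        then show "bij_betw ty e {..<3}" using b by (meson bij_betw_comp_iff)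
      qed
      have light: "card {e \<in> T ` H'. a \<in> e \<and> b \<in> e} \<le> 2 * m + 1" if ab: "a \<noteq> b" "ty a \<le> ty b" for a b
      proof (cases "\<exists>h\<in>H'. a \<in> T h \<and> b \<in> T h")
        case False
        then have "{e \<in> T ` H'. a \<in> e \<and> b \<in> e} = {}" by blast
        then show ?thesis by (metis card.empty zero_le)
      next
        case True
        then obtain h where h: "h \<in> H'" "a \<in> T h" "b \<in> T h" by blast
        have hH: "h \<in> H" using h H'H by blast
        show ?thesis
        proof (cases "ty b < 2")
          case True
          have "e = T h" if e: "e \<in> T ` H'" "a \<in> e" "b \<in> e" for e
          proof -
            obtain g where g: "g \<in> H'" "e = T g" using e(1) by blast
            have "a \<in> p g" "b \<in> p g" "a \<in> p h" "b \<in> p h"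
              using pty[OF g(1)] pty[OF h(1)] g h e True ab unfolding T_def by auto
            moreover have "card (p g) = 2" "card (p h) = 2" using p g h H'H by auto
            ultimately have "p g = p h" using ab(1)
              by (smt (verit) card_2_iff doubleton_eq_iff insert_iff singletonD)
            then show ?thesis using inj g h H'H by (metis inj_onD subsetD)
          qed
          then have "{e \<in> T ` H'. a \<in> e \<and> b \<in> e} \<subseteq> {T h}" by blast
          then have "card {e \<in> T ` H'. a \<in> e \<and> b \<in> e} \<le> 1" using card_mono[of "{T h}"] by force
          then show ?thesis by simp
        next
          case False
          have bx: "b = x h"
          proof (rule ccontr)
            assume "b \<noteq> x h"
            then have "b \<in> p h" using h T by auto
            then show False using False pty h by auto
          qed
          have "a \<in> p h" using h T ab bx by auto
          moreover have "x h \<in> h - p h" "h \<in> H - Ha" using uwx[OF hH] h H' unfolding Hb_def by auto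
          ultimately have c: "cod a b \<le> 2 * m + 1" unfolding Ha_def bx by (auto simp: not_less)
          have "{e \<in> T ` H'. a \<in> e \<and> b \<in> e} \<subseteq> T ` {g \<in> H. a \<in> g \<and> b \<in> g}"
          proof
            fix e assume "e \<in> {e \<in> T ` H'. a \<in> e \<and> b \<in> e}"
            then obtain g where g: "g \<in> H'" "e = T g" "a \<in> T g" "b \<in> T g" by blast
            have gH: "g \<in> H" using g H'H by blast
            have "T g \<subseteq> g" unfolding T[OF g(1)] using xh[OF gH] p[OF gH] by blast
            then show "e \<in> T ` {g \<in> H. a \<in> g \<and> b \<in> g}" using g gH by blast
          qed
          then have "card {e \<in> T ` H'. a \<in> e \<and> b \<in> e} \<le> card (T ` {g \<in> H. a \<in> g \<and> b \<in> g})"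
            using fH by (intro card_mono) auto
          also have "\<dots> \<le> cod a b" unfolding cod_def using fH by (intro card_image_le) auto
          finally show ?thesis using c by simp
        qed
      qed
      have "codeg_le (2 * m + 1) (T ` H')" unfolding codeg_le_def
      proof (intro allI impI)
        fix a b :: 'a assume ab: "a \<noteq> b"
        have sw: "{e \<in> T ` H'. a \<in> e \<and> b \<in> e} = {e \<in> T ` H'. b \<in> e \<and> a \<in> e}" by blast
        show "card {e \<in> T ` H'. a \<in> e \<and> b \<in> e} \<le> 2 * m + 1"
        proof (cases "ty a \<le> ty b")
          case True
          then show ?thesis using light[of a b] ab by simp
        next
          case False
          then show ?thesis using light[of b a] ab unfolding sw by simp
        qed
      qed
      moreover have "\<not> bcycle (T ` H') (2 * m + 1)"
      proof
        assume cyc: "bcycle (T ` H') (2 * m + 1)"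
        have "bcycle H (2 * m + 1)"
        proof (rule bcycle_map[OF cyc, of "inv_into H' T"])
          show "inj_on (inv_into H' T) (T ` H')" by (simp add: inj_on_inv_into)
          fix e assume "e \<in> T ` H'"
          then obtain h where h: "h \<in> H'" "e = T h" by blast
          have hH: "h \<in> H" using h H'H by blast
          have "inv_into H' T e = h" using injT h by simp
          moreover have "T h \<subseteq> h" unfolding T[OF h(1)] using xh[OF hH] p[OF hH] by blast
          ultimately show "inv_into H' T e \<in> H \<and> e \<subseteq> inv_into H' T e" using h hH by simp
        qed
        then show False using nocyc by simp
      qed
      moreover have "\<Union>(T ` H') \<subseteq> V" using fsub H'H unfolding T_def by blast
      ultimately have "real (card (T ` H')) \<le> K3 * N" using K3(2)[OF fV _ tyT] unfolding N_def by blast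
      moreover have "card (T ` H') = card H'" using injT by (rule card_image)
      moreover have "real (card Hb) \<le> 27 * real (card H')" using H'(2) by simp
      ultimately show ?thesis by simp
    qed
    have "H = Ha \<union> Hb" unfolding Hb_def Ha_def by auto
    then have "card H \<le> card Ha + card Hb" by (metis card_Un_le)
    then have "real (card H) \<le> real (card Ha) + real (card Hb)" by (metis of_nat_add of_nat_le_iff)
    then show ?thesis using Ha Hb unfolding N_def[symmetric] by (simp add: algebra_simps)
  qed
  moreover have "27 * K2 + 27 * K3 > 0" using K2 K3 by simp
  ultimately show thesis using that by blast
qed

lemma turan_berge_cycle:
  assumes m1: "m \<ge> 1" and len3: "3 \<le> len" and r2: "r \<ge> 2" and len: "len = 2 * m \<or> (len = 2 * m + 1 \<and> r \<ge> 3)"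
  obtains K where "K > 0" "\<And>(V :: 'a set) H. \<lbrakk>finite V; \<And>h. h \<in> H \<Longrightarrow> h \<subseteq> V \<and> card h = r; \<not> bcycle H len\<rbrakk>
     \<Longrightarrow> real (card H) \<le> K * real (card V) powr (1 + 1 / real m)"
proof -
  obtain K2 where K2: "K2 > 0" "\<And>(V :: 'a set) G. \<lbrakk>finite V; \<And>e. e \<in> G \<Longrightarrow> e \<subseteq> V \<and> card e = 2; \<not> bcycle G (2 * m)\<rbrakk>
     \<Longrightarrow> real (card G) \<le> K2 * real (card V) powr (1 + 1 / real m)"
    using turan_even_graph[OF m1] by blast
  obtain K3 where K3: "K3 > 0" "\<And>(V :: 'a set) H p. \<lbrakk>finite V; \<And>h. h \<in> H \<Longrightarrow> h \<subseteq> V \<and> 3 \<le> card h; inj_on p H;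
      \<And>h. h \<in> H \<Longrightarrow> p h \<subseteq> h \<and> card (p h) = 2; \<not> bcycle H (2 * m + 1)\<rbrakk>
     \<Longrightarrow> real (card H) \<le> K3 * real (card V) powr (1 + 1 / real m)"
    using turan_berge_odd[OF m1] by blast
  show thesis
  proof (cases "r = 2")
    case True
    then show thesis using that[OF K2(1)] K2(2) len by simp
  next
    case False
    then have r3: "r \<ge> 3" using r2 by simp
    have "real (card H) \<le> (2 ^ len * (K2 + K3)) * real (card V) powr (1 + 1 / real m)"
      if fV: "finite V" and H: "\<And>h. h \<in> H \<Longrightarrow> h \<subseteq> V \<and> card h = r" and nocyc: "\<not> bcycle H len"
      for V :: "'a set" and H
    proof -
      define N where "N = real (card V) powr (1 + 1 / real m)"
      have N0: "N \<ge> 0" unfolding N_def by simp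
      have fH: "finite H" using H fV by (intro finite_subset[of H "Pow V"]) auto
      have "\<exists>h\<in>H'. \<exists>u\<in>h. \<exists>v\<in>h. u \<noteq> v \<and> card {g \<in> H'. u \<in> g \<and> v \<in> g} \<le> 2 ^ len"
        if H': "H' \<subseteq> H" "H' \<noteq> {}" for H'
      proof (rule ccontr)
        assume no: "\<not> ?thesis"
        have "bcycle H' len"
        proof (rule heavy_core_cycle[OF _ H'(2) _ len3])
          show "finite H'" using H' fH finite_subset by blast
          show "3 \<le> card h" if "h \<in> H'" for h using that H' H r3 by auto
          show "2 ^ len < card {g \<in> H'. u \<in> g \<and> v \<in> g}" if "h \<in> H'" "u \<in> h" "v \<in> h" "u \<noteq> v" for h u v
            using no that by (meson not_le)
        qed
        then show False using nocyc bcycle_mono H' by blast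
      qed
      from private_pairs[OF fH this] obtain H1 p where H1: "H1 \<subseteq> H" "card H \<le> 2 ^ len * card H1" "inj_on p H1"
        "\<forall>h\<in>H1. p h \<subseteq> h \<and> card (p h) = 2" by blast
      have nocyc1: "\<not> bcycle H1 len" using nocyc bcycle_mono H1 by blast
      have "real (card H1) \<le> (K2 + K3) * N"
      proof (cases "len = 2 * m")
        case True
        have "\<not> bcycle (p ` H1) (2 * m)"
        proof
          assume cyc: "bcycle (p ` H1) (2 * m)"
          have "bcycle H1 (2 * m)"
          proof (rule bcycle_map[OF cyc, of "inv_into H1 p"])
            show "inj_on (inv_into H1 p) (p ` H1)" by (simp add: inj_on_inv_into)
            fix e assume "e \<in> p ` H1"
            then obtain h where h: "h \<in> H1" "e = p h" by blast
            then have "inv_into H1 p e = h" using H1(3) by simp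
            then show "inv_into H1 p e \<in> H1 \<and> e \<subseteq> inv_into H1 p e" using H1(4) h by simp
          qed
          then show False using nocyc1 True by simp
        qed
        moreover have "e \<subseteq> V \<and> card e = 2" if "e \<in> p ` H1" for e using that H1 H by blast
        ultimately have "real (card (p ` H1)) \<le> K2 * N" using K2(2)[OF fV] unfolding N_def by blast
        moreover have "card (p ` H1) = card H1" using H1(3) by (rule card_image)
        moreover have "K3 * N \<ge> 0" using K3 N0 by simp
        ultimately show ?thesis by (simp add: algebra_simps)
      next
        case False
        then have "\<not> bcycle H1 (2 * m + 1)" using nocyc1 len by auto
        moreover have "h \<subseteq> V \<and> 3 \<le> card h" if "h \<in> H1" for h
          using H[OF subsetD[OF H1(1) that]] r3 by simp
        ultimately have "real (card H1) \<le> K3 * N" using K3(2)[OF fV _ H1(3)] H1(4) unfolding N_def by blast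
        moreover have "K2 * N \<ge> 0" using K2 N0 by simp
        ultimately show ?thesis by (simp add: algebra_simps)
      qed
      then have up: "2 ^ len * real (card H1) \<le> 2 ^ len * ((K2 + K3) * N)" by (intro mult_left_mono) auto
      have "real (card H) \<le> 2 ^ len * real (card H1)"
        using H1(2) by (metis of_nat_le_iff of_nat_mult of_nat_numeral of_nat_power)
      from order_trans[OF this up] show ?thesis unfolding N_def by (simp add: mult.assoc)
    qed
    moreover have "2 ^ len * (K2 + K3) > 0" using K2 K3 by simp
    ultimately show thesis using that by blast
  qed
qed

section \<open>Ramsey numbers of Berge cycles: the upper bound\<close>

lemma cycle_edge_inj:
  fixes l :: nat
  assumes "l \<ge> 3"
  shows "inj_on (\<lambda>i. {i, (i + 1) mod l}) {..<l}"
proof (rule inj_onI)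
  fix i j assume ij: "i \<in> {..<l}" "j \<in> {..<l}" "{i, (i + 1) mod l} = {j, (j + 1) mod l}"
  show "i = j"
  proof (rule ccontr)
    assume n: "i \<noteq> j"
    have "i \<in> {j, (j + 1) mod l}" "j \<in> {i, (i + 1) mod l}" using ij(3) by blast+
    then have e: "i = (j + 1) mod l" "j = (i + 1) mod l" using n by auto
    show False
    proof (cases "Suc j = l")
      case True
      then have "i = 0" using e(1) by simp
      then have "j = 1" using e(2) assms by simp
      then show False using True assms by simp
    next
      case False
      then have "Suc j < l" using ij(2) by simp
      then have i: "i = Suc j" using e(1) by simp
      show False
      proof (cases "Suc (Suc j) = l")
        case True
        then have "j = 0" using e(2) unfolding i by simp
        then show False using True assms by simp
      next
        case False
        then have "Suc (Suc j) < l" using \<open>Suc j < l\<close> by simp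
        then have "(i + 1) mod l = Suc (Suc j)" unfolding i by simp
        then show False using e(2) by linarith
      qed
    qed
  qed
qed

text \<open>For the direction from right to left, the Berge cycle has to be relabelled so that its vertices
become \<open>0, \<dots>, l - 1\<close>; \<open>\<tau>\<close> is a permutation of the vertices that does this.\<close>

lemma contains_berge_cycle_iff:
  fixes n :: nat
  assumes l: "l \<ge> 3" and E: "\<And>e. e \<in> E \<Longrightarrow> e \<subseteq> {..<n}"
  shows "(\<exists>F \<in> berge (cycle_graph l). contains_copy ({..<n}, E) F) \<longleftrightarrow> bcycle E l"
proof -
  define ed where "ed i = {i, (i + 1) mod l}" for i
  have hed: "hedges (cycle_graph l) = ed ` {..<l}" "verts (cycle_graph l) = {..<l}"
    unfolding cycle_graph_def ed_def by auto
  have injed: "inj_on ed {..<l}" unfolding ed_def using cycle_edge_inj[OF l] .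
  show ?thesis
  proof
    assume "\<exists>F \<in> berge (cycle_graph l). contains_copy ({..<n}, E) F"
    then obtain F where F: "is_berge (cycle_graph l) F" "contains_copy ({..<n}, E) F" unfolding berge_def by blast
    obtain \<phi> where \<phi>: "bij_betw \<phi> (ed ` {..<l}) (hedges F)" "\<And>i. i < l \<Longrightarrow> ed i \<subseteq> \<phi> (ed i)"
      using F(1) unfolding is_berge_def hed by auto
    have hF: "\<And>e. e \<in> hedges F \<Longrightarrow> e \<subseteq> verts F" "{..<l} \<subseteq> verts F"
      using F(1) unfolding is_berge_def hypergraph_def hed by auto
    obtain g where g: "inj_on g (verts F)" "\<And>e. e \<in> hedges F \<Longrightarrow> g ` e \<in> E"
      using F(2) unfolding contains_copy_def by auto
    have \<phi>F: "\<phi> (ed i) \<in> hedges F" if "i < l" for i using \<phi>(1) that unfolding bij_betw_def by auto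
    have "inj_on g {..<l}" using g(1) hF(2) inj_on_subset by blast
    moreover have "inj_on (\<lambda>i. g ` \<phi> (ed i)) {..<l}"
    proof (rule inj_onI)
      fix i j assume ij: "i \<in> {..<l}" "j \<in> {..<l}" "g ` \<phi> (ed i) = g ` \<phi> (ed j)"
      then have "\<phi> (ed i) = \<phi> (ed j)" using inj_on_image_eq_iff[OF g(1)] hF(1) \<phi>F by simp
      then have "ed i = ed j" using \<phi>(1) ij unfolding bij_betw_def by (auto dest: inj_onD)
      then show "i = j" using injed ij by (auto dest: inj_onD)
    qed
    moreover have "g ` \<phi> (ed i) \<in> E \<and> g i \<in> g ` \<phi> (ed i) \<and> g ((i + 1) mod l) \<in> g ` \<phi> (ed i)" if "i < l" for i
      using g(2)[OF \<phi>F[OF that]] \<phi>(2)[OF that] unfolding ed_def by auto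
    moreover have "l \<ge> 2" using l by simp
    ultimately show "bcycle E l" unfolding bcycle_iff[OF \<open>l \<ge> 2\<close>] by blast
  next
    assume c: "bcycle E l"
    have "l \<ge> 2" using l by simp
    then obtain w g where wg: "inj_on w {..<l}" "inj_on g {..<l}"
      "\<And>i. i < l \<Longrightarrow> g i \<in> E \<and> w i \<in> g i \<and> w ((i + 1) mod l) \<in> g i"
      using c unfolding bcycle_iff[OF \<open>l \<ge> 2\<close>] by blast
    have wn: "w ` {..<l} \<subseteq> {..<n}" using wg(3) E by blast
    have ln: "l \<le> n" using card_mono[OF _ wn] card_image[OF wg(1)] by simp
    have "card ({..<n} - {..<l}) = card ({..<n} - w ` {..<l})"
      using ln wn card_image[OF wg(1)] by (simp add: card_Diff_subset)
    then obtain w' where w': "bij_betw w' ({..<n} - {..<l}) ({..<n} - w ` {..<l})"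
      using finite_same_card_bij[of "{..<n} - {..<l}" "{..<n} - w ` {..<l}"] by auto
    define \<tau> where "\<tau> i = (if i < l then w i else w' i)" for i
    have "bij_betw \<tau> ({..<l} \<union> ({..<n} - {..<l})) (w ` {..<l} \<union> ({..<n} - w ` {..<l}))"
    proof (rule bij_betw_combine)
      show "bij_betw \<tau> {..<l} (w ` {..<l})" using wg(1) unfolding bij_betw_def \<tau>_def by (auto simp: inj_on_def)
      show "bij_betw \<tau> ({..<n} - {..<l}) ({..<n} - w ` {..<l})"
        using w' by (rule bij_betw_cong[THEN iffD2, rotated]) (auto simp: \<tau>_def)
    qed auto
    moreover have "{..<l} \<union> ({..<n} - {..<l}) = {..<n}" "w ` {..<l} \<union> ({..<n} - w ` {..<l}) = {..<n}"
      using ln wn by auto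
    ultimately have \<tau>: "bij_betw \<tau> {..<n} {..<n}" by simp
    define \<rho> where "\<rho> = inv_into {..<n} \<tau>"
    have \<rho>\<tau>: "\<rho> (\<tau> i) = i" if "i < n" for i unfolding \<rho>_def using \<tau> that unfolding bij_betw_def by simp
    have \<tau>\<rho>: "\<tau> (\<rho> v) = v" "\<rho> v < n" if "v < n" for v
    proof -
      have "v \<in> \<tau> ` {..<n}" using that \<tau> unfolding bij_betw_def by simp
      then show "\<tau> (\<rho> v) = v" "\<rho> v < n" unfolding \<rho>_def
        using f_inv_into_f[of v \<tau>] inv_into_into[of v \<tau> "{..<n}"] by auto
    qed
    have \<tau>\<rho>i: "\<tau> ` \<rho> ` e = e" if "e \<subseteq> {..<n}" for e
    proof -
      have "(\<lambda>v. \<tau> (\<rho> v)) ` e = (\<lambda>v. v) ` e" using that \<tau>\<rho>(1) by (intro image_cong) auto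
      then show ?thesis by (simp add: image_image)
    qed
    define F where "F = ({..<n}, (\<lambda>i. \<rho> ` g i) ` {..<l})"
    define \<phi> where "\<phi> e = \<rho> ` g (inv_into {..<l} ed e)" for e
    have \<phi>ed: "\<phi> (ed i) = \<rho> ` g i" if "i < l" for i unfolding \<phi>_def using injed that by simp
    have gn: "g i \<subseteq> {..<n}" if "i < l" for i using wg(3)[OF that] E by blast
    have "inj_on \<phi> (ed ` {..<l})"
    proof (rule inj_onI)
      fix e e' assume "e \<in> ed ` {..<l}" "e' \<in> ed ` {..<l}" and eq: "\<phi> e = \<phi> e'"
      then obtain i j where ij: "i < l" "e = ed i" "j < l" "e' = ed j" by auto
      then have "\<tau> ` \<rho> ` g i = \<tau> ` \<rho> ` g j" using eq \<phi>ed by simp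
      then have "g i = g j" using \<tau>\<rho>i gn ij by simp
      then show "e = e'" using wg(2) ij by (auto dest: inj_onD)
    qed
    then have "bij_betw \<phi> (ed ` {..<l}) (hedges F)"
      unfolding bij_betw_def F_def using \<phi>ed by (simp add: image_image)
    moreover have "e \<subseteq> \<phi> e" if "e \<in> ed ` {..<l}" for e
    proof -
      obtain i where i: "i < l" "e = ed i" using \<open>e \<in> ed ` {..<l}\<close> by auto
      have "i = \<rho> (w i)" using \<rho>\<tau>[of i] i ln unfolding \<tau>_def by simp
      moreover have "(i + 1) mod l < l" using l by simp
      then have "(i + 1) mod l = \<rho> (w ((i + 1) mod l))" using \<rho>\<tau>[of "(i + 1) mod l"] ln unfolding \<tau>_def by simp
      ultimately have "i \<in> \<rho> ` g i" "(i + 1) mod l \<in> \<rho> ` g i" using wg(3)[OF i(1)] by (metis imageI)+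
      then show ?thesis using \<phi>ed[OF i(1)] unfolding i(2) ed_def by simp
    qed
    moreover have "hypergraph F" unfolding hypergraph_def F_def using gn \<tau>\<rho>(2) by fastforce
    moreover have "verts (cycle_graph l) \<subseteq> verts F" unfolding hed F_def using ln by auto
    ultimately have "is_berge (cycle_graph l) F" unfolding is_berge_def hed by blast
    moreover have "contains_copy ({..<n}, E) F" unfolding contains_copy_def
    proof (intro exI conjI)
      show "inj_on \<tau> (verts F)" "\<tau> ` verts F \<subseteq> verts ({..<n}, E)" using \<tau> unfolding F_def bij_betw_def by auto
      show "\<forall>e\<in>hedges F. \<tau> ` e \<in> hedges ({..<n}, E)" unfolding F_def using \<tau>\<rho>i gn wg(3) by auto
    qed
    ultimately show "\<exists>F \<in> berge (cycle_graph l). contains_copy ({..<n}, E) F" unfolding berge_def by blast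
  qed
qed

lemma ramsey_property_berge_cycle_iff:
  assumes "l \<ge> 3"
  shows "ramsey_property r (berge (cycle_graph l)) k n \<longleftrightarrow>
     (\<forall>c \<in> nsets {..<n} r \<rightarrow> {..<k}. \<exists>i<k. bcycle {e \<in> nsets {..<n} r. c e = i} l)"
  unfolding ramsey_property_def
  by (subst contains_berge_cycle_iff[OF assms]) (auto simp: nsets_def)

lemma ramsey_property_mono:
  assumes "ramsey_property r \<F> k n" "n \<le> n'"
  shows "ramsey_property r \<F> k n'"
  unfolding ramsey_property_def
proof
  fix c assume c: "c \<in> nsets {..<n'} r \<rightarrow> {..<k}"
  have sub: "nsets {..<n} r \<subseteq> nsets {..<n'} r" using assms(2) by (intro nsets_mono) auto
  then have "c \<in> nsets {..<n} r \<rightarrow> {..<k}" using c by auto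
  then obtain i F g where F: "i < k" "F \<in> \<F>" "inj_on g (verts F)" "g ` verts F \<subseteq> {..<n}"
     "\<forall>e \<in> hedges F. g ` e \<in> {e \<in> nsets {..<n} r. c e = i}"
    using assms(1) unfolding ramsey_property_def contains_copy_def by auto
  then have "contains_copy ({..<n'}, {e \<in> nsets {..<n'} r. c e = i}) F"
    unfolding contains_copy_def using sub assms(2) by (intro exI[of _ g]) auto
  then show "\<exists>i<k. \<exists>F\<in>\<F>. contains_copy ({..<n'}, {e \<in> nsets {..<n'} r. c e = i}) F" using F by blast
qed

text \<open>If no colour class contains the cycle, then
\<open>(n / r) ^ r \<le> n choose r \<le> k * K * n powr (1 + 1 / m)\<close>, which bounds \<open>n powr \<alpha>\<close> by a multiple of \<open>k\<close>.\<close>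

lemma ramsey_upper_bound:
  assumes m2: "m \<ge> 2" and r2: "r \<ge> 2" and len: "len = 2 * m \<or> (len = 2 * m + 1 \<and> r \<ge> 3)"
  obtains C where "C > 0" "\<And>k. k \<ge> 1 \<Longrightarrow> \<exists>n. ramsey_property r (berge (cycle_graph len)) k n \<and>
     real n \<le> C * real k powr (1 / (real r - 1 - 1 / real m))"
proof -
  define \<alpha> where "\<alpha> = real r - 1 - 1 / real m"
  have "1 / real m \<le> 1 / 2" using m2 by (simp add: field_simps)
  then have \<alpha>: "\<alpha> > 0" unfolding \<alpha>_def using r2 by simp
  have l3: "len \<ge> 3" using len m2 by auto
  obtain K where K: "K > 0" "\<And>(V :: nat set) H. \<lbrakk>finite V; \<And>h. h \<in> H \<Longrightarrow> h \<subseteq> V \<and> card h = r; \<not> bcycle H len\<rbrakk>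
     \<Longrightarrow> real (card H) \<le> K * real (card V) powr (1 + 1 / real m)"
    using turan_berge_cycle[of m len r] m2 l3 r2 len by (metis (no_types, lifting) Suc_1 Suc_leD)
  define B where "B = (K * real r ^ r) powr (1 / \<alpha>)"
  have Kr: "K * real r ^ r > 0" using K(1) r2 by simp
  have "\<exists>n. ramsey_property r (berge (cycle_graph len)) k n \<and> real n \<le> (B + 1 + real r) * real k powr (1 / \<alpha>)"
    if k: "k \<ge> 1" for k
  proof -
    define x where "x = (real k * (K * real r ^ r)) powr (1 / \<alpha>)"
    have x: "x = B * real k powr (1 / \<alpha>)" unfolding x_def B_def using Kr k by (simp add: powr_mult mult.commute)
    have "real k * (K * real r ^ r) > 0" by (rule mult_pos_pos[OF _ Kr]) (use k in simp)
    then have x0: "x > 0" unfolding x_def by (simp only: powr_gt_zero)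
    define n where "n = nat \<lfloor>x\<rfloor> + 1 + r"
    have nx: "real n > x" unfolding n_def using x0 by linarith
    have "real n \<le> x + 1 + real r" unfolding n_def using x0 by linarith
    also have "\<dots> \<le> (B + 1 + real r) * real k powr (1 / \<alpha>)"
    proof -
      have "real k powr (1 / \<alpha>) \<ge> 1" using k \<alpha> by (simp add: ge_one_powr_ge_zero)
      then have "(1 + real r) * 1 \<le> (1 + real r) * real k powr (1 / \<alpha>)" by (intro mult_left_mono) auto
      then show ?thesis unfolding x by (simp add: algebra_simps)
    qed
    finally have nb: "real n \<le> (B + 1 + real r) * real k powr (1 / \<alpha>)" .
    have n0: "real n > 0" using nx x0 by linarith
    have rn: "r \<le> n" unfolding n_def by simp
    have "ramsey_property r (berge (cycle_graph len)) k n"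
      unfolding ramsey_property_berge_cycle_iff[OF l3]
    proof (rule ballI, rule ccontr)
      fix c assume c: "c \<in> nsets {..<n} r \<rightarrow> {..<k}" and no: "\<not> (\<exists>i<k. bcycle {e \<in> nsets {..<n} r. c e = i} len)"
      have fin: "finite (nsets {..<n} r)" by (simp add: finite_imp_finite_nsets)
      have "card (nsets {..<n} r) = (\<Sum>i<k. card {e \<in> nsets {..<n} r. c e = i})"
        using sum.group[OF fin, of "{..<k}" c "\<lambda>_. 1::nat"] c by (auto simp: Pi_iff image_subset_iff)
      then have "real (n choose r) = (\<Sum>i<k. real (card {e \<in> nsets {..<n} r. c e = i}))"
        by (simp add: card_nsets)
      also have "\<dots> \<le> (\<Sum>i<k. K * real n powr (1 + 1 / real m))"
      proof (rule sum_mono)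
        fix i assume "i \<in> {..<k}"
        then have "\<not> bcycle {e \<in> nsets {..<n} r. c e = i} len" using no by simp
        from K(2)[OF _ _ this, of "{..<n}"]
        show "real (card {e \<in> nsets {..<n} r. c e = i}) \<le> K * real n powr (1 + 1 / real m)"
          by (simp add: nsets_def)
      qed
      also have "\<dots> = real k * K * real n powr (1 + 1 / real m)" by simp
      finally have up: "real (n choose r) \<le> real k * K * real n powr (1 + 1 / real m)" .
      have "(real n / real r) ^ r \<le> real (n choose r)"
        using binomial_ge_n_over_k_pow_k[OF rn, where 'a = real] by simp
      then have "real n ^ r / real r ^ r \<le> real k * K * real n powr (1 + 1 / real m)"
        using up by (simp add: power_divide)
      then have "real n ^ r \<le> real k * (K * real r ^ r) * real n powr (1 + 1 / real m)"
        using r2 by (simp add: field_simps)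
      moreover have "real n ^ r = real n powr \<alpha> * real n powr (1 + 1 / real m)"
        unfolding powr_add[symmetric] \<alpha>_def using n0 by (simp add: powr_realpow)
      ultimately have "real n powr \<alpha> \<le> real k * (K * real r ^ r)" using n0 by simp
      then have "(real n powr \<alpha>) powr (1 / \<alpha>) \<le> x" unfolding x_def using \<alpha> by (intro powr_mono2) auto
      then have "real n \<le> x" using \<alpha> n0 by (simp add: powr_powr)
      then show False using nx by simp
    qed
    then show ?thesis using nb by blast
  qed
  moreover have "B + 1 + real r > 0" unfolding B_def by (simp add: add_nonneg_pos add_pos_nonneg)
  ultimately show thesis using that unfolding \<alpha>_def by blast
qed

section \<open>Finite fields of characteristic two\<close>

lemma char_bit: "CHAR(bit) = 2"
  by (rule CHAR_eq_posI) (auto simp: less_2_cases_iff)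

lemma card_roots_squarefree:
  fixes p :: "'a :: alg_closed_field poly"
  assumes "p \<noteq> 0" "\<And>x. poly p x = 0 \<Longrightarrow> poly (pderiv p) x \<noteq> 0"
  shows "card {x. poly p x = 0} = degree p"
proof -
  obtain A where A: "size A = degree p" "p = smult (lead_coeff p) (\<Prod>x\<in>#A. [:-x, 1:])"
    using alg_closed_imp_factorization[OF assms(1)] by blast
  have roots: "{x. poly p x = 0} = set_mset A"
    using assms(1) by (subst A(2)) (auto simp: poly_prod_mset prod_mset_zero_iff)
  have "count A x \<le> 1" for x
  proof (rule ccontr)
    assume "\<not> count A x \<le> 1"
    then have "replicate_mset 2 x \<subseteq># A" by (simp add: count_le_replicate_mset_subset_eq[symmetric])
    then obtain B where "A = replicate_mset 2 x + B" using mset_subset_eq_exists_conv by blast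
    then have "(\<Prod>x\<in>#A. [:-x, 1:]) = [:-x, 1:] ^ 2 * (\<Prod>x\<in>#B. [:-x, 1:])"
      by (simp only: image_mset_union prod_mset.union image_replicate_mset prod_mset_replicate_mset)
    then have "[:-x, 1:] ^ 2 dvd (\<Prod>x\<in>#A. [:-x, 1:])" by (simp only: dvd_triv_left)
    then have "[:-x, 1:] ^ 2 dvd p" by (subst A(2)) (rule dvd_smult)
    then obtain q where q: "p = [:-x, 1:] ^ 2 * q" by (elim dvdE)
    have "poly [:-x, 1:] x = 0" by simp
    then have "poly p x = 0" "poly (pderiv p) x = 0" unfolding q power2_eq_square
      by (simp_all only: pderiv_mult poly_add poly_mult mult_zero_left mult_zero_right add_0_left)
    then show False using assms(2) by blast
  qed
  then have "mset_set (set_mset A) = A"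
    by (intro multiset_eqI) (auto simp: count_mset_set' not_in_iff order_antisym Suc_le_eq count_greater_zero_iff
        dest: le_antisym)
  then have "card (set_mset A) = size A" by (metis size_mset_set)
  then show ?thesis using roots A(1) by simp
qed

text \<open>The field with \<open>2 ^ \<sigma>\<close> elements is the set of fixed points of an iterate of the Frobenius map in the
algebraic closure of the field with two elements: \<open>x ^ q - x\<close> has no multiple roots, as its
derivative is \<open>-1\<close>. Taking powers of a fixed prime provides fields whose size is within a constant
factor of any given number.\<close>

lemma finite_subfield_exists:
  assumes "\<sigma> \<ge> 1"
  obtains F :: "bit alg_closure set" where "finite F" "card F = 2 ^ \<sigma>" "0 \<in> F" "1 \<in> F"
    "\<And>x y. x \<in> F \<Longrightarrow> y \<in> F \<Longrightarrow> x + y \<in> F" "\<And>x y. x \<in> F \<Longrightarrow> y \<in> F \<Longrightarrow> x - y \<in> F"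
    "\<And>x y. x \<in> F \<Longrightarrow> y \<in> F \<Longrightarrow> x * y \<in> F"
proof -
  define q :: nat where "q = 2 ^ \<sigma>"
  have char: "CHAR(bit alg_closure) = 2" by (simp add: char_bit)
  have q1: "q > 1" using one_less_power[of "2::nat" \<sigma>] assms unfolding q_def by simp
  have q0: "of_nat q = (0 :: bit alg_closure)" unfolding of_nat_eq_0_iff_char_dvd char q_def
    using assms by simp
  have two: "(2 :: bit alg_closure) = 0" using of_nat_CHAR[where 'a = "bit alg_closure"] unfolding char by simp
  then have neg: "- x = x" for x :: "bit alg_closure" by (metis add_eq_0_iff2 mult_2 mult_zero_left)
  define F where "F = {x :: bit alg_closure. x ^ q = x}"
  define p :: "bit alg_closure poly" where "p = monom 1 q - [:0, 1:]"
  have roots: "{x. poly p x = 0} = F" unfolding p_def F_def by (simp add: poly_monom)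
  have dp: "degree p = q"
  proof -
    have "degree [:0, 1 :: bit alg_closure:] < degree (monom (1 :: bit alg_closure) q)" using q1 by (simp add: degree_monom_eq)
    then have "degree (monom (1 :: bit alg_closure) q + - [:0, 1:]) = degree (monom (1 :: bit alg_closure) q)"
      by (intro degree_add_eq_left) simp
    then show ?thesis unfolding p_def by (metis degree_monom_eq diff_conv_add_uminus one_neq_zero)
  qed
  have p0: "p \<noteq> 0" using dp q1 by auto
  have "pderiv p = - 1" unfolding p_def
    by (simp add: pderiv_diff pderiv_monom q0 pderiv_pCons) (simp add: one_pCons)
  then have cF: "card F = q" using card_roots_squarefree[OF p0] dp roots by simp
  have "prime CHAR(bit alg_closure)" by (simp add: char_bit)
  then have fr: "(x + y) ^ q = x ^ q + y ^ q" for x y :: "bit alg_closure"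
    using freshmans_dream'[of q \<sigma> x y] unfolding q_def char by simp
  show thesis
  proof
    show "card F = 2 ^ \<sigma>" using cF unfolding q_def .
    show "finite F" using cF q1 card.infinite by fastforce
    show "0 \<in> F" "1 \<in> F" unfolding F_def using q1 by auto
    show add: "x + y \<in> F" if "x \<in> F" "y \<in> F" for x y using that fr unfolding F_def by simp
    show "x - y \<in> F" if "x \<in> F" "y \<in> F" for x y
      using add[OF that] neg[of y] by (metis add_uminus_conv_diff)
    show "x * y \<in> F" if "x \<in> F" "y \<in> F" for x y using that unfolding F_def by (simp add: power_mult_distrib)
  qed
qed

section \<open>Bipartite graphs of girth \<open>2 m + 2\<close>\<close>

text \<open>\<open>G\<close> is the set of edges of a bipartite graph with points \<open>p i\<close> and lines \<open>l i\<close>; a closed walk visits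
\<open>l 0, p 0, l 1, p 1, \<dots>, l s = l 0\<close> and never turns back. Excluding such walks instead of cycles gives the
same notion of girth, with conditions on neighbouring nodes only.\<close>

definition no_short_closed_walk :: "nat \<Rightarrow> ('p \<times> 'l) set \<Rightarrow> bool" where
  "no_short_closed_walk m G \<longleftrightarrow> (\<forall>s p l. 2 \<le> s \<longrightarrow> s \<le> m \<longrightarrow> p s = p 0 \<longrightarrow> l s = l 0 \<longrightarrow>
     \<not> (\<forall>i<s. (p i, l i) \<in> G \<and> (p i, l (Suc i)) \<in> G \<and> p i \<noteq> p (Suc i) \<and> l i \<noteq> l (Suc i)))"

text \<open>A locally injective homomorphism sends walks that never turn back to such walks.\<close>

lemma no_short_closed_walk_map:
  assumes "no_short_closed_walk m G'" and hom: "\<And>x y. (x, y) \<in> G \<Longrightarrow> (\<iota> x, \<kappa> y) \<in> G'"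
    and inj1: "\<And>x x' y. (x, y) \<in> G \<Longrightarrow> (x', y) \<in> G \<Longrightarrow> \<iota> x = \<iota> x' \<Longrightarrow> x = x'"
    and inj2: "\<And>x y y'. (x, y) \<in> G \<Longrightarrow> (x, y') \<in> G \<Longrightarrow> \<kappa> y = \<kappa> y' \<Longrightarrow> y = y'"
  shows "no_short_closed_walk m G"
  unfolding no_short_closed_walk_def
proof (intro allI impI notI)
  fix s p l
  assume s: "2 \<le> s" "s \<le> m" and cl: "p s = p 0" "l s = l 0"
    and w: "\<forall>i<s. (p i, l i) \<in> G \<and> (p i, l (Suc i)) \<in> G \<and> p i \<noteq> p (Suc i) \<and> l i \<noteq> l (Suc i)"
  have next_pt: "(p (Suc i), l (Suc i)) \<in> G" if "i < s" for i
  proof (cases "Suc i = s")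
    case True
    then show ?thesis using cl w s by auto
  next
    case False
    then show ?thesis using that w by auto
  qed
  have "\<iota> (p i) \<noteq> \<iota> (p (Suc i))" "\<kappa> (l i) \<noteq> \<kappa> (l (Suc i))" if "i < s" for i
    using w that inj1[OF _ next_pt[OF that]] inj2[of "p i" "l i" "l (Suc i)"] by auto
  then have "\<forall>i<s. (\<iota> (p i), \<kappa> (l i)) \<in> G' \<and> (\<iota> (p i), \<kappa> (l (Suc i))) \<in> G' \<and>
     \<iota> (p i) \<noteq> \<iota> (p (Suc i)) \<and> \<kappa> (l i) \<noteq> \<kappa> (l (Suc i))" using w hom by blast
  moreover have "\<iota> (p s) = \<iota> (p 0)" "\<kappa> (l s) = \<kappa> (l 0)" using cl by auto
  ultimately show False using assms(1)[unfolded no_short_closed_walk_def, rule_format, of s "\<lambda>i. \<iota> (p i)" "\<lambda>i. \<kappa> (l i)"] s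
    by blast
qed

lemma triangle_moments:
  fixes u s :: "nat \<Rightarrow> 'a :: idom"
  assumes M: "\<And>k. k < 3 \<Longrightarrow> (\<Sum>i<3. u i * s i ^ k) = 0"
  shows "u 0 * ((s 0 - s 1) * (s 0 - s 2)) = 0"
proof -
  have M': "u 0 + u 1 + u 2 = 0" "u 0 * s 0 + u 1 * s 1 + u 2 * s 2 = 0"
    "u 0 * s 0 ^ 2 + u 1 * s 1 ^ 2 + u 2 * s 2 ^ 2 = 0"
    using M[of 0] M[of 1] M[of 2] by (simp_all add: eval_nat_numeral lessThan_Suc add_ac)
  have "u 0 * ((s 0 - s 1) * (s 0 - s 2)) = (u 0 * s 0 ^ 2 + u 1 * s 1 ^ 2 + u 2 * s 2 ^ 2)
     - (s 1 + s 2) * (u 0 * s 0 + u 1 * s 1 + u 2 * s 2) + s 1 * s 2 * (u 0 + u 1 + u 2)"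
    by (simp add: algebra_simps power2_eq_square)
  then show ?thesis using M' by simp
qed

text \<open>The heart of the case \<open>m = 5\<close>. The factor in brackets is the quadratic form in \<open>u\<close> that a closed walk with
five points and five lines annihilates, while \<open>M0, \<dots>, M3\<close> vanish because of the linear equations. Modulo these,
\<open>s2 - s4\<close> times the form is a single product, whose factors are nonzero on such a walk. The
cofactors of \<open>M0, \<dots>, M3\<close> were found by linear algebra. An identity with integer coefficients and
without denominators is needed here, because the fields have characteristic two.\<close>

lemma pentagon_identity:
  fixes u0 u1 u2 u3 u4 s0 s1 s2 s3 s4 :: "'a :: comm_ring_1"
  defines "M0 \<equiv> u0 + u1 + u2 + u3 + u4"
    and "M1 \<equiv> u0*s0 + u1*s1 + u2*s2 + u3*s3 + u4*s4"
    and "M2 \<equiv> u0*s0^2 + u1*s1^2 + u2*s2^2 + u3*s3^2 + u4*s4^2"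
    and "M3 \<equiv> u0*s0^3 + u1*s1^3 + u2*s2^3 + u3*s3^3 + u4*s4^3"
  shows "(s2 - s4) * (
      u1 * (u0*s1^3 - 3*(u0*s0)*s1^2)
    + u2 * ((u0 + u1)*s2^3 - 3*(u0*s0 + u1*s1)*s2^2)
    + u3 * ((u0 + u1 + u2)*s3^3 - 3*(u0*s0 + u1*s1 + u2*s2)*s3^2)
    + u4 * ((u0 + u1 + u2 + u3)*s4^3 - 3*(u0*s0 + u1*s1 + u2*s2 + u3*s3)*s4^2)
    - (u0^2*s0^3 + u1^2*s1^3 + u2^2*s2^3 + u3^2*s3^3 + u4^2*s4^3))
   = M0 * (s4 * (u0*s0*(s0*s3 - 2*s2*s4 - s3*s4 + 2*s4^2) + u1*s1*(s1*s3 - 2*s2*s4 - s3*s4 + 2*s4^2)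
        + u2*s2*(s2*s3 - 2*s2*s4 - s3*s4 + 2*s4^2) + u3*s3*(s2*s3 - 2*s2*s4 - s3*s4 + 2*s4^2) + u4*s4^2*(s4 - s2)))
   + M1 * (u0*(s0*s2*s4 - s0^2*s3 - s0^2*s4 + 2*s2*s4^2 + s3*s4^2 - 2*s4^3)
        + u1*(s1*s2*s4 - s1^2*s3 - s1^2*s4 + 2*s2*s4^2 + s3*s4^2 - 2*s4^3)
        + u2*(2*s2*s4^2 - s2^2*s3 + s3*s4^2 - 2*s4^3)
        + u3*(2*s2*s4^2 - s2*s3^2 - s2*s3*s4 + s3^2*s4 + s3*s4^2 - 2*s4^3))
   + M2 * (u0*(s0^2 - 2*s0*s2 + s0*s3 + 2*s0*s4 - s2*s4 - s3*s4)
        + u1*(s1^2 - 2*s1*s2 + s1*s3 + 2*s1*s4 - s2*s4 - s3*s4)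
        + u2*(s2*s3 - s2^2 + s2*s4 - s3*s4))
   + M3 * (u0*(s2 - s0) + u1*(s2 - s1))
   - u0*u1*(s0 - s1)^2*(s1 - s2)*(s4 - s0)"
  unfolding M0_def M1_def M2_def M3_def
  by (simp add: algebra_simps power2_eq_square power3_eq_cube)

text \<open>The starting values \<open>a\<close> and \<open>b\<close> only contribute multiples of the third and the second moment.\<close>

lemma pentagon_moments:
  fixes u s :: "nat \<Rightarrow> 'a :: idom"
  assumes M: "\<And>k. k < 4 \<Longrightarrow> (\<Sum>i<5. u i * s i ^ k) = 0"
    and E: "(\<Sum>i<5. u i * ((a + (\<Sum>k<i. u k)) * s i ^ 3 - 3 * (b + (\<Sum>k<i. u k * s k)) * s i ^ 2) - u i ^ 2 * s i ^ 3) = 0"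
  shows "u 0 * u 1 * (s 0 - s 1) ^ 2 * (s 1 - s 2) * (s 4 - s 0) = 0"
proof -
  have five: "{..<5} = {0, 1, 2, 3, 4 :: nat}" "{..<4} = {0, 1, 2, 3 :: nat}" "{..<3} = {0, 1, 2 :: nat}"
    "{..<2} = {0, 1 :: nat}" "{..<1} = {0 :: nat}" by auto
  have M0: "u 0 + u 1 + u 2 + u 3 + u 4 = 0" using M[of 0] by (simp add: five add_ac)
  have M1: "u 0 * s 0 + u 1 * s 1 + u 2 * s 2 + u 3 * s 3 + u 4 * s 4 = 0"
    using M[of 1] by (simp add: five add_ac)
  have M2: "u 0 * s 0 ^ 2 + u 1 * s 1 ^ 2 + u 2 * s 2 ^ 2 + u 3 * s 3 ^ 2 + u 4 * s 4 ^ 2 = 0"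
    using M[of 2] by (simp add: five add_ac)
  have M3: "u 0 * s 0 ^ 3 + u 1 * s 1 ^ 3 + u 2 * s 2 ^ 3 + u 3 * s 3 ^ 3 + u 4 * s 4 ^ 3 = 0"
    using M[of 3] by (simp add: five add_ac)
  define E0 where "E0 = u 1 * (u 0 * s 1 ^ 3 - 3 * (u 0 * s 0) * s 1 ^ 2)
    + u 2 * ((u 0 + u 1) * s 2 ^ 3 - 3 * (u 0 * s 0 + u 1 * s 1) * s 2 ^ 2)
    + u 3 * ((u 0 + u 1 + u 2) * s 3 ^ 3 - 3 * (u 0 * s 0 + u 1 * s 1 + u 2 * s 2) * s 3 ^ 2)
    + u 4 * ((u 0 + u 1 + u 2 + u 3) * s 4 ^ 3 - 3 * (u 0 * s 0 + u 1 * s 1 + u 2 * s 2 + u 3 * s 3) * s 4 ^ 2)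
    - (u 0 ^ 2 * s 0 ^ 3 + u 1 ^ 2 * s 1 ^ 3 + u 2 ^ 2 * s 2 ^ 3 + u 3 ^ 2 * s 3 ^ 3 + u 4 ^ 2 * s 4 ^ 3)"
  have "0 = E0 + a * (u 0 * s 0 ^ 3 + u 1 * s 1 ^ 3 + u 2 * s 2 ^ 3 + u 3 * s 3 ^ 3 + u 4 * s 4 ^ 3)
     - 3 * b * (u 0 * s 0 ^ 2 + u 1 * s 1 ^ 2 + u 2 * s 2 ^ 2 + u 3 * s 3 ^ 2 + u 4 * s 4 ^ 2)"
    unfolding E0_def E[symmetric] by (simp add: five algebra_simps)
  then have "E0 = 0" unfolding M2 M3 by simp
  then show ?thesis
    using pentagon_identity[of "s 2" "s 4" "u 1" "u 0" "s 1" "s 0" "u 2" "u 3" "s 3" "u 4"]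
    unfolding E0_def[symmetric] unfolding M0 M1 M2 M3 by simp
qed

text \<open>A point \<open>g\<close> and a line \<open>f\<close>, both vectors over the field, are adjacent if
\<open>g j - f j + girth_poly j (g 0) f\<close> vanishes for \<open>1 \<le> j < m\<close>. When a line through \<open>g\<close> varies, the first four
coordinates of \<open>f\<close> move along the vector \<open>(1, s, s^2, s^3)\<close> with \<open>s = g 0\<close>. The last coordinate, for
\<open>m = 5\<close>, then changes by \<open>u * (f 0 * s^3 - 3 * f 1 * s^2) - u^2 * s^3\<close>, where \<open>u\<close> is the change of \<open>f 0\<close>.
Antisymmetrising the bilinear part gives the symplectic form that takes the value \<open>(t - s)^3\<close> on the
vectors of \<open>s\<close> and \<open>t\<close>.\<close>

definition girth_poly :: "nat \<Rightarrow> 'a :: comm_ring_1 \<Rightarrow> (nat \<Rightarrow> 'a) \<Rightarrow> 'a" where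
  "girth_poly j s f = (if j = 4 then 2 * f 0 ^ 2 * s ^ 3 - 3 * f 0 * f 1 * s ^ 2 else s ^ j * f 0)"

text \<open>Let the \<open>i\<close>-th point of a closed walk have first coordinate \<open>s i\<close>, and let \<open>u i\<close> be the change of the first
coordinate between the lines before and after it. Never turning back means that all \<open>u i\<close> are nonzero
and neighbouring \<open>s i\<close> differ. Summing the changes of the other coordinates around the walk shows
that the first \<open>min m 4\<close> moments of \<open>u\<close> vanish. For \<open>m = 2\<close> and \<open>m = 3\<close> these Vandermonde equations already
force \<open>u 0 = 0\<close>. For \<open>m = 5\<close> they have nonzero solutions, which the quadratic condition from the last
coordinate excludes.\<close>

lemma large_girth_graph:
  fixes \<gamma> :: "nat \<Rightarrow> 'a :: idom"
  assumes m: "m \<in> {2, 3, 5}"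
  shows "no_short_closed_walk m {(g, f). g \<in> {..<m} \<rightarrow>\<^sub>E F \<and> f \<in> {..<m} \<rightarrow>\<^sub>E F \<and>
     (\<forall>j \<in> {1..<m}. g j - f j + girth_poly j (g 0) f = \<gamma> j)}" (is "no_short_closed_walk m ?G")
  unfolding no_short_closed_walk_def
proof (intro allI impI notI)
  fix n and p l :: "nat \<Rightarrow> nat \<Rightarrow> 'a"
  assume n: "2 \<le> n" "n \<le> m" and cl: "p n = p 0" "l n = l 0"
    and w: "\<forall>i<n. (p i, l i) \<in> ?G \<and> (p i, l (Suc i)) \<in> ?G \<and> p i \<noteq> p (Suc i) \<and> l i \<noteq> l (Suc i)"
  have m2: "m \<ge> 2" using m by auto
  have adj: "p i j - l i j + girth_poly j (p i 0) (l i) = \<gamma> j"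
     "p i j - l (Suc i) j + girth_poly j (p i 0) (l (Suc i)) = \<gamma> j" if "i < n" "1 \<le> j" "j < m" for i j
    using w that by auto
  have mem: "p i \<in> {..<m} \<rightarrow>\<^sub>E F" "l i \<in> {..<m} \<rightarrow>\<^sub>E F" "l (Suc i) \<in> {..<m} \<rightarrow>\<^sub>E F" if "i < n" for i
    using w that by auto
  have step: "l (Suc i) j - l i j = girth_poly j (p i 0) (l (Suc i)) - girth_poly j (p i 0) (l i)"
    if "i < n" "1 \<le> j" "j < m" for i j using adj[OF that]
  proof -
    have "p i j - l i j + girth_poly j (p i 0) (l i) = p i j - l (Suc i) j + girth_poly j (p i 0) (l (Suc i))"
      using adj[OF that] by simp
    then show ?thesis by (simp add: algebra_simps)
  qed
  define u where "u i = l (Suc i) 0 - l i 0" for i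
  define s where "s i = p i 0" for i
  have u0: "u i \<noteq> 0" if i: "i < n" for i
  proof
    assume "u i = 0"
    then have 0: "l (Suc i) 0 = l i 0" unfolding u_def by simp
    have 1: "l (Suc i) 1 = l i 1" using step[OF i, of 1] m2 0 unfolding girth_poly_def by simp
    have "girth_poly j x (l (Suc i)) = girth_poly j x (l i)" for j x
      unfolding girth_poly_def 0 1 ..
    then have "l (Suc i) j = l i j" if "j < m" for j using step[OF i, of j] 0 that by (cases "j = 0") auto
    then have "l (Suc i) = l i" using mem[OF i] by (intro PiE_ext) auto
    then show False using w i by auto
  qed
  have s0: "s i \<noteq> s (Suc i)" if i: "i < n" for i
  proof
    assume eq: "s i = s (Suc i)"
    have a: "(p (Suc i), l (Suc i)) \<in> ?G"
    proof (cases "Suc i = n")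
      case True
      then have "p (Suc i) = p 0" "l (Suc i) = l 0" using cl by auto
      moreover have "(p 0, l 0) \<in> ?G" using w n by auto
      ultimately show ?thesis by simp
    next
      case False
      then show ?thesis using w i by auto
    qed
    have "p (Suc i) j = p i j" if "j < m" for j
    proof (cases "j = 0")
      case True
      then show ?thesis using eq unfolding s_def by simp
    next
      case False
      then have "p (Suc i) j - l (Suc i) j + girth_poly j (p (Suc i) 0) (l (Suc i)) = \<gamma> j"
        using a that by auto
      then have "p (Suc i) j - l (Suc i) j + girth_poly j (p i 0) (l (Suc i)) = \<gamma> j"
        using eq unfolding s_def by simp
      then have "p (Suc i) j - l (Suc i) j + girth_poly j (p i 0) (l (Suc i)) =
          p i j - l (Suc i) j + girth_poly j (p i 0) (l (Suc i))"
        using adj(2)[OF i, of j] False that by simp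
      then show ?thesis by simp
    qed
    then have "p (Suc i) = p i" using mem[OF i] a by (intro PiE_ext) auto
    then show False using w i by auto
  qed
  have mom: "(\<Sum>i<n. u i * s i ^ k) = 0" if k: "k < 4" "k < m" for k
  proof -
    have "u i * s i ^ k = l (Suc i) k - l i k" if i: "i < n" for i
    proof (cases "k = 0")
      case True
      then show ?thesis unfolding u_def by simp
    next
      case False
      then show ?thesis using step[OF i, of k] k unfolding girth_poly_def u_def s_def by (simp add: algebra_simps)
    qed
    then have "(\<Sum>i<n. u i * s i ^ k) = (\<Sum>i<n. l (Suc i) k - l i k)" by simp
    also have "\<dots> = l n k - l 0 k" by (rule sum_lessThan_telescope)
    finally show ?thesis using cl by simp
  qed
  have s_last: "s n = s 0" unfolding s_def using cl by simp
  have s12: "s 0 \<noteq> s 1" "s 1 \<noteq> s 2" "s (n - 1) \<noteq> s 0"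
    using s0[of 0] s0[of 1] s0[of "n - 1"] n s_last by (auto simp: numeral_2_eq_2)
  \<comment> \<open>Shorter walks are treated together with the walks of length \<open>m\<close> by adding zero weights \<open>u' i\<close>. The
      values \<open>s' i\<close> added must keep \<open>s' 1 \<noteq> s' 2\<close> and \<open>s' (m - 1) \<noteq> s' 0\<close>; for two points on the walk and
      \<open>m = 5\<close> this is why \<open>s' 2 = s 0\<close>.\<close>
  define u' where "u' i = (if i < n then u i else 0)" for i
  define s' where "s' i = (if i < n then s i else if n = 2 \<and> i = 2 \<and> m = 5 then s 0 else s (n - 1))" for i
  have pad: "(\<Sum>i<m. u' i * Z i) = (\<Sum>i<n. u i * Z' i)" if "\<And>i. i < n \<Longrightarrow> Z i = Z' i" for Z Z'
  proof -
    have "(\<Sum>i<m. u' i * Z i) = (\<Sum>i<n. u' i * Z i)"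
      using n unfolding u'_def by (intro sum.mono_neutral_right) auto
    also have "\<dots> = (\<Sum>i<n. u i * Z' i)" using that unfolding u'_def by (intro sum.cong) auto
    finally show ?thesis .
  qed
  have mom': "(\<Sum>i<m. u' i * s' i ^ k) = 0" if "k < 4" "k < m" for k
    using pad[of "\<lambda>i. s' i ^ k" "\<lambda>i. s i ^ k"] mom[OF that] unfolding s'_def by simp
  have u'0: "u' 0 \<noteq> 0" "u' 1 \<noteq> 0" using u0[of 0] u0[of 1] n unfolding u'_def by auto
  have s'01: "s' 0 \<noteq> s' 1" using s12 n unfolding s'_def by auto
  consider "m = 2" | "m = 3" | "m = 5" using m by blast
  then show False
  proof cases
    case 1
    have "u' 0 + u' 1 = 0" "u' 0 * s' 0 + u' 1 * s' 1 = 0"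
      using mom'[of 0] mom'[of 1] 1 by (simp_all add: eval_nat_numeral lessThan_Suc add_ac)
    moreover have "u' 0 * (s' 0 - s' 1) = (u' 0 * s' 0 + u' 1 * s' 1) - s' 1 * (u' 0 + u' 1)"
      by (simp add: algebra_simps)
    ultimately have "u' 0 * (s' 0 - s' 1) = 0" by simp
    then show False using u'0 s'01 by simp
  next
    case 2
    have "n = 2 \<or> n = 3" using n 2 by linarith
    then have "s' 0 \<noteq> s' 2" using s12 2 unfolding s'_def by (elim disjE) auto
    moreover have "u' 0 * ((s' 0 - s' 1) * (s' 0 - s' 2)) = 0"
      using triangle_moments[of u' s'] mom' 2 by simp
    ultimately show False using u'0 s'01 by simp
  next
    case 3
    have A: "l i 0 = l 0 0 + (\<Sum>k<i. u k)" for i unfolding u_def using sum_lessThan_telescope[of "\<lambda>k. l k 0" i] by simp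
    have B: "l i 1 = l 0 1 + (\<Sum>k<i. u k * s k)" if "i \<le> n" for i
    proof -
      have "u k * s k = l (Suc k) 1 - l k 1" if "k < i" for k
        using step[of k 1] that \<open>i \<le> n\<close> m2 unfolding girth_poly_def u_def s_def by (simp add: algebra_simps)
      then have "(\<Sum>k<i. u k * s k) = (\<Sum>k<i. l (Suc k) 1 - l k 1)" by simp
      then show ?thesis using sum_lessThan_telescope[of "\<lambda>k. l k 1" i] by simp
    qed
    define a where "a = l 0 0"
    define b where "b = l 0 1"
    define Z where "Z i = (a + (\<Sum>k<i. u k)) * s i ^ 3 - 3 * (b + (\<Sum>k<i. u k * s k)) * s i ^ 2 - u i * s i ^ 3" for i
    define Z' where "Z' i = (a + (\<Sum>k<i. u' k)) * s' i ^ 3 - 3 * (b + (\<Sum>k<i. u' k * s' k)) * s' i ^ 2 - u' i * s' i ^ 3" for i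
    have st4: "u i * Z i = l (Suc i) 4 - l i 4" if i: "i < n" for i
    proof -
      have l0: "l (Suc i) 0 = l i 0 + u i" unfolding u_def by simp
      have l1: "l (Suc i) 1 = l i 1 + u i * s i"
        using step[OF i, of 1] m2 unfolding girth_poly_def u_def s_def by (simp add: algebra_simps)
      have "l (Suc i) 4 - l i 4 = girth_poly 4 (s i) (l (Suc i)) - girth_poly 4 (s i) (l i)"
        using step[OF i, of 4] 3 unfolding s_def by simp
      also have "\<dots> = u i * (l i 0 * s i ^ 3 - 3 * l i 1 * s i ^ 2 - u i * s i ^ 3)"
        unfolding girth_poly_def l0 l1 by (simp add: algebra_simps power2_eq_square power3_eq_cube)
      finally show ?thesis unfolding Z_def a_def b_def A[of i, symmetric] using B[of i] i by simp
    qed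
    have "(\<Sum>i<n. u i * Z i) = (\<Sum>i<n. l (Suc i) 4 - l i 4)" using st4 by simp
    also have "\<dots> = 0" using cl sum_lessThan_telescope[of "\<lambda>k. l k 4" n] by simp
    finally have "(\<Sum>i<n. u i * Z i) = 0" .
    moreover have "Z' i = Z i" if i: "i < n" for i
    proof -
      have "(\<Sum>k<i. u' k) = (\<Sum>k<i. u k)" "(\<Sum>k<i. u' k * s' k) = (\<Sum>k<i. u k * s k)"
        using i unfolding u'_def s'_def by (auto intro!: sum.cong)
      then show ?thesis unfolding Z_def Z'_def using i by (simp add: u'_def s'_def)
    qed
    ultimately have "(\<Sum>i<5. u' i * Z' i) = 0" using pad[of Z' Z] 3 by simp
    then have "(\<Sum>i<5. u' i * ((a + (\<Sum>k<i. u' k)) * s' i ^ 3 - 3 * (b + (\<Sum>k<i. u' k * s' k)) * s' i ^ 2) - u' i ^ 2 * s' i ^ 3) = 0"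
      unfolding Z'_def by (simp add: algebra_simps power2_eq_square)
    then have "u' 0 * u' 1 * (s' 0 - s' 1) ^ 2 * (s' 1 - s' 2) * (s' 4 - s' 0) = 0"
      using pentagon_moments[of u' s' a b] mom' 3 by simp
    moreover have n': "n = 2 \<or> n = 3 \<or> n = 4 \<or> n = 5" using n 3 by linarith
    then have "s' 1 \<noteq> s' 2" using s12 3 unfolding s'_def by (elim disjE) auto
    moreover have "s' 4 \<noteq> s' 0" using n' s12 3 unfolding s'_def by (elim disjE) auto
    ultimately show False using u'0 s'01 by simp
  qed
qed

text \<open>The colour of a pair \<open>x\<close>, \<open>y\<close> is the right-hand side of the \<open>m - 1\<close> equations for the point \<open>\<iota> x\<close> and the
line \<open>\<iota> y\<close>, so each colour class is a graph as in \<open>large_girth_graph\<close>. The field has \<open>2 ^ (h div m + 1)\<close>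
elements, the least power of two whose \<open>m\<close>-th power exceeds \<open>2 ^ h\<close>.\<close>

lemma pair_colouring:
  assumes m: "m \<in> {2, 3, 5}"
  obtains c :: "nat \<Rightarrow> nat \<Rightarrow> nat" where
    "\<And>x y. x < 2 ^ h \<Longrightarrow> y < 2 ^ h \<Longrightarrow> c x y < 2 ^ ((m - 1) * (h div m + 1))"
    "\<And>col. no_short_closed_walk m {(x, y). x < 2 ^ h \<and> y < 2 ^ h \<and> c x y = col}"
proof -
  define \<sigma> where "\<sigma> = h div m + 1"
  have m0: "m > 0" using m by auto
  obtain F :: "bit alg_closure set" where F: "finite F" "card F = 2 ^ \<sigma>" "0 \<in> F" "1 \<in> F"
    "\<And>x y. x \<in> F \<Longrightarrow> y \<in> F \<Longrightarrow> x + y \<in> F" "\<And>x y. x \<in> F \<Longrightarrow> y \<in> F \<Longrightarrow> x - y \<in> F"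
    "\<And>x y. x \<in> F \<Longrightarrow> y \<in> F \<Longrightarrow> x * y \<in> F"
    using finite_subfield_exists[of \<sigma>] unfolding \<sigma>_def by auto
  have Fpow: "x ^ k \<in> F" if "x \<in> F" for x k using that F by (induction k) auto
  have F2: "2 \<in> F" "3 \<in> F" using F(5)[OF F(4) F(4)] F(5)[OF F(5)[OF F(4) F(4)] F(4)] by simp_all
  define P where "P = {..<m} \<rightarrow>\<^sub>E F"
  have fP: "finite P" "card P = (2 ^ \<sigma>) ^ m" unfolding P_def using F(1,2) by (simp_all add: finite_PiE card_PiE)
  define C where "C = {1..<m} \<rightarrow>\<^sub>E F"
  have fC: "finite C" "card C = (2 ^ \<sigma>) ^ (m - 1)" unfolding C_def using F(1,2) by (simp_all add: finite_PiE card_PiE)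
  have "h < m * \<sigma>" unfolding \<sigma>_def using m0 by (metis Suc_eq_plus1 dividend_less_times_div mult_Suc_right)
  then have "(2 :: nat) ^ h \<le> 2 ^ (\<sigma> * m)" by (intro power_increasing) (auto simp: mult.commute)
  then have "card {..<(2::nat) ^ h} \<le> card P" unfolding fP by (simp add: power_mult)
  then obtain \<iota> where \<iota>: "inj_on \<iota> {..<(2::nat) ^ h}" "\<iota> ` {..<2 ^ h} \<subseteq> P"
    using card_le_inj[of "{..<(2::nat) ^ h}" P] fP by auto
  obtain enc :: "(nat \<Rightarrow> bit alg_closure) \<Rightarrow> nat" where enc: "bij_betw enc C {0..<card C}"
    using ex_bij_betw_finite_nat[OF fC(1)] by blast
  define v where "v g f = (\<lambda>j\<in>{1..<m}. g j - f j + girth_poly j (g 0) f)" for g f :: "nat \<Rightarrow> bit alg_closure"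
  have vC: "v g f \<in> C" if "g \<in> P" "f \<in> P" for g f
  proof -
    have gf: "g j \<in> F" "f j \<in> F" if "j < m" for j using \<open>g \<in> P\<close> \<open>f \<in> P\<close> that unfolding P_def by (auto simp: PiE_iff)
    have "f 0 \<in> F" "f 1 \<in> F" "g 0 \<in> F" using gf m by auto
    then have "girth_poly j (g 0) f \<in> F" for j unfolding girth_poly_def using F F2 Fpow by simp
    then show ?thesis unfolding v_def C_def using gf F by auto
  qed
  define c where "c x y = enc (v (\<iota> x) (\<iota> y))" for x y
  show thesis
  proof (rule that[of c])
    fix x y :: nat assume xy: "x < 2 ^ h" "y < 2 ^ h"
    then have "v (\<iota> x) (\<iota> y) \<in> C" using \<iota> by (intro vC) auto
    then have "c x y < card C" using bij_betw_apply[OF enc] unfolding c_def by auto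
    moreover have "card C = 2 ^ ((m - 1) * \<sigma>)" unfolding fC by (metis power_mult mult.commute)
    ultimately show "c x y < 2 ^ ((m - 1) * (h div m + 1))" unfolding \<sigma>_def by metis
  next
    fix col
    show "no_short_closed_walk m {(x, y). x < 2 ^ h \<and> y < 2 ^ h \<and> c x y = col}" (is "no_short_closed_walk m ?G")
    proof (cases "\<exists>x y. (x, y) \<in> ?G")
      case False
      then have empty: "?G = {}" by auto
      show ?thesis unfolding empty no_short_closed_walk_def by (auto intro!: exI[of _ "0 :: nat"])
    next
      case True
      then obtain x0 y0 where xy0: "(x0, y0) \<in> ?G" by blast
      define \<gamma> where "\<gamma> = v (\<iota> x0) (\<iota> y0)"
      have \<gamma>: "v (\<iota> x) (\<iota> y) = \<gamma>" if "(x, y) \<in> ?G" for x y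
      proof -
        have "v (\<iota> x) (\<iota> y) \<in> C" "\<gamma> \<in> C" unfolding \<gamma>_def using that xy0 \<iota> by (auto intro!: vC)
        moreover have "enc (v (\<iota> x) (\<iota> y)) = enc \<gamma>" unfolding \<gamma>_def using that xy0 unfolding c_def by auto
        ultimately show ?thesis using enc unfolding bij_betw_def by (auto dest: inj_onD)
      qed
      show ?thesis
      proof (rule no_short_closed_walk_map[OF large_girth_graph[OF m, of F \<gamma>], of _ \<iota> \<iota>])
        fix x y assume xy: "(x, y) \<in> ?G"
        have "\<iota> x \<in> P" "\<iota> y \<in> P" using xy \<iota> by auto
        moreover have "\<iota> x j - \<iota> y j + girth_poly j (\<iota> x 0) (\<iota> y) = \<gamma> j" if "j \<in> {1..<m}" for j
          using fun_cong[OF \<gamma>[OF xy], of j] that unfolding v_def by simp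
        ultimately show "(\<iota> x, \<iota> y) \<in>
          {(g, f). g \<in> {..<m} \<rightarrow>\<^sub>E F \<and> f \<in> {..<m} \<rightarrow>\<^sub>E F \<and> (\<forall>j\<in>{1..<m}. g j - f j + girth_poly j (g 0) f = \<gamma> j)}"
          unfolding P_def by auto
      qed (use \<iota>(1) in \<open>auto dest: inj_onD\<close>)
    qed
  qed
qed

section \<open>Berge cycles over graphs of large girth\<close>

lemma relpow_shortcut:
  assumes "\<And>i. i < n \<Longrightarrow> (f i, f (Suc i)) \<in> R" "i + 2 \<le> n" "f i = f (i + 2)"
  shows "(f 0, f n) \<in> R ^^ (n - 2)"
proof -
  have "(f 0, f i) \<in> R ^^ i"
    unfolding relpow_fun_conv using assms by (intro exI[of _ f]) auto
  moreover have "(f (i + 2), f n) \<in> R ^^ (n - 2 - i)"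
  proof -
    have "Suc (Suc (n - 2)) = n" using assms(2) by simp
    then show ?thesis unfolding relpow_fun_conv using assms by (intro exI[of _ "\<lambda>k. f (i + 2 + k)"]) auto
  qed
  ultimately have "(f 0, f n) \<in> R ^^ (i + (n - 2 - i))"
    using assms(3) by (auto simp: relpow_add)
  then show ?thesis using assms(2) by simp
qed

lemma relpow_sym: "sym R \<Longrightarrow> (x, y) \<in> R ^^ n \<Longrightarrow> (y, x) \<in> R ^^ n"
proof (induction n arbitrary: y)
  case (Suc n)
  then obtain z where "(x, z) \<in> R ^^ n" "(z, y) \<in> R" by auto
  then show ?case using Suc by (meson relpow_Suc_I2 symD)
qed auto

text \<open>\<open>C\<close> is a blow-up of the graph with the edges \<open>(P h, L h)\<close>: every vertex of \<open>h\<close> lies over one of the two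
ends of its edge. As the fibres are smaller than the cycle, two neighbours on the cycle lie over
different ends of some edge \<open>h0\<close>. The rest of the cycle connects these ends without using \<open>h0\<close> again, and a
shortest such connection together with \<open>h0\<close> is a closed walk that never turns back. The
connection has odd length at most \<open>2 m\<close>, so the walk has at most \<open>m\<close> points.\<close>

lemma no_berge_cycle_over_large_girth:
  fixes P :: "'a set \<Rightarrow> 'p" and L :: "'a set \<Rightarrow> 'l" and \<pi> :: "'a \<Rightarrow> 'p + 'l"
  assumes node: "\<And>h v. h \<in> C \<Longrightarrow> v \<in> h \<Longrightarrow> \<pi> v = Inl (P h) \<or> \<pi> v = Inr (L h)"
    and inj: "\<And>h h'. h \<in> C \<Longrightarrow> h' \<in> C \<Longrightarrow> P h = P h' \<Longrightarrow> L h = L h' \<Longrightarrow> h = h'"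
    and girth: "no_short_closed_walk m ((\<lambda>h. (P h, L h)) ` C)"
    and fibre: "\<And>x. finite {v \<in> \<Union>C. \<pi> v = x} \<and> card {v \<in> \<Union>C. \<pi> v = x} < 2 * m"
    and len: "len = 2 * m \<or> len = 2 * m + 1" and m: "m \<ge> 1"
  shows "\<not> bcycle C len"
proof
  assume "bcycle C len"
  moreover have len2: "len \<ge> 2" using len m by auto
  ultimately obtain w g where wg: "inj_on w {..<len}" "inj_on g {..<len}"
    "\<And>i. i < len \<Longrightarrow> g i \<in> C \<and> w i \<in> g i \<and> w ((i + 1) mod len) \<in> g i"
    unfolding bcycle_iff[OF len2] by blast
  have "\<exists>j<len. \<pi> (w j) \<noteq> \<pi> (w ((j + 1) mod len))"
  proof (rule ccontr)
    assume "\<not> ?thesis"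
    then have eq: "\<pi> (w j) = \<pi> (w ((j + 1) mod len))" if "j < len" for j using that by blast
    have "j < len \<Longrightarrow> \<pi> (w j) = \<pi> (w 0)" for j
    proof (induction j)
      case (Suc j)
      then show ?case using eq[of j] by simp
    qed simp
    then have "w ` {..<len} \<subseteq> {v \<in> \<Union>C. \<pi> v = \<pi> (w 0)}" using wg(3) by blast
    then have "card (w ` {..<len}) \<le> card {v \<in> \<Union>C. \<pi> v = \<pi> (w 0)}"
      using fibre by (intro card_mono) auto
    also have "\<dots> < 2 * m" using fibre by blast
    finally show False using card_image[OF wg(1)] len by auto
  qed
  then obtain j where j: "j < len" "\<pi> (w j) \<noteq> \<pi> (w ((j + 1) mod len))" by blast
  define h0 where "h0 = g j"
  have h0: "h0 \<in> C" unfolding h0_def using wg(3) j by blast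
  \<comment> \<open>The cycle is rotated so that \<open>h0\<close> becomes its last hyperedge.\<close>
  define v where "v k = w ((j + 1 + k) mod len)" for k
  define e where "e k = g ((j + 1 + k) mod len)" for k
  have ve: "e k \<in> C" "v k \<in> e k" "v (Suc k) \<in> e k" for k
  proof -
    have "(j + 1 + k) mod len < len" using len2 by simp
    from wg(3)[OF this] show "e k \<in> C" "v k \<in> e k" "v (Suc k) \<in> e k"
      unfolding v_def e_def by (simp_all add: mod_Suc_eq)
  qed
  have last: "(j + 1 + (len - 1)) mod len = j" using j by simp
  have e_ne: "e k \<noteq> h0" if k: "k < len - 1" for k
  proof
    assume "e k = h0"
    then have eq: "(j + 1 + k) mod len = j" unfolding e_def h0_def
      using inj_onD[OF wg(2), of "(j + 1 + k) mod len" j] j len2 by simp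
    show False
    proof (cases "j + 1 + k < len")
      case True
      then show False using eq by simp
    next
      case False
      then have "(j + 1 + k) mod len = j + 1 + k - len" using j k by (simp add: le_mod_geq)
      then show False using eq False k by linarith
    qed
  qed
  define R where "R = {(x, y). \<exists>h \<in> C - {h0}. (x = Inl (P h) \<and> y = Inr (L h)) \<or> (x = Inr (L h) \<and> y = Inl (P h))}"
  have symR: "sym R" unfolding R_def sym_def by blast
  have walk: "k \<le> len - 1 \<Longrightarrow> \<exists>n\<le>k. (\<pi> (v 0), \<pi> (v k)) \<in> R ^^ n" for k
  proof (induction k)
    case (Suc k)
    then obtain n where n: "n \<le> k" "(\<pi> (v 0), \<pi> (v k)) \<in> R ^^ n" by auto
    have "e k \<in> C - {h0}" using ve e_ne Suc.prems by auto
    moreover have "\<pi> (v k) \<in> {Inl (P (e k)), Inr (L (e k))}" "\<pi> (v (Suc k)) \<in> {Inl (P (e k)), Inr (L (e k))}"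
      using node ve by auto
    ultimately have "\<pi> (v k) = \<pi> (v (Suc k)) \<or> (\<pi> (v k), \<pi> (v (Suc k))) \<in> R" unfolding R_def by auto
    then show ?case
    proof
      assume "\<pi> (v k) = \<pi> (v (Suc k))"
      then show ?thesis using n by (intro exI[of _ n]) auto
    next
      assume "(\<pi> (v k), \<pi> (v (Suc k))) \<in> R"
      then have "(\<pi> (v 0), \<pi> (v (Suc k))) \<in> R ^^ Suc n" using n by auto
      then show ?thesis using n by (intro exI[of _ "Suc n"]) auto
    qed
  qed (auto intro!: exI[of _ 0])
  define a where "a = (Inr (L h0) :: 'p + 'l)"
  define b where "b = (Inl (P h0) :: 'p + 'l)"
  have "\<exists>n\<le>len - 1. (a, b) \<in> R ^^ n"
  proof -
    obtain n where n: "n \<le> len - 1" "(\<pi> (v 0), \<pi> (v (len - 1))) \<in> R ^^ n" using walk[of "len - 1"] by auto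
    have v0: "v 0 = w ((j + 1) mod len)" "v (len - 1) = w j" unfolding v_def using last by simp_all
    have "\<pi> (w j) = b \<or> \<pi> (w j) = a" "\<pi> (w ((j + 1) mod len)) = b \<or> \<pi> (w ((j + 1) mod len)) = a"
      using node[OF h0] wg(3)[OF j(1)] unfolding a_def b_def h0_def by auto
    then have "(\<pi> (v 0) = a \<and> \<pi> (v (len - 1)) = b) \<or> (\<pi> (v 0) = b \<and> \<pi> (v (len - 1)) = a)"
      using j(2) v0 by auto
    then show ?thesis using n relpow_sym[OF symR] by metis
  qed
  define n where "n = (LEAST n. (a, b) \<in> R ^^ n)"
  have n: "(a, b) \<in> R ^^ n" "n \<le> len - 1"
  proof -
    obtain k where k: "k \<le> len - 1" "(a, b) \<in> R ^^ k" using \<open>\<exists>n\<le>len - 1. (a, b) \<in> R ^^ n\<close> by blast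
    show "(a, b) \<in> R ^^ n" unfolding n_def using k(2) by (rule LeastI)
    have "n \<le> k" unfolding n_def using k(2) by (rule Least_le)
    then show "n \<le> len - 1" using k by simp
  qed
  have least: "n \<le> k" if "(a, b) \<in> R ^^ k" for k unfolding n_def using that by (rule Least_le)
  obtain f where f: "f 0 = a" "f n = b" "\<And>i. i < n \<Longrightarrow> (f i, f (Suc i)) \<in> R"
    using n(1) unfolding relpow_fun_conv by blast
  have alt: "i \<le> n \<Longrightarrow> isl (f i) \<longleftrightarrow> odd i" for i
  proof (induction i)
    case 0
    then show ?case unfolding f(1) a_def by simp
  next
    case (Suc i)
    have "(f i, f (Suc i)) \<in> R" using f(3) Suc.prems by simp
    then have "isl (f (Suc i)) \<longleftrightarrow> \<not> isl (f i)" unfolding R_def by auto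
    then show ?case using Suc by simp
  qed
  have oddn: "odd n" using alt[of n] f(2) unfolding b_def by simp
  have n1: "n \<noteq> 1"
  proof
    assume "n = 1"
    then have "(a, b) \<in> R" using n(1) by simp
    then have "\<exists>h. h \<in> C \<and> h \<noteq> h0 \<and> L h = L h0 \<and> P h = P h0" unfolding R_def a_def b_def by force
    then show False using inj[OF _ h0] by blast
  qed
  obtain s0 where s0: "n = 2 * s0 + 1" using oddn by (elim oddE)
  define s where "s = Suc s0"
  have sn: "n = 2 * s - 1" "n = 2 * s0 + 1" unfolding s_def using s0 by simp_all
  have s2: "2 \<le> s" using n1 s0 unfolding s_def by auto
  have sm: "s \<le> m" using n(2) len s0 unfolding s_def by auto
  have nb: "f i \<noteq> f (i + 2)" if "i + 2 \<le> n" for i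
  proof
    assume "f i = f (i + 2)"
    then have "(a, b) \<in> R ^^ (n - 2)" using relpow_shortcut[of n f R i] f that by simp
    then show False using least[of "n - 2"] that by auto
  qed
  have notR: "(a, b) \<notin> R"
  proof
    assume "(a, b) \<in> R"
    then have "n \<le> 1" using least[of 1] by simp
    then show False using n1 oddn by (cases n) auto
  qed
  define l where "l i = (if i = s then L h0 else projr (f (2 * i)))" for i
  define p where "p i = (if i = s then projl (f 1) else projl (f (2 * i + 1)))" for i
  have fl: "f (2 * i) = Inr (l i)" if "i < s" for i
  proof -
    have "2 * i \<le> n" using that sn s_def by auto
    then have "\<not> isl (f (2 * i))" using alt[of "2 * i"] by simp
    then show ?thesis unfolding l_def using that by (cases "f (2 * i)") auto
  qed
  have fp: "f (2 * i + 1) = Inl (p i)" if "i < s" for i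
  proof -
    have "2 * i + 1 \<le> n" using that sn s_def by auto
    then have "isl (f (2 * i + 1))" using alt[of "2 * i + 1"] by simp
    then show ?thesis unfolding p_def using that by (cases "f (2 * i + 1)") auto
  qed
  define G where "G = (\<lambda>h. (P h, L h)) ` C"
  have RG: "(y, x) \<in> G" if "(Inr x, Inl y) \<in> R \<or> (Inl y, Inr x) \<in> R" for x y
    using that unfolding R_def G_def by auto
  have l0: "l 0 = L h0" using fl[of 0] f(1) s2 unfolding a_def by simp
  have p_last: "p s0 = P h0" using fp[of s0] f(2) sn unfolding b_def s_def by simp
  have "(p i, l i) \<in> G \<and> (p i, l (Suc i)) \<in> G \<and> p i \<noteq> p (Suc i) \<and> l i \<noteq> l (Suc i)" if i: "i < s" for i
  proof -
    have in1: "2 * i < n" using i sn s_def by auto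
    have "(f (2 * i), f (2 * i + 1)) \<in> R" using f(3)[OF in1] by simp
    then have A: "(p i, l i) \<in> G" using fl[OF i] fp[OF i] RG by metis
    show ?thesis
    proof (cases "Suc i = s")
      case True
      then have i_eq: "i = s0" unfolding s_def by simp
      have l1: "l (Suc i) = L h0" unfolding l_def using True by simp
      have "(P h0, L h0) \<in> G" unfolding G_def using h0 by (rule image_eqI[rotated]) simp
      then have "(p i, l (Suc i)) \<in> G" using l1 i_eq p_last by metis
      moreover have "l i \<noteq> l (Suc i)"
      proof
        assume "l i = l (Suc i)"
        then have "f (2 * i) = a" using fl[OF i] l1 unfolding a_def by simp
        moreover have "f (2 * i + 1) = b" using f(2) sn i_eq by simp
        ultimately show False using \<open>(f (2 * i), f (2 * i + 1)) \<in> R\<close> notR by simp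
      qed
      moreover have "p i \<noteq> p (Suc i)"
      proof
        assume "p i = p (Suc i)"
        moreover have "p (Suc i) = p 0" unfolding p_def using True s2 by simp
        ultimately have "f 1 = b" using fp[of 0] s2 p_last i_eq unfolding b_def by simp
        moreover have "(f 0, f 1) \<in> R" using f(3)[of 0] sn by simp
        ultimately show False using f(1) notR by simp
      qed
      ultimately show ?thesis using A by blast
    next
      case False
      then have i': "Suc i < s" using i by simp
      then have in2: "2 * i + 1 < n" "2 * i + 2 \<le> n" "2 * i + 1 + 2 \<le> n" using sn s_def by auto
      have "(f (2 * i + 1), f (2 * Suc i)) \<in> R" using f(3)[OF in2(1)] by simp
      then have "(p i, l (Suc i)) \<in> G" using fp[OF i] fl[OF i'] RG by metis
      moreover have "l i \<noteq> l (Suc i)" using nb[OF in2(2)] fl[OF i] fl[OF i'] by auto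
      moreover have "p i \<noteq> p (Suc i)" using nb[OF in2(3)] fp[OF i] fp[OF i'] by auto
      ultimately show ?thesis using A by blast
    qed
  qed
  moreover have "p s = p 0" "l s = l 0" using l0 s2 unfolding p_def l_def by auto
  ultimately show False using girth[folded G_def, unfolded no_short_closed_walk_def, rule_format, of s p l] s2 sm by blast
qed

text \<open>The position of the highest binary digit in which \<open>x\<close> and \<open>y\<close> differ, for \<open>x \<noteq> y\<close>.\<close>

definition lev :: "nat \<Rightarrow> nat \<Rightarrow> nat" where
  "lev x y = (LEAST h. x div 2 ^ Suc h = y div 2 ^ Suc h)"

section \<open>Colour classes of sets of numbers\<close>

lemma half_div: "(x :: nat) div 2 ^ h div 2 = x div 2 ^ Suc h"
  by (simp add: div_mult2_eq[symmetric] mult.commute)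

lemma lev_exists: "\<exists>h. (x :: nat) div 2 ^ Suc h = y div 2 ^ Suc h"
proof -
  have "x + y < 2 ^ (x + y)" by (rule less_exp)
  then have "x < 2 ^ Suc (x + y)" "y < 2 ^ Suc (x + y)" unfolding power_Suc by linarith+
  then show ?thesis by (intro exI[of _ "x + y"]) simp
qed

lemma div_eq_mono: "(x :: nat) div 2 ^ h = y div 2 ^ h \<Longrightarrow> h \<le> h' \<Longrightarrow> x div 2 ^ h' = y div 2 ^ h'"
  by (metis le_add_diff_inverse div_mult2_eq power_add)

lemma lev_eq: "lev x y \<le> h \<Longrightarrow> x div 2 ^ Suc h = y div 2 ^ Suc h"
  using LeastI_ex[OF lev_exists[of x y]] div_eq_mono[of x "Suc (lev x y)" y "Suc h"] unfolding lev_def by simp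

lemma lev_less:
  assumes "x < y"
  shows "x div 2 ^ lev x y < y div 2 ^ lev x y"
proof -
  have "x div 2 ^ lev x y \<noteq> y div 2 ^ lev x y"
  proof (cases "lev x y")
    case 0
    then show ?thesis using assms by simp
  next
    case (Suc h)
    then have "h < lev x y" by simp
    then have "x div 2 ^ Suc h \<noteq> y div 2 ^ Suc h" unfolding lev_def by (rule not_less_Least)
    then show ?thesis using Suc by simp
  qed
  moreover have "x div 2 ^ lev x y \<le> y div 2 ^ lev x y" using assms by (intro div_le_mono) simp
  ultimately show ?thesis by simp
qed

lemma lev_bound:
  assumes "x < y" "y < 2 ^ t"
  shows "lev x y < t"
proof -
  have "t \<noteq> 0" using assms by (intro notI) simp
  then obtain t' where t: "t = Suc t'" by (cases t) auto
  have "x div 2 ^ Suc t' = y div 2 ^ Suc t'" using assms t by simp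
  then have "lev x y \<le> t'" unfolding lev_def by (rule Least_le)
  then show ?thesis using t by simp
qed

lemma lev_diff:
  assumes "x < y"
  shows "y - x < 2 ^ Suc (lev x y)"
proof -
  let ?q = "2 ^ Suc (lev x y) :: nat"
  have "x div ?q = y div ?q" using lev_eq[of x y "lev x y"] by simp
  then have "y - x = y mod ?q - x mod ?q"
    using div_mult_mod_eq[of x ?q] div_mult_mod_eq[of y ?q] by (metis diff_add_inverse diff_diff_left)
  also have "\<dots> < ?q" using mod_less_divisor[of ?q y] by (meson less_imp_diff_less zero_less_numeral zero_less_power)
  finally show ?thesis .
qed

lemma half_parity: "u < v \<Longrightarrow> (u :: nat) div 2 = v div 2 \<Longrightarrow> even u \<and> odd v"
  by presburger

lemma half_parity_eq: "(u :: nat) div 2 = v div 2 \<Longrightarrow> even u = even v \<Longrightarrow> u = v"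
  by presburger

text \<open>In an increasing sequence the highest digit in which the first and the last element differ is the
maximum of the levels between neighbours, and there the first has the digit \<open>0\<close>, the last the digit \<open>1\<close>.\<close>

lemma level_parity:
  assumes ij: "i < j" and inc: "\<And>k. i \<le> k \<Longrightarrow> k < j \<Longrightarrow> x k < x (Suc k)"
    and H: "H = Max ((\<lambda>k. lev (x k) (x (Suc k))) ` {i..<j})"
  shows "even (x i div 2 ^ H) \<and> odd (x j div 2 ^ H)"
proof -
  let ?S = "(\<lambda>k. lev (x k) (x (Suc k))) ` {i..<j}"
  have S: "finite ?S" "?S \<noteq> {}" using ij by auto
  have le: "lev (x k) (x (Suc k)) \<le> H" if "i \<le> k" "k < j" for k
    unfolding H using S that by (intro Max_ge) auto
  have "H \<in> ?S" unfolding H using S by (rule Max_in)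
  then obtain k0 where k0: "i \<le> k0" "k0 < j" "H = lev (x k0) (x (Suc k0))" by auto
  have top: "i \<le> k \<Longrightarrow> k \<le> j \<Longrightarrow> x i div 2 ^ Suc H = x k div 2 ^ Suc H" for k
  proof (induction k rule: dec_induct)
    case (step k)
    then show ?case using lev_eq[OF le[of k]] by simp
  qed simp
  have mono: "x k div 2 ^ H \<le> x k' div 2 ^ H" if "i \<le> k" "k \<le> k'" "k' \<le> j" for k k'
    using that(2,3)
  proof (induction k' rule: dec_induct)
    case (step n)
    have "x n < x (Suc n)" using inc[of n] step that(1) by simp
    then have "x n div 2 ^ H \<le> x (Suc n) div 2 ^ H" by (intro div_le_mono) simp
    then show ?case using step by simp
  qed simp
  have "x i div 2 ^ H \<le> x k0 div 2 ^ H" using mono k0 by simp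
  also have "\<dots> < x (Suc k0) div 2 ^ H" unfolding k0(3) using inc k0 by (intro lev_less) auto
  also have "\<dots> \<le> x j div 2 ^ H" using mono k0 by simp
  finally have "x i div 2 ^ H < x j div 2 ^ H" .
  moreover have "x i div 2 ^ H div 2 = x j div 2 ^ H div 2"
    unfolding half_div using top[of j] ij by simp
  ultimately show ?thesis by (rule half_parity)
qed

definition elt :: "nat set \<Rightarrow> nat \<Rightarrow> nat" where
  "elt e i = sorted_list_of_set e ! i"

lemma elt_mem: "finite e \<Longrightarrow> i < card e \<Longrightarrow> elt e i \<in> e"
  unfolding elt_def by (metis length_sorted_list_of_set nth_mem set_sorted_list_of_set)

lemma elt_less: "finite e \<Longrightarrow> i < j \<Longrightarrow> j < card e \<Longrightarrow> elt e i < elt e j"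
  unfolding elt_def by (rule sorted_wrt_nth_less[OF strict_sorted_list_of_set]) simp_all

lemma elt_image: "finite e \<Longrightarrow> elt e ` {..<card e} = e"
  unfolding elt_def by (metis (no_types, lifting) atLeast0LessThan length_sorted_list_of_set list.set_map
      map_nth set_sorted_list_of_set set_upt)

text \<open>Link \<open>i\<close> joins the elements number \<open>i\<close> and \<open>i + 1\<close> of a sorted set, so the link with \<open>Suc i = a\<close> joins
the block of the first \<open>a\<close> elements to the rest. On the other links the colour determines each end from the other.\<close>

definition link_colour :: "(nat \<Rightarrow> nat \<Rightarrow> nat \<Rightarrow> nat) \<Rightarrow> nat \<Rightarrow> nat \<Rightarrow> nat \<Rightarrow> nat \<Rightarrow> nat \<times> nat" where
  "link_colour c a i x y = (lev x y, if Suc i = a then c (lev x y) (x mod 2 ^ lev x y) (y mod 2 ^ lev x y) else y - x)"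

definition edge_colour :: "(nat \<Rightarrow> nat \<Rightarrow> nat \<Rightarrow> nat) \<Rightarrow> nat \<Rightarrow> nat \<Rightarrow> nat set \<Rightarrow> nat \<Rightarrow> nat \<times> nat" where
  "edge_colour c a r e = (\<lambda>i\<in>{..<r - 1}. link_colour c a i (elt e i) (elt e (Suc i)))"

text \<open>A number cannot be the \<open>i\<close>-th element of one set of the class and the \<open>j\<close>-th element of another one, for
\<open>i < j\<close>: the colour determines the levels, and \<open>level_parity\<close> would give the number two different
digits. Hence the class is a blow-up of the graph of its middle links, in which a point carries the
first \<open>a\<close> elements and a line the remaining \<open>r - a\<close> ones.\<close>

lemma no_berge_cycle_in_colour_class:
  assumes m: "m \<ge> 1" and a: "1 \<le> a" "a < r" "a < 2 * m" "r - a < 2 * m"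
    and c: "\<And>h col. no_short_closed_walk m {(x, y). x < 2 ^ h \<and> y < 2 ^ h \<and> c h x y = col}"
    and len: "len = 2 * m \<or> len = 2 * m + 1"
  shows "\<not> bcycle {e. finite e \<and> card e = r \<and> edge_colour c a r e = \<gamma>} len"
proof -
  define C where "C = {e. finite e \<and> card e = r \<and> edge_colour c a r e = \<gamma>}"
  have fin: "finite e" "card e = r" if "e \<in> C" for e using that unfolding C_def by auto
  have col: "link_colour c a i (elt e i) (elt e (Suc i)) = \<gamma> i" if "e \<in> C" "Suc i < r" for e i
  proof -
    have "i < r - 1" using that by simp
    then show ?thesis using that unfolding C_def edge_colour_def by auto
  qed
  have less: "elt e i < elt e j" if "e \<in> C" "i < j" "j < r" for e i j
    using elt_less[of e i j] fin[OF that(1)] that by simp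
  have lev: "lev (elt e i) (elt e (Suc i)) = fst (\<gamma> i)" if "e \<in> C" "Suc i < r" for e i
    using arg_cong[OF col[OF that], of fst] unfolding link_colour_def by simp
  have diff: "elt e (Suc i) - elt e i = snd (\<gamma> i)" if "e \<in> C" "Suc i < r" "Suc i \<noteq> a" for e i
    using arg_cong[OF col[OF that(1,2)], of snd] that(3) unfolding link_colour_def by simp
  have sep: False if e: "e \<in> C" "e' \<in> C" "i < j" "j < r" "elt e i = elt e' j" for e e' i j
  proof -
    define H where "H = Max ((\<lambda>k. fst (\<gamma> k)) ` {i..<j})"
    have "H = Max ((\<lambda>k. lev (elt e k) (elt e (Suc k))) ` {i..<j})"
      unfolding H_def using lev[OF e(1)] e(4) by (intro arg_cong[of _ _ Max] image_cong) auto
    then have "even (elt e i div 2 ^ H)"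
      using level_parity[of i j "elt e" H] e less[OF e(1)] by auto
    moreover have "H = Max ((\<lambda>k. lev (elt e' k) (elt e' (Suc k))) ` {i..<j})"
      unfolding H_def using lev[OF e(2)] e(4) by (intro arg_cong[of _ _ Max] image_cong) auto
    then have "odd (elt e' j div 2 ^ H)"
      using level_parity[of i j "elt e'" H] e less[OF e(2)] by auto
    ultimately show False using e(5) by simp
  qed
  have role: "i = j" if "e \<in> C" "e' \<in> C" "i < r" "j < r" "elt e i = elt e' j" for e e' i j
    using sep[of e e' i j] sep[of e' e j i] that by (metis linorder_neqE_nat)
  have shift: "elt e i = elt e' i \<longleftrightarrow> elt e (Suc i) = elt e' (Suc i)" if "e \<in> C" "e' \<in> C" "Suc i < r" "Suc i \<noteq> a" for e e' i
    using diff[OF that(1,3,4)] diff[OF that(2,3,4)] less[OF that(1), of i "Suc i"] less[OF that(2), of i "Suc i"] that(3) by linarith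
  define P where "P e = elt e (a - 1)" for e
  define L where "L e = elt e a" for e
  have left: "elt e i = elt e' i \<longleftrightarrow> P e = P e'" if e: "e \<in> C" "e' \<in> C" "i < a" for e e' i
  proof -
    have "i \<le> a - 1" using e(3) by simp
    then show ?thesis
    proof (induction i rule: inc_induct)
      case base
      show ?case unfolding P_def ..
    next
      case (step n)
      then show ?case using shift[of e e' n] e a by auto
    qed
  qed
  have right: "elt e i = elt e' i \<longleftrightarrow> L e = L e'" if e: "e \<in> C" "e' \<in> C" "a \<le> i" "i < r" for e e' i
    using e(3,4)
  proof (induction i rule: dec_induct)
    case base
    show ?case unfolding L_def ..
  next
    case (step n)
    have "elt e n = elt e' n \<longleftrightarrow> elt e (Suc n) = elt e' (Suc n)"
      using e step by (intro shift) auto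
    then show ?case using step by simp
  qed
  have inj: "e = e'" if e: "e \<in> C" "e' \<in> C" "P e = P e'" "L e = L e'" for e e'
  proof -
    have "elt e i = elt e' i" if "i < r" for i
      using left[of e e' i] right[of e e' i] e that by (cases "i < a") auto
    then have "elt e ` {..<r} = elt e' ` {..<r}" by simp
    then show ?thesis using elt_image fin e by metis
  qed
  have "\<forall>v\<in>\<Union>C. \<exists>e i. e \<in> C \<and> i < r \<and> v = elt e i"
    using elt_image fin by (metis UnionE imageE lessThan_iff)
  then obtain he \<rho> where hr: "\<And>v. v \<in> \<Union>C \<Longrightarrow> he v \<in> C \<and> \<rho> v < r \<and> v = elt (he v) (\<rho> v)" by metis
  define \<pi> :: "nat \<Rightarrow> nat + nat" where "\<pi> v = (if \<rho> v < a then Inl (P (he v)) else Inr (L (he v)))" for v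
  have "\<not> bcycle C len"
  proof (rule no_berge_cycle_over_large_girth[of C \<pi> P L m len])
    fix e v assume e: "e \<in> C" "v \<in> e"
    have "v \<in> \<Union>C" using e by blast
    then have v: "he v \<in> C" "\<rho> v < r" "v = elt (he v) (\<rho> v)" using hr by blast+
    obtain i where i: "i < r" "v = elt e i" using elt_image[of e] fin[OF e(1)] e(2) by auto
    have "i = \<rho> v" using role[OF e(1) v(1) i(1) v(2)] i v by simp
    then have eq: "elt e (\<rho> v) = elt (he v) (\<rho> v)" using i v by simp
    show "\<pi> v = Inl (P e) \<or> \<pi> v = Inr (L e)"
      using left[OF e(1) v(1), of "\<rho> v"] right[OF e(1) v(1) _ v(2)] eq unfolding \<pi>_def by (cases "\<rho> v < a") auto
  next
    show "e = e'" if "e \<in> C" "e' \<in> C" "P e = P e'" "L e = L e'" for e e' using inj that by blast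
  next
    define h where "h = fst (\<gamma> (a - 1))"
    have sa: "Suc (a - 1) = a" using a by simp
    have props: "P e < L e" "P e div 2 ^ Suc h = L e div 2 ^ Suc h" "even (P e div 2 ^ h)" "odd (L e div 2 ^ h)"
      "c h (P e mod 2 ^ h) (L e mod 2 ^ h) = snd (\<gamma> (a - 1))" if e: "e \<in> C" for e
    proof -
      show lt: "P e < L e" unfolding P_def L_def using less[OF e, of "a - 1" a] a by simp
      have lv: "lev (P e) (L e) = h" unfolding P_def L_def h_def using lev[OF e, of "a - 1"] sa a by simp
      show top: "P e div 2 ^ Suc h = L e div 2 ^ Suc h" using lev_eq[of "P e" "L e" h] lv by simp
      have "P e div 2 ^ h < L e div 2 ^ h" using lev_less[OF lt] lv by simp
      moreover have "P e div 2 ^ h div 2 = L e div 2 ^ h div 2" unfolding half_div by (rule top)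
      ultimately show "even (P e div 2 ^ h)" "odd (L e div 2 ^ h)" using half_parity by blast+
      have "link_colour c a (a - 1) (P e) (L e) = \<gamma> (a - 1)"
        using col[OF e, of "a - 1"] sa a unfolding P_def L_def by simp
      then show "c h (P e mod 2 ^ h) (L e mod 2 ^ h) = snd (\<gamma> (a - 1))"
        unfolding link_colour_def lv using sa by (auto dest: arg_cong[of _ _ snd])
    qed
    \<comment> \<open>Reduction modulo \<open>2 ^ h\<close> leads to a class of the colouring \<open>c h\<close>. It is injective on the neighbours of a
      node, since these agree in the digits from \<open>h\<close> upwards.\<close>
    have rec: "x = x'" if x: "x div 2 ^ Suc h = x' div 2 ^ Suc h" "even (x div 2 ^ h) \<longleftrightarrow> even (x' div 2 ^ h)"
      "x mod 2 ^ h = x' mod 2 ^ h" for x x' :: nat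
    proof -
      have "x div 2 ^ h div 2 = x' div 2 ^ h div 2" unfolding half_div by (rule x(1))
      then have "x div 2 ^ h = x' div 2 ^ h" using x(2) by (rule half_parity_eq)
      then show ?thesis using x(3) by (metis div_mult_mod_eq)
    qed
    show "no_short_closed_walk m ((\<lambda>e. (P e, L e)) ` C)"
    proof (rule no_short_closed_walk_map[OF c[of h "snd (\<gamma> (a - 1))"], of _ "\<lambda>x. x mod 2 ^ h" "\<lambda>y. y mod 2 ^ h"])
      fix x y assume "(x, y) \<in> (\<lambda>e. (P e, L e)) ` C"
      then obtain e where e: "e \<in> C" "x = P e" "y = L e" by blast
      show "(x mod 2 ^ h, y mod 2 ^ h) \<in> {(x, y). x < 2 ^ h \<and> y < 2 ^ h \<and> c h x y = snd (\<gamma> (a - 1))}"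
        using props(5)[OF e(1)] e by simp
    next
      fix x x' y assume "(x, y) \<in> (\<lambda>e. (P e, L e)) ` C" "(x', y) \<in> (\<lambda>e. (P e, L e)) ` C" and mo: "x mod 2 ^ h = x' mod 2 ^ h"
      then obtain e e' where e: "e \<in> C" "x = P e" "y = L e" "e' \<in> C" "x' = P e'" "y = L e'" by blast
      show "x = x'"
      proof (rule rec[OF _ _ mo])
        show "x div 2 ^ Suc h = x' div 2 ^ Suc h" using props(2)[OF e(1)] props(2)[OF e(4)] e(2,3,5,6) by metis
        show "even (x div 2 ^ h) = even (x' div 2 ^ h)"
          unfolding e(2) e(5) using props(3)[OF e(1)] props(3)[OF e(4)] by blast
      qed
    next
      fix x y y' assume "(x, y) \<in> (\<lambda>e. (P e, L e)) ` C" "(x, y') \<in> (\<lambda>e. (P e, L e)) ` C" and mo: "y mod 2 ^ h = y' mod 2 ^ h"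
      then obtain e e' where e: "e \<in> C" "x = P e" "y = L e" "e' \<in> C" "x = P e'" "y' = L e'" by blast
      show "y = y'"
      proof (rule rec[OF _ _ mo])
        show "y div 2 ^ Suc h = y' div 2 ^ Suc h" using props(2)[OF e(1)] props(2)[OF e(4)] e(2,3,5,6) by metis
        show "even (y div 2 ^ h) = even (y' div 2 ^ h)"
          unfolding e(3) e(6) using props(4)[OF e(1)] props(4)[OF e(4)] by blast
      qed
    qed
  next
    fix nd :: "nat + nat"
    let ?S = "{v \<in> \<Union>C. \<pi> v = nd}"
    have injS: "inj_on \<rho> ?S"
    proof (rule inj_onI)
      fix v w assume vw: "v \<in> ?S" "w \<in> ?S" "\<rho> v = \<rho> w"
      have "v \<in> \<Union>C" "w \<in> \<Union>C" using vw by simp_all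
      then have v: "he v \<in> C" "\<rho> v < r" "v = elt (he v) (\<rho> v)"
        and w: "he w \<in> C" "\<rho> w < r" "w = elt (he w) (\<rho> w)" using hr by blast+
      have "\<pi> v = \<pi> w" using vw by simp
      then have "elt (he v) (\<rho> v) = elt (he w) (\<rho> v)"
        using left[OF v(1) w(1), of "\<rho> v"] right[OF v(1) w(1) _ v(2)] vw(3) unfolding \<pi>_def
        by (cases "\<rho> v < a") auto
      then show "v = w" using v(3) w(3) vw(3) by metis
    qed
    have "\<exists>T. \<rho> ` ?S \<subseteq> T \<and> finite T \<and> card T < 2 * m"
    proof (cases nd)
      case (Inl p)
      have "\<rho> ` ?S \<subseteq> {..<a}" using Inl unfolding \<pi>_def by (auto split: if_splits)
      then show ?thesis using a by (intro exI[of _ "{..<a}"]) simp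
    next
      case (Inr p)
      have "\<rho> ` ?S \<subseteq> {a..<r}" using Inr hr unfolding \<pi>_def by (fastforce split: if_splits)
      then show ?thesis using a by (intro exI[of _ "{a..<r}"]) simp
    qed
    then obtain T where T: "\<rho> ` ?S \<subseteq> T" "finite T" "card T < 2 * m" by blast
    have "finite (\<rho> ` ?S)" using T finite_subset by blast
    then have "finite ?S" using injS finite_imageD by blast
    moreover have "card ?S < 2 * m" using card_mono[OF T(2,1)] card_image[OF injS] T(3) by simp
    ultimately show "finite ?S \<and> card ?S < 2 * m" by blast
  qed (use len m in auto)
  then show ?thesis unfolding C_def .
qed

section \<open>The lower bound and the theorem\<close>

text \<open>The numbers of colours needed for the middle link at level \<open>h\<close> grow geometrically in \<open>h\<close>, so their sum
is dominated by the last one.\<close>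

lemma geometric_colour_count:
  assumes m: "m \<ge> 2"
  obtains C where "C > 0" "\<And>t. real (\<Sum>h<t. 2 ^ ((m - 1) * (h div m + 1))) \<le> C * (2 ^ t) powr (1 - 1 / real m)"
proof -
  define \<beta> where "\<beta> = (2 :: real) powr (1 - 1 / real m)"
  have ex: "1 - 1 / real m > 0" using m by (simp add: field_simps)
  have \<beta>1: "\<beta> > 1" unfolding \<beta>_def using ex by (intro gr_one_powr) auto
  have term_le: "real (2 ^ ((m - 1) * (h div m + 1))) \<le> 2 ^ (m - 1) * \<beta> ^ h" for h
  proof -
    have "real (h div m) \<le> real h / real m" by (rule of_nat_div_le_of_nat)
    then have "real (m - 1) * real (h div m) \<le> real (m - 1) * (real h / real m)" by (intro mult_left_mono) auto
    also have "\<dots> = (1 - 1 / real m) * real h" using m by (simp add: field_simps of_nat_diff)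
    finally have le: "real ((m - 1) * (h div m)) \<le> (1 - 1 / real m) * real h" by simp
    have "(2 :: real) ^ ((m - 1) * (h div m)) = 2 powr real ((m - 1) * (h div m))" by (rule powr_realpow[symmetric]) simp
    also have "\<dots> \<le> 2 powr ((1 - 1 / real m) * real h)" using le by (intro powr_mono) auto
    also have "\<dots> = \<beta> ^ h" unfolding \<beta>_def by (simp add: powr_powr[symmetric] powr_realpow)
    finally have "(2 :: real) ^ ((m - 1) * (h div m)) \<le> \<beta> ^ h" .
    then have "(2 :: real) ^ (m - 1) * 2 ^ ((m - 1) * (h div m)) \<le> 2 ^ (m - 1) * \<beta> ^ h" by (intro mult_left_mono) auto
    then show ?thesis by (simp add: power_add[symmetric] algebra_simps)
  qed
  have "real (\<Sum>h<t. 2 ^ ((m - 1) * (h div m + 1))) \<le> 2 ^ (m - 1) / (\<beta> - 1) * (2 ^ t) powr (1 - 1 / real m)" for t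
  proof -
    have "real (\<Sum>h<t. 2 ^ ((m - 1) * (h div m + 1))) \<le> (\<Sum>h<t. 2 ^ (m - 1) * \<beta> ^ h)"
      unfolding of_nat_sum by (intro sum_mono term_le)
    also have "\<dots> = 2 ^ (m - 1) * ((\<beta> ^ t - 1) / (\<beta> - 1))"
      using \<beta>1 by (simp add: sum_distrib_left[symmetric] geometric_sum)
    also have "\<dots> \<le> 2 ^ (m - 1) * (\<beta> ^ t / (\<beta> - 1))"
      using \<beta>1 by (intro mult_left_mono divide_right_mono) auto
    also have "\<beta> ^ t = (2 ^ t) powr (1 - 1 / real m)"
      unfolding \<beta>_def by (simp add: powr_realpow[symmetric] powr_powr mult.commute)
    finally show ?thesis by (simp add: field_simps)
  qed
  moreover have "2 ^ (m - 1) / (\<beta> - 1) > 0" using \<beta>1 by simp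
  ultimately show thesis using that by blast
qed

text \<open>The colours form a product over the \<open>r - 1\<close> links: each of the \<open>r - 2\<close> outer links contributes a factor of
\<open>2 * 2 ^ t\<close> at most, and the middle link a multiple of \<open>(2 ^ t) powr (1 - 1 / m)\<close>.\<close>

lemma cycle_free_colouring:
  assumes m: "m \<in> {2, 3, 5}" and r: "2 \<le> r" "r < 4 * m - 1"
  obtains C where "C > 0" "\<And>t k len. \<lbrakk>len = 2 * m \<or> len = 2 * m + 1;
     C * (2 ^ t) powr (real r - 1 - 1 / real m) \<le> real k\<rbrakk> \<Longrightarrow> \<not> ramsey_property r (berge (cycle_graph len)) k (2 ^ t)"
proof -
  have m2: "m \<ge> 2" using m by auto
  obtain C1 where C1: "C1 > 0" "\<And>t. real (\<Sum>h<t. 2 ^ ((m - 1) * (h div m + 1))) \<le> C1 * (2 ^ t) powr (1 - 1 / real m)"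
    using geometric_colour_count[OF m2] by blast
  define a where "a = r div 2"
  have a: "1 \<le> a" "a < r" "a < 2 * m" "r - a < 2 * m" unfolding a_def using r by auto
  have "\<forall>h. \<exists>c :: nat \<Rightarrow> nat \<Rightarrow> nat. (\<forall>x y. x < 2 ^ h \<longrightarrow> y < 2 ^ h \<longrightarrow> c x y < 2 ^ ((m - 1) * (h div m + 1))) \<and>
    (\<forall>col. no_short_closed_walk m {(x, y). x < 2 ^ h \<and> y < 2 ^ h \<and> c x y = col})"
  proof
    fix h
    obtain c :: "nat \<Rightarrow> nat \<Rightarrow> nat" where
      "\<And>x y. x < 2 ^ h \<Longrightarrow> y < 2 ^ h \<Longrightarrow> c x y < 2 ^ ((m - 1) * (h div m + 1))"
      "\<And>col. no_short_closed_walk m {(x, y). x < 2 ^ h \<and> y < 2 ^ h \<and> c x y = col}"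
      using pair_colouring[OF m, of h] by blast
    then show "\<exists>c :: nat \<Rightarrow> nat \<Rightarrow> nat. (\<forall>x y. x < 2 ^ h \<longrightarrow> y < 2 ^ h \<longrightarrow> c x y < 2 ^ ((m - 1) * (h div m + 1))) \<and>
      (\<forall>col. no_short_closed_walk m {(x, y). x < 2 ^ h \<and> y < 2 ^ h \<and> c x y = col})" by blast
  qed
  from choice[OF this] obtain c :: "nat \<Rightarrow> nat \<Rightarrow> nat \<Rightarrow> nat" where
    call: "\<forall>h. (\<forall>x y. x < 2 ^ h \<longrightarrow> y < 2 ^ h \<longrightarrow> c h x y < 2 ^ ((m - 1) * (h div m + 1))) \<and>
      (\<forall>col. no_short_closed_walk m {(x, y). x < 2 ^ h \<and> y < 2 ^ h \<and> c h x y = col})" by blast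
  have c: "\<And>h x y. x < 2 ^ h \<Longrightarrow> y < 2 ^ h \<Longrightarrow> c h x y < 2 ^ ((m - 1) * (h div m + 1))"
      "\<And>h col. no_short_closed_walk m {(x, y). x < 2 ^ h \<and> y < 2 ^ h \<and> c h x y = col}"
    using call by blast+
  define palette where "palette t i = (SIGMA h:{..<t}. {..<if Suc i = a then (2::nat) ^ ((m - 1) * (h div m + 1)) else 2 ^ Suc h})" for t i
  define Col where "Col t = (\<Pi>\<^sub>E i\<in>{..<r - 1}. palette t i)" for t
  have fpal: "finite (palette t i)" for t i unfolding palette_def by auto
  have fCol: "finite (Col t)" for t unfolding Col_def using fpal by (intro finite_PiE) auto
  have in_Col: "edge_colour c a r e \<in> Col t" if e: "e \<in> nsets {..<2 ^ t} r" for e t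
  proof -
    have fe: "finite e" "card e = r" "e \<subseteq> {..<2 ^ t}" using e by (auto simp: nsets_def)
    have "link_colour c a i (elt e i) (elt e (Suc i)) \<in> palette t i" if i: "i < r - 1" for i
    proof -
      have lt: "elt e i < elt e (Suc i)" using elt_less[OF fe(1), of i "Suc i"] fe i by simp
      have "elt e (Suc i) \<in> e" using elt_mem[OF fe(1), of "Suc i"] fe i by simp
      then have "lev (elt e i) (elt e (Suc i)) < t" using lev_bound[OF lt] fe(3) by blast
      then show ?thesis using lev_diff[OF lt] c(1) unfolding link_colour_def palette_def by auto
    qed
    then show ?thesis unfolding edge_colour_def Col_def by auto
  qed
  define C where "C = 2 ^ (r - 2) * C1"
  have card_Col: "real (card (Col t)) \<le> C * (2 ^ t) powr (real r - 1 - 1 / real m)" for t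
  proof -
    have ra: "a - 1 \<in> {..<r - 1}" using a by auto
    have "card (palette t i) \<le> 2 * 2 ^ t" if "Suc i \<noteq> a" for i
    proof -
      have "card (palette t i) = (\<Sum>h<t. 2 ^ Suc h)" using that unfolding palette_def by (simp add: card_SigmaI)
      also have "\<dots> = 2 * (\<Sum>h<t. 2 ^ h)" by (simp add: sum_distrib_left)
      also have "\<dots> \<le> 2 * 2 ^ t" using sum_power2[of t] by (simp add: atLeast0LessThan)
      finally show ?thesis .
    qed
    then have "(\<Prod>i\<in>{..<r - 1} - {a - 1}. card (palette t i)) \<le> (\<Prod>i\<in>{..<r - 1} - {a - 1}. 2 * 2 ^ t)"
      using a by (intro prod_mono) auto
    also have "\<dots> = (2 * 2 ^ t) ^ (r - 2)" using ra by (simp add: numeral_2_eq_2)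
    finally have p1: "(\<Prod>i\<in>{..<r - 1} - {a - 1}. card (palette t i)) \<le> (2 * 2 ^ t) ^ (r - 2)" .
    have "card (palette t (a - 1)) = (\<Sum>h<t. 2 ^ ((m - 1) * (h div m + 1)))"
      using a unfolding palette_def by (simp add: card_SigmaI)
    then have p2: "real (card (palette t (a - 1))) \<le> C1 * (2 ^ t) powr (1 - 1 / real m)" using C1(2)[of t] by simp
    have "card (Col t) = card (palette t (a - 1)) * (\<Prod>i\<in>{..<r - 1} - {a - 1}. card (palette t i))"
      unfolding Col_def using ra by (simp add: card_PiE prod.remove)
    then have "real (card (Col t)) = real (card (palette t (a - 1))) * real (\<Prod>i\<in>{..<r - 1} - {a - 1}. card (palette t i))"
      by simp
    also have "\<dots> \<le> (C1 * (2 ^ t) powr (1 - 1 / real m)) * real ((2 * 2 ^ t) ^ (r - 2))"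
    proof (rule mult_mono[OF p2])
      show "real (\<Prod>i\<in>{..<r - 1} - {a - 1}. card (palette t i)) \<le> real ((2 * 2 ^ t) ^ (r - 2))"
        unfolding of_nat_le_iff by (rule p1)
    qed (use C1(1) in \<open>auto intro!: prod_nonneg\<close>)
    also have "\<dots> = C * ((2 ^ t) powr (1 - 1 / real m) * (2 ^ t) ^ (r - 2))"
      unfolding C_def by (simp add: power_mult_distrib mult_ac)
    also have "(2 ^ t) powr (1 - 1 / real m) * (2 ^ t) ^ (r - 2) = ((2::real) ^ t) powr (1 - 1 / real m + real (r - 2))"
      by (simp add: powr_add powr_realpow)
    also have "1 - 1 / real m + real (r - 2) = real r - 1 - 1 / real m" using r by (simp add: of_nat_diff)
    finally show ?thesis .
  qed
  have "\<not> ramsey_property r (berge (cycle_graph len)) k (2 ^ t)"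
    if len: "len = 2 * m \<or> len = 2 * m + 1" and k: "C * (2 ^ t) powr (real r - 1 - 1 / real m) \<le> real k" for t k len
  proof
    have l3: "3 \<le> len" using len m2 by auto
    assume R: "ramsey_property r (berge (cycle_graph len)) k (2 ^ t)"
    have kC: "card (Col t) \<le> k" using order_trans[OF card_Col k] by simp
    obtain enc :: "(nat \<Rightarrow> nat \<times> nat) \<Rightarrow> nat" where enc: "bij_betw enc (Col t) {0..<card (Col t)}"
      using ex_bij_betw_finite_nat[OF fCol] by blast
    define f where "f e = enc (edge_colour c a r e)" for e
    have "f e < k" if "e \<in> nsets {..<2 ^ t} r" for e
      using bij_betw_apply[OF enc in_Col[OF that]] kC unfolding f_def by simp
    then have "f \<in> nsets {..<2 ^ t} r \<rightarrow> {..<k}" by simp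
    then obtain i where i: "bcycle {e \<in> nsets {..<2 ^ t} r. f e = i} len"
      using R unfolding ramsey_property_berge_cycle_iff[OF l3] by blast
    then obtain e0 where e0: "e0 \<in> nsets {..<2 ^ t} r" "f e0 = i" unfolding bcycle_def by blast
    have "{e \<in> nsets {..<2 ^ t} r. f e = i} \<subseteq> {e. finite e \<and> card e = r \<and> edge_colour c a r e = edge_colour c a r e0}"
    proof
      fix e assume e: "e \<in> {e \<in> nsets {..<2 ^ t} r. f e = i}"
      then have "enc (edge_colour c a r e) = enc (edge_colour c a r e0)" using e0 unfolding f_def by simp
      then have "edge_colour c a r e = edge_colour c a r e0"
        using inj_onD[OF bij_betw_imp_inj_on[OF enc]] in_Col e e0 by blast
      then show "e \<in> {e. finite e \<and> card e = r \<and> edge_colour c a r e = edge_colour c a r e0}"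
        using e by (simp add: nsets_def)
    qed
    from bcycle_mono[OF i this] show False
      using no_berge_cycle_in_colour_class[OF _ a c(2) len] m2 by simp
  qed
  moreover have "C > 0" unfolding C_def using C1(1) by simp
  ultimately show thesis using that by blast
qed

text \<open>Choose the largest \<open>t\<close> for which \<open>cycle_free_colouring\<close> needs at most \<open>k\<close> colours.\<close>

lemma ramsey_lower_bound:
  assumes m: "m \<in> {2, 3, 5}" and r: "2 \<le> r" "r < 4 * m - 1" and len: "len = 2 * m \<or> len = 2 * m + 1"
  obtains C k0 where "C > 0" "\<And>k n. k \<ge> k0 \<Longrightarrow> ramsey_property r (berge (cycle_graph len)) k n \<Longrightarrow>
     C * real k powr (1 / (real r - 1 - 1 / real m)) \<le> real n"
proof -
  define \<alpha> where "\<alpha> = real r - 1 - 1 / real m"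
  have "1 / real m \<le> 1 / 2" using m by auto
  moreover have "real r \<ge> 2" using r(1) by simp
  ultimately have \<alpha>: "\<alpha> > 0" unfolding \<alpha>_def by linarith
  obtain B where B: "B > 0" "\<And>t k. B * (2 ^ t) powr \<alpha> \<le> real k \<Longrightarrow> \<not> ramsey_property r (berge (cycle_graph len)) k (2 ^ t)"
    using cycle_free_colouring[OF m r] len unfolding \<alpha>_def by metis
  define C where "C = (1 / B) powr (1 / \<alpha>) / 2"
  have "C * real k powr (1 / \<alpha>) \<le> real n"
    if k: "k \<ge> nat \<lceil>B\<rceil>" and R: "ramsey_property r (berge (cycle_graph len)) k n" for k n
  proof -
    define x where "x = (real k / B) powr (1 / \<alpha>)"
    have kB: "real k / B \<ge> 1" using k B(1) by (simp add: field_simps)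
    then have x1: "x \<ge> 1" unfolding x_def using \<alpha> by (simp add: ge_one_powr_ge_zero)
    define t where "t = nat \<lfloor>log 2 x\<rfloor>"
    have l0: "log 2 x \<ge> 0" using x1 by simp
    have t: "real t \<le> log 2 x" "log 2 x < real t + 1" unfolding t_def using l0 by linarith+
    have "2 powr real t \<le> 2 powr log 2 x" using t(1) by (intro powr_mono) auto
    then have lo: "2 ^ t \<le> x" using x1 by (simp add: powr_realpow)
    have "2 powr log 2 x < 2 powr (real t + 1)" using t(2) by (intro powr_less_mono) auto
    then have hi: "x < 2 * 2 ^ t" using x1 by (simp add: powr_realpow powr_add)
    have "(2 ^ t) powr \<alpha> \<le> x powr \<alpha>" using lo \<alpha> by (intro powr_mono2) auto
    also have "\<dots> = real k / B" unfolding x_def using \<alpha> kB B(1) by (simp add: powr_powr)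
    finally have "B * (2 ^ t) powr \<alpha> \<le> real k" using B(1) by (simp add: field_simps)
    then have "\<not> ramsey_property r (berge (cycle_graph len)) k (2 ^ t)" by (rule B(2))
    then have "2 ^ t < n" using R ramsey_property_mono by (metis not_le)
    then have "2 ^ t < real n" by (metis of_nat_less_iff of_nat_numeral of_nat_power)
    then have "x / 2 < real n" using hi by linarith
    moreover have "x = (1 / B) powr (1 / \<alpha>) * real k powr (1 / \<alpha>)"
      unfolding x_def using B(1) by (simp add: powr_mult[symmetric])
    ultimately show ?thesis unfolding C_def by simp
  qed
  moreover have "C > 0" unfolding C_def using B(1) by simp
  ultimately show thesis using that unfolding \<alpha>_def by blast
qed

lemma ramsey_number_bigtheta:
  assumes m: "m \<in> {2, 3, 5}" and r: "2 \<le> r" "r < 4 * m - 1"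
    and len: "len = 2 * m \<or> (len = 2 * m + 1 \<and> r \<ge> 3)"
  shows "(\<lambda>k. real (ramsey_number r (berge (cycle_graph len)) k))
     \<in> \<Theta>(\<lambda>k. real k powr (real m / (real r * real m - real m - 1)))"
proof -
  have m2: "m \<ge> 2" using m by auto
  have ex: "1 / (real r - 1 - 1 / real m) = real m / (real r * real m - real m - 1)"
  proof -
    have "real r - 1 - 1 / real m = (real r * real m - real m - 1) / real m" using m2 by (simp add: field_simps)
    then show ?thesis by simp
  qed
  let ?R = "\<lambda>k. real (ramsey_number r (berge (cycle_graph len)) k)"
  let ?f = "\<lambda>k. real k powr (real m / (real r * real m - real m - 1))"
  obtain C1 where C1: "C1 > 0" "\<And>k. k \<ge> 1 \<Longrightarrow> \<exists>n. ramsey_property r (berge (cycle_graph len)) k n \<and> real n \<le> C1 * ?f k"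
    using ramsey_upper_bound[OF m2 r(1) len] unfolding ex by blast
  have len': "len = 2 * m \<or> len = 2 * m + 1" using len by auto
  obtain C0 k0 where C0: "C0 > 0" "\<And>k n. k \<ge> k0 \<Longrightarrow> ramsey_property r (berge (cycle_graph len)) k n \<Longrightarrow> C0 * ?f k \<le> real n"
    using ramsey_lower_bound[OF m r len'] unfolding ex by blast
  have up: "?R k \<le> C1 * ?f k" and holds: "ramsey_property r (berge (cycle_graph len)) k (ramsey_number r (berge (cycle_graph len)) k)"
    if k: "k \<ge> 1" for k
  proof -
    obtain n where n: "ramsey_property r (berge (cycle_graph len)) k n" "real n \<le> C1 * ?f k" using C1(2)[OF k] by blast
    have "ramsey_number r (berge (cycle_graph len)) k \<le> n" unfolding ramsey_number_def using n(1) by (rule Least_le)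
    then show "?R k \<le> C1 * ?f k" using n(2) by linarith
    show "ramsey_property r (berge (cycle_graph len)) k (ramsey_number r (berge (cycle_graph len)) k)"
      unfolding ramsey_number_def using n(1) by (rule LeastI)
  qed
  show ?thesis
  proof (rule bigthetaI')
    show "C0 > 0" "C1 > 0" using C0 C1 by auto
    show "\<forall>\<^sub>F k in at_top. C0 * norm (?f k) \<le> norm (?R k) \<and> norm (?R k) \<le> C1 * norm (?f k)"
      using eventually_ge_at_top[of "max 1 k0"]
    proof eventually_elim
      case (elim k)
      then show ?case using up[of k] C0(2)[OF _ holds[of k]] by simp
    qed
  qed
qed

theorem theorem1p2:
  fixes m r :: nat
  assumes "m \<in> {2, 3, 5}"
    and "2 \<le> r"
    and "r < 4 * m - 1"
  shows "(\<lambda>k. real (ramsey_number r (berge (cycle_graph (2 * m))) k))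
           \<in> \<Theta>(\<lambda>k. real k powr (real m / (real r * real m - real m - 1))) \<and>
         (r \<noteq> 2 \<longrightarrow>
           (\<lambda>k. real (ramsey_number r (berge (cycle_graph (2 * m + 1))) k))
             \<in> \<Theta>(\<lambda>k. real k powr (real m / (real r * real m - real m - 1))))"
proof (intro conjI impI)
  show "(\<lambda>k. real (ramsey_number r (berge (cycle_graph (2 * m))) k))
           \<in> \<Theta>(\<lambda>k. real k powr (real m / (real r * real m - real m - 1)))"
    by (rule ramsey_number_bigtheta[OF assms]) simp
  assume "r \<noteq> 2"
  then show "(\<lambda>k. real (ramsey_number r (berge (cycle_graph (2 * m + 1))) k))
           \<in> \<Theta>(\<lambda>k. real k powr (real m / (real r * real m - real m - 1)))"
    using assms(2) by (intro ramsey_number_bigtheta[OF assms]) simp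
qed

end
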